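(* Let $\mathcal{H}$ be a real Hilbert space, $r$ a strictly positive integer, $z\in\mathcal{H}$, $f\in\Gamma_0(\mathcal{H})$, and $\ell\colon\mathcal{H}\to\mathbb{R}$ differentiable convex with $\mu$-Lipschitzian gradient for some $\mu\in[0,+\infty[$. For every $k\in\{1,\ldots,r\}$ let $\mathcal{G}_k,\mathcal{K}_k$ be real Hilbert spaces, $g_k\in\Gamma_0(\mathcal{G}_k)$, $h_k\in\Gamma_0(\mathcal{K}_k)$, and $L_k\colon\mathcal{H}\to\mathcal{G}_k$, $M_k\colon\mathcal{H}\to\mathcal{K}_k$ bounded linear operators. Assume $\beta=\mu+\sqrt{\sum_{k=1}^r\|L_k\|^2+\max_{1\le k\le r}(\|L_k\|^2+\|M_k\|^2)}>0$, that for every $k$, $0\in\operatorname{sri}\big(\operatorname{dom}(g_k\circ L_k)^*-M_k^*(\operatorname{dom}h_k^* )\big)$ and $0\in\operatorname{sri}(\operatorname{ran}M_k-\operatorname{dom}h_k)$, and that $z\in\operatorname{ran}\Big(\partial f+\sum_{k=1}^r\big((L_k^*\circ(\partial g_k)\circ L_k)\,\square\,(M_k^*\circ(\partial h_k)\circ M_k)\big)+\nabla\ell\Big)$. Consider the primal problem (P) minimize over $x\in\mathcal{H}$: $f(x)+\sum_{k=1}^r\big((g_k\circ L_k)\,\square\,(h_k\circ M_k)\big)(x)+\ell(x)-\langle x,z\rangle$, and the dual problem (D) minimize over $v_1\in\mathcal{G}_1,\ldots,v_r\in\mathcal{G}_r$: $(f^*\,\square\,\ell^* )\big(z-\sum_{k=1}^rL_k^*v_k\big)+\sum_{k=1}^r\big(g_k^*(v_k)+(M_k^*\triangleright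 h_k^* )(L_k^*v_k)\big)$. Let $x_0,y_{1,0},\ldots,y_{r,0}\in\mathcal{H}$, $v_{k,0}\in\mathcal{G}_k$, $w_{k,0}\in\mathcal{K}_k$, let $\varepsilon\in\left]0,1/(\beta+1)\right[$, let $(\gamma_n)_{n\in\mathbb{N}}$ be a sequence in $[\varepsilon,(1-\varepsilon)/\beta]$, and for $n=0,1,\ldots$ set $s_{1,1,n}\approx x_n-\gamma_n\big(\nabla\ell(x_n)+\sum_{k=1}^rL_k^*v_{k,n}\big)$, $p_{1,1,n}\approx\operatorname{prox}_{\gamma_nf}(s_{1,1,n}+\gamma_nz)$, and for $k=1,\ldots,r$: $p_{1,k+1,n}\approx y_{k,n}+\gamma_n(L_k^*v_{k,n}-M_k^*w_{k,n})$, $s_{2,k,n}\approx v_{k,n}+\gamma_nL_k(x_n-y_{k,n})$, $p_{2,k,n}\approx s_{2,k,n}-\gamma_n\operatorname{prox}_{\gamma_n^{-1}g_k}(\gamma_n^{-1}s_{2,k,n})$, $q_{2,k,n}\approx p_{2,k,n}+\gamma_nL_k(p_{1,1,n}-p_{1,k+1,n})$, $v_{k,n+1}=v_{k,n}-s_{2,k,n}+q_{2,k,n}$, $s_{2,k+r,n}\approx w_{k,n}+\gamma_nM_ky_{k,n}$, $p_{2,k+r,n}\approx s_{2,k+r,n}-\gamma_n\operatorname{prox}_{\gamma_n^{-1}h_k}(\gamma_n^{-1}s_{2,k+r,n})$, $q_{1,k+1,n}\approx p_{1,k+1,n}+\gamma_n(L_k^*p_{2,k,n}-M_k^*p_{2,k+r,n})$,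 $q_{2,k+r,n}\approx p_{2,k+r,n}+\gamma_nM_kp_{1,k+1,n}$, $w_{k,n+1}=w_{k,n}-s_{2,k+r,n}+q_{2,k+r,n}$; then $q_{1,1,n}\approx p_{1,1,n}-\gamma_n\big(\nabla\ell(p_{1,1,n})+\sum_{k=1}^rL_k^*p_{2,k,n}\big)$, $x_{n+1}=x_n-s_{1,1,n}+q_{1,1,n}$, and for $k=1,\ldots,r$: $y_{k,n+1}=y_{k,n}-p_{1,k+1,n}+q_{1,k+1,n}$. Then there exist a solution $\overline{x}$ to (P) and a solution $(\overline{v_1},\ldots,\overline{v_r})$ to (D) such that: (i) $x_n\rightharpoonup\overline{x}$ and $v_{k,n}\rightharpoonup\overline{v_k}$ for every $k$; (ii) if $f$ or $\ell$ is uniformly convex at $\overline{x}$, then $x_n\to\overline{x}$; (iii) if, for some $k\in\{1,\ldots,r\}$, $g_k^*$ is uniformly convex at $\overline{v_k}$, then $v_{k,n}\to\overline{v_k}$.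
   Context: $\Gamma_0(\mathcal{X})$ is the class of lower semicontinuous convex functions $\mathcal{X}\to\left]-\infty,+\infty\right]$ with nonempty domain; $\varphi^*$ is the Fenchel conjugate, $\partial\varphi$ the subdifferential, and $\operatorname{prox}_\varphi x$ the unique minimizer of $\varphi+\tfrac12\|x-\cdot\|^2$. For a convex set $S$, $\operatorname{sri}S$ is the set of $x\in S$ such that the cone generated by $-x+S$ is a closed vector subspace. Functions: $(\varphi_1\,\square\,\varphi_2)(x)=\inf_y(\varphi_1(x-y)+\varphi_2(y))$ (infimal convolution) and $(L\triangleright\varphi)(y)=\inf\{\varphi(x):Lx=y\}$ (infimal postcomposition). Operators: $T^{-1}$ is the inverse, $\operatorname{ran}$ the range, $T_1\,\square\,T_2=(T_1^{-1}+T_2^{-1})^{-1}$. $\rightharpoonup$ and $\to$ denote weak and strong convergence. Error tolerance: "$a_n\approx b_n$" means $\sum_n\|a_n-b_n\|<+\infty$, i.e., each such quantity is computed with summable errors. A function $\varphi$ is uniformly convex at $x\in\operatorname{dom}\varphi$ if there is an increasing $\phi\colon[0,+\infty[\to[0,+\infty]$ vanishing only at $0$ with $\varphi(\alpha x+(1-\alpha)y)+\alpha(1-\alpha)\phi(\|x-y\|)\le\alpha\varphi(x)+(1-\alpha)\varphi(y)$ for all $y\in\operatorname{dom}\varphi$ and $\alpha\in\left]0,1\right[$. *)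

theory Defs
  imports "HOL-Analysis.Analysis"
begin

text \<open>Real Hilbert spaces are modelled as closed linear subspaces S of a complete
real inner product space (the ambient type). The primal space H is a whole type
(carrier UNIV). Extended-real valued functions are only relevant on their carrier S.\<close>

definition hilbert_sub :: "'a::{real_inner,complete_space} set \<Rightarrow> bool" where
  "hilbert_sub S \<longleftrightarrow> subspace S \<and> closed S"

definition edom :: "'a::real_inner set \<Rightarrow> ('a \<Rightarrow> ereal) \<Rightarrow> 'a set" where
  "edom S f = {x \<in> S. f x < \<infinity>}"

definition Gamma0 :: "'a::real_inner set \<Rightarrow> ('a \<Rightarrow> ereal) \<Rightarrow> bool" where
  "Gamma0 S f \<longleftrightarrow>
     (\<forall>x\<in>S. f x \<noteq> -\<infinity>) \<and> edom S f \<noteq> {} \<and>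
     (\<forall>x\<in>S. \<forall>y\<in>S. \<forall>t\<in>{0<..<1::real}.
        f ((1 - t) *\<^sub>R x + t *\<^sub>R y) \<le> ereal (1 - t) * f x + ereal t * f y) \<and>
     (\<forall>c::ereal. closedin (top_of_set S) {x \<in> S. f x \<le> c})"

definition conj :: "'a::real_inner set \<Rightarrow> ('a \<Rightarrow> ereal) \<Rightarrow> 'a \<Rightarrow> ereal" where
  "conj S f u = (SUP v\<in>S. ereal (u \<bullet> v) - f v)"

definition subdiff :: "'a::real_inner set \<Rightarrow> ('a \<Rightarrow> ereal) \<Rightarrow> 'a \<Rightarrow> 'a set" where
  "subdiff S f x = {u \<in> S. x \<in> S \<and> f x < \<infinity> \<and>
      (\<forall>y\<in>S. ereal ((y - x) \<bullet> u) + f x \<le> f y)}"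

definition prox :: "'a::real_inner set \<Rightarrow> ('a \<Rightarrow> ereal) \<Rightarrow> 'a \<Rightarrow> 'a" where
  "prox S f x = (THE p. p \<in> S \<and>
      (\<forall>y\<in>S. f p + ereal ((norm (x - p))\<^sup>2 / 2) \<le> f y + ereal ((norm (x - y))\<^sup>2 / 2)))"

definition infconv :: "'a::real_inner set \<Rightarrow> ('a \<Rightarrow> ereal) \<Rightarrow> ('a \<Rightarrow> ereal) \<Rightarrow> 'a \<Rightarrow> ereal" where
  "infconv S f1 f2 x = (INF y\<in>S. f1 (x - y) + f2 y)"

definition infpost :: "'a::real_inner set \<Rightarrow> ('a \<Rightarrow> 'b) \<Rightarrow> ('a \<Rightarrow> ereal) \<Rightarrow> 'b \<Rightarrow> ereal" where
  "infpost S L f y = (INF x\<in>{x \<in> S. L x = y}. f x)"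

definition sri :: "'a::real_normed_vector set \<Rightarrow> 'a set" where
  "sri C = {x \<in> C. subspace {t *\<^sub>R (y - x) | t y. t \<ge> 0 \<and> y \<in> C} \<and>
                   closed {t *\<^sub>R (y - x) | t y. t \<ge> 0 \<and> y \<in> C}}"

definition set_diff :: "'a::ab_group_add set \<Rightarrow> 'a set \<Rightarrow> 'a set" where
  "set_diff A B = {a - b | a b. a \<in> A \<and> b \<in> B}"

definition op_inv :: "('a \<Rightarrow> 'b set) \<Rightarrow> 'b \<Rightarrow> 'a set" where
  "op_inv A y = {x. y \<in> A x}"

definition op_add :: "('a \<Rightarrow> 'b::ab_group_add set) \<Rightarrow> ('a \<Rightarrow> 'b set) \<Rightarrow> 'a \<Rightarrow> 'b set" where
  "op_add A B x = {a + b | a b. a \<in> A x \<and> b \<in> B x}"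

definition op_sum :: "'i set \<Rightarrow> ('i \<Rightarrow> 'a \<Rightarrow> 'b::comm_monoid_add set) \<Rightarrow> 'a \<Rightarrow> 'b set" where
  "op_sum I A x = {(\<Sum>i\<in>I. a i) | a. \<forall>i\<in>I. a i \<in> A i x}"

definition op_parsum :: "('a::ab_group_add \<Rightarrow> 'a set) \<Rightarrow> ('a \<Rightarrow> 'a set) \<Rightarrow> 'a \<Rightarrow> 'a set" where
  "op_parsum A B = op_inv (op_add (op_inv A) (op_inv B))"

definition op_ran :: "('a \<Rightarrow> 'b set) \<Rightarrow> 'b set" where
  "op_ran A = {y. \<exists>x. y \<in> A x}"

definition op_compose :: "('a::real_inner \<Rightarrow> 'b::real_inner) \<Rightarrow> ('b \<Rightarrow> 'b set) \<Rightarrow> 'a \<Rightarrow> 'a set" where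
  "op_compose L A x = adjoint L ` A (L x)"

definition weak_conv :: "'a::real_inner set \<Rightarrow> (nat \<Rightarrow> 'a) \<Rightarrow> 'a \<Rightarrow> bool" where
  "weak_conv S xs x \<longleftrightarrow> (\<forall>u\<in>S. (\<lambda>n. xs n \<bullet> u) \<longlonglongrightarrow> x \<bullet> u)"

definition unif_convex_at :: "'a::real_inner set \<Rightarrow> ('a \<Rightarrow> ereal) \<Rightarrow> 'a \<Rightarrow> bool" where
  "unif_convex_at S f x \<longleftrightarrow> x \<in> edom S f \<and>
     (\<exists>\<phi>::real \<Rightarrow> ereal. mono_on {0..} \<phi> \<and> (\<forall>t\<ge>0. \<phi> t \<ge> 0) \<and>
        (\<forall>t\<ge>0. \<phi> t = 0 \<longleftrightarrow> t = 0) \<and>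
        (\<forall>y\<in>edom S f. \<forall>\<alpha>\<in>{0<..<1::real}.
           f (\<alpha> *\<^sub>R x + (1 - \<alpha>) *\<^sub>R y) + ereal (\<alpha> * (1 - \<alpha>)) * \<phi> (norm (x - y))
             \<le> ereal \<alpha> * f x + ereal (1 - \<alpha>) * f y))"

end

theory Submission
  imports Defs "HOL-Library.Poly_Mapping"
begin

text \<open>The algorithm is Tseng's forward-backward-forward method in the product space of the
  variables \<open>(x, (y\<^sub>k, v\<^sub>k, w\<^sub>k)\<^sub>k)\<close>, applied to \<open>0 \<in> A + B\<close> where \<open>A\<close> collects \<open>\<partial>f - z\<close> and the
  inverses of \<open>\<partial>g\<^sub>k\<close> and \<open>\<partial>h\<^sub>k\<close>, and \<open>B\<close> is \<open>\<nabla>\<ell>\<close> plus a skew linear coupling, hence monotone and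
  \<open>\<beta>\<close>-Lipschitz. The iterates are quasi-Fejer monotone with respect to the zeros, and weak cluster points are
  zeros by Minty's argument, which gives weak convergence. At a zero, all subgradient and
  Fenchel-Young relations are equalities that add up to the optimality of \<open>x\<close> for the primal and of
  \<open>v\<close> for the dual problem. Strong convergence holds because the monotonicity products of the individual
  components vanish in the limit, and uniform convexity bounds the distance by such a product.

  The number \<open>r\<close> of blocks is a term and not a type, so the product space is realised as a space of finitely
  supported families. Such a space is not complete as a whole; therefore completeness
  is demanded of the subspaces in use and not of the types.\<close>

section \<open>Proximity operators and the Riesz representation\<close>

text \<open>The auxiliary points \<open>y k\<close> split the infimal convolutions: the first
  summand is evaluated at \<open>x - y k\<close>, the second at \<open>y k\<close>. Equality of the
  two composed subgradients becomes the y-row of the inclusion, so the range condition supplies a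
  zero of A + B. Compositions with \<open>L k\<close> and \<open>M k\<close> sit in the linear
  coupling, and no resolvent of such a composition is ever taken. The coupling exchanges the primal
  rows (x, y) and the dual rows (v, w), and its two halves are adjoint to each other up to sign. The
  bound for one half therefore serves for the whole; this is the square root in beta, to which the
  gradient adds mu. The step size range makes 1 - (gamma n * beta)^2 at least eps, the margin by
  which an exact step approaches every zero. Errors are confined to one place: an exact step is
  built from the true iterate, and the perturbed successor differs from it by a summable amount.
  Strong convergence is shown for the exact backward points, whose residuals tend to 0, and then
  carried to the iterates.\<close>

lemma Gamma0_convexD:
  assumes "Gamma0 S f" "x \<in> S" "y \<in> S" "0 < t" "t < 1"
  shows "f ((1 - t) *\<^sub>R x + t *\<^sub>R y) \<le> ereal (1 - t) * f x + ereal t * f y"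
  using assms by (auto simp: Gamma0_def)

lemma Gamma0_not_MInf: "Gamma0 S f \<Longrightarrow> x \<in> S \<Longrightarrow> f x \<noteq> -\<infinity>"
  by (auto simp: Gamma0_def)

lemma Gamma0_closedin: "Gamma0 S f \<Longrightarrow> closedin (top_of_set S) {x \<in> S. f x \<le> c}"
  by (auto simp: Gamma0_def)

text \<open>Lower semicontinuity keeps \<open>f\<close> above \<open>f x0 - 1\<close> on a ball
  around a point \<open>x0\<close> of the domain; convexity on the segment from \<open>x0\<close> to
  a distant \<open>y\<close> turns this into at most linear decay. This plays the part of an affine
  minorant.\<close>

lemma Gamma0_norm_minorant:
  assumes f: "Gamma0 S f" and S: "subspace S"
  shows "\<exists>a b. b \<ge> 0 \<and> (\<forall>y\<in>S. ereal (a - b * norm y) \<le> f y)"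
proof -
  obtain x0 where x0: "x0 \<in> S" "f x0 < \<infinity>"
    using f by (auto simp: Gamma0_def edom_def)
  moreover have "f x0 \<noteq> -\<infinity>" using x0 by (intro Gamma0_not_MInf[OF f])
  ultimately obtain c where c: "f x0 = ereal c" by (cases "f x0") auto
  have "closedin (top_of_set S) {x \<in> S. f x \<le> ereal (c - 1)}"
    by (rule Gamma0_closedin[OF f])
  then obtain T where T: "closed T" "{x \<in> S. f x \<le> ereal (c - 1)} = S \<inter> T"
    by (auto simp: closedin_closed)
  have "x0 \<notin> T"
  proof
    assume "x0 \<in> T"
    then have "x0 \<in> {x \<in> S. f x \<le> ereal (c - 1)}" unfolding T(2) using x0 by simp
    then show False using c by simp
  qed
  then obtain e where e: "e > 0" "\<And>y. dist y x0 < e \<Longrightarrow> y \<notin> T"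
    using T(1) by (metis open_Compl open_dist ComplI ComplD)
  define d where "d = e / 2"
  have d: "d > 0" using e by (simp add: d_def)
  have near: "f y > ereal (c - 1)" if "y \<in> S" "norm (y - x0) \<le> d" for y
  proof -
    have "y \<notin> T" using e that by (intro e) (auto simp: dist_norm d_def)
    then show ?thesis using T(2) that by (metis (no_types, lifting) Int_iff mem_Collect_eq not_le_imp_less)
  qed
  have minor: "ereal (c - 1 - norm (y - x0) / d) \<le> f y" if y: "y \<in> S" for y
  proof (cases "norm (y - x0) \<le> d")
    case True
    have "ereal (c - 1 - norm (y - x0) / d) \<le> ereal (c - 1)" using d by simp
    also have "\<dots> \<le> f y" using near[OF y True] by simp
    finally show ?thesis .
  next
    case False
    \<comment> \<open>This \<open>t\<close> places \<open>?m\<close> on the sphere of radius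
      \<open>d\<close> around \<open>x0\<close>, where the lower bound is already known.\<close>
    define t where "t = d / norm (y - x0)"
    have t: "0 < t" "t < 1" using False d by (auto simp: t_def divide_simps)
    let ?m = "(1 - t) *\<^sub>R x0 + t *\<^sub>R y"
    have mS: "?m \<in> S" using S x0 y by (simp add: subspace_add subspace_scale)
    have "?m - x0 = t *\<^sub>R (y - x0)" by (simp add: algebra_simps)
    then have "norm (?m - x0) \<le> d" using False d t by (simp add: t_def)
    then have "ereal (c - 1) < f ?m" using near mS by blast
    also have "f ?m \<le> ereal (1 - t) * f x0 + ereal t * f y"
      using x0 y t by (intro Gamma0_convexD[OF f])
    finally have *: "ereal (c - 1) < ereal ((1 - t) * c) + ereal t * f y" by (simp add: c)
    show ?thesis
    proof (cases "f y")
      case (real v)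
      have "c - 1 < (1 - t) * c + t * v" using * real by simp
      then have "t * (c - v) < 1" by (simp add: algebra_simps)
      then have "c - v < 1 / t" using t by (simp add: field_simps)
      then show ?thesis using real by (simp add: t_def)
    next
      case MInf
      then show ?thesis using Gamma0_not_MInf[OF f y] by simp
    qed simp
  qed
  show ?thesis
  proof (rule exI[of _ "c - 1 - norm x0 / d"], rule exI[of _ "1 / d"], intro conjI ballI)
    fix y assume y: "y \<in> S"
    have "norm (y - x0) / d \<le> (norm y + norm x0) / d"
      using d by (intro divide_right_mono) (auto simp: norm_triangle_ineq4)
    then have "ereal (c - 1 - norm x0 / d - 1 / d * norm y) \<le> ereal (c - 1 - norm (y - x0) / d)"
      by (simp add: add_divide_distrib)
    also have "\<dots> \<le> f y" using minor y by blast
    finally show "ereal (c - 1 - norm x0 / d - 1 / d * norm y) \<le> f y" .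
  qed (use d in auto)
qed

text \<open>Parallelogram law for \<open>x - a\<close> and \<open>x - b\<close>. The last term is
  what makes minimising sequences Cauchy.\<close>

lemma midpoint_norm_identity:
  fixes x a b :: "'a::real_inner"
  shows "(norm (x - ((1/2) *\<^sub>R a + (1/2) *\<^sub>R b)))\<^sup>2
    = (norm (x - a))\<^sup>2 / 2 + (norm (x - b))\<^sup>2 / 2 - (norm (a - b))\<^sup>2 / 4"
proof -
  define p q where "p = x - a" and "q = x - b"
  have "x - ((1/2) *\<^sub>R a + (1/2) *\<^sub>R b) = (1/2) *\<^sub>R p + (1/2) *\<^sub>R q"
    unfolding p_def q_def by (simp add: scaleR_diff_right scaleR_left_distrib[symmetric])
  moreover have "a - b = q - p" by (simp add: p_def q_def)
  ultimately show ?thesis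
    unfolding p_def[symmetric] q_def[symmetric]
    by (simp add: power2_norm_eq_inner inner_add_left inner_add_right inner_diff_left
        inner_diff_right inner_commute[of q p] add_divide_distrib diff_divide_distrib)
qed

lemma norm_diff_scaleR_sq:
  fixes u v :: "'a::real_inner"
  shows "(norm (u - t *\<^sub>R v))\<^sup>2 = (norm u)\<^sup>2 - 2 * t * (v \<bullet> u) + t\<^sup>2 * (norm v)\<^sup>2"
  by (simp add: power2_norm_eq_inner inner_diff_left inner_diff_right inner_commute[of u v])
    (simp add: power2_eq_square algebra_simps)

text \<open>Direct method without weak compactness: the quadratic term makes a minimising sequence
  Cauchy, completeness of \<open>S\<close> supplies a limit, and closedness of the sublevel sets
  shows that the limit is a minimiser.\<close>

lemma prox_minimizer_exists:
  fixes S :: "'a::real_inner set"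
  assumes f: "Gamma0 S f" and S: "subspace S" "complete S"
  shows "\<exists>p\<in>S. \<forall>y\<in>S. f p + ereal ((norm (x - p))\<^sup>2 / 2) \<le> f y + ereal ((norm (x - y))\<^sup>2 / 2)"
proof -
  obtain a b where b: "b \<ge> 0" and ab: "\<forall>y\<in>S. ereal (a - b * norm y) \<le> f y"
    using Gamma0_norm_minorant[OF f S(1)] by (elim exE conjE)
  define \<phi> where "\<phi> y = f y + ereal ((norm (x - y))\<^sup>2 / 2)" for y
  have lower: "ereal (a - b * norm x - b\<^sup>2 / 2) \<le> \<phi> y" if "y \<in> S" for y
  proof -
    have "norm y \<le> norm x + norm (x - y)"
      by (metis norm_triangle_sub norm_minus_commute)
    then have "b * norm y \<le> b * norm x + b * norm (x - y)"
      using b by (metis distrib_left mult_left_mono)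
    \<comment> \<open>Completing the square absorbs the linear decay of the minorant into the
      quadratic term.\<close>
    moreover have "0 \<le> (norm (x - y) - b)\<^sup>2" by simp
    then have "b * norm (x - y) \<le> (norm (x - y))\<^sup>2 / 2 + b\<^sup>2 / 2"
      by (simp add: power2_diff field_simps)
    ultimately have "ereal (a - b * norm x - b\<^sup>2 / 2)
        \<le> ereal (a - b * norm y) + ereal ((norm (x - y))\<^sup>2 / 2)" by simp
    also have "\<dots> \<le> \<phi> y" unfolding \<phi>_def by (intro add_right_mono ab[rule_format] that)
    finally show ?thesis .
  qed
  obtain x0 where x0: "x0 \<in> S" "f x0 < \<infinity>"
    using f by (auto simp: Gamma0_def edom_def)
  define m where "m = (INF y\<in>S. \<phi> y)"
  have "m \<le> \<phi> x0" unfolding m_def using x0 by (intro INF_lower)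
  also have "\<phi> x0 < \<infinity>" using x0 by (simp add: \<phi>_def)
  finally have "m < \<infinity>" .
  moreover have "ereal (a - b * norm x - b\<^sup>2 / 2) \<le> m"
    unfolding m_def using lower by (intro INF_greatest)
  ultimately obtain c where c: "m = ereal c" by (cases m) auto
  have cl: "ereal c \<le> \<phi> y" if "y \<in> S" for y
    unfolding c[symmetric] m_def using that by (intro INF_lower)
  have "\<exists>y\<in>S. \<phi> y < ereal (c + 1 / Suc n)" for n
  proof -
    have "m < ereal (c + 1 / Suc n)" using c by simp
    then show ?thesis unfolding m_def by (simp add: INF_less_iff)
  qed
  then obtain Y where Y: "\<And>n. Y n \<in> S" "\<And>n. \<phi> (Y n) < ereal (c + 1 / Suc n)" by metis
  have "\<exists>v. f (Y n) = ereal v" for n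
  proof -
    have "f (Y n) < \<infinity>" using Y(2)[of n] by (auto simp: \<phi>_def)
    moreover have "f (Y n) \<noteq> -\<infinity>" by (rule Gamma0_not_MInf[OF f Y(1)])
    ultimately show ?thesis by (cases "f (Y n)") auto
  qed
  then obtain F where F: "\<And>n. f (Y n) = ereal (F n)" by metis
  have FY: "F n + (norm (x - Y n))\<^sup>2 / 2 < c + 1 / Suc n" for n
    using Y(2)[of n] by (simp add: \<phi>_def F)
  \<comment> \<open>The midpoint has value at least the infimum \<open>c\<close>, while the average
    of the endpoint values exceeds \<open>c\<close> by at most half of
    \<open>1 / Suc i + 1 / Suc j\<close>. One eighth of the squared distance must fit in
    between.\<close>
  have close: "(norm (Y i - Y j))\<^sup>2 \<le> 4 * (1 / Suc i + 1 / Suc j)" for i j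
  proof -
    let ?m = "(1/2) *\<^sub>R Y i + (1/2) *\<^sub>R Y j"
    have "?m \<in> S" using S Y by (simp add: subspace_add subspace_scale)
    then have "ereal c \<le> \<phi> ?m" by (rule cl)
    moreover have "f ?m \<le> ereal (F i / 2 + F j / 2)"
    proof -
      have "f ((1 - (1/2)) *\<^sub>R Y i + (1/2) *\<^sub>R Y j) \<le> ereal (1 - 1/2) * f (Y i) + ereal (1/2) * f (Y j)"
        by (rule Gamma0_convexD[OF f Y(1) Y(1)]) auto
      then show ?thesis by (simp add: F)
    qed
    then have "\<phi> ?m \<le> ereal (F i / 2 + F j / 2) + ereal ((norm (x - ?m))\<^sup>2 / 2)"
      unfolding \<phi>_def by (rule add_right_mono)
    ultimately have "ereal c \<le> ereal (F i / 2 + F j / 2) + ereal ((norm (x - ?m))\<^sup>2 / 2)"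
      by (rule order_trans)
    then have "c \<le> F i / 2 + F j / 2 + (norm (x - ?m))\<^sup>2 / 2" by simp
    then show ?thesis
      using FY[of i] FY[of j] midpoint_norm_identity[of x "Y i" "Y j"]
      unfolding distrib_left by linarith
  qed
  have "Cauchy Y"
  proof (rule metric_CauchyI)
    fix e :: real assume e: "e > 0"
    obtain N where N: "1 / Suc N < e\<^sup>2 / 8"
      using nat_approx_posE[of "e\<^sup>2 / 8"] e by auto
    have "dist (Y i) (Y j) < e" if "i \<ge> N" "j \<ge> N" for i j
    proof -
      have "1 / Suc i \<le> 1 / Suc N" "1 / Suc j \<le> 1 / Suc N"
        using that by (auto intro!: divide_left_mono)
      then have "(norm (Y i - Y j))\<^sup>2 < e\<^sup>2"
        using close[of i j] N unfolding distrib_left by linarith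
      then show ?thesis using e by (simp add: dist_norm power_less_imp_less_base)
    qed
    then show "\<exists>M. \<forall>i\<ge>M. \<forall>j\<ge>M. dist (Y i) (Y j) < e" by blast
  qed
  then obtain p where p: "p \<in> S" "Y \<longlonglongrightarrow> p"
    using S(2) Y(1) unfolding complete_def by blast
  have lim: "(\<lambda>n. c + 1 / Suc n - (norm (x - Y n))\<^sup>2 / 2) \<longlonglongrightarrow> c + 0 - (norm (x - p))\<^sup>2 / 2"
    by (intro tendsto_intros p LIMSEQ_Suc[OF lim_1_over_n]) auto
  \<comment> \<open>\<open>F n\<close> stays below a quantity that converges to
    \<open>c - (norm (x - p))\<^sup>2 / 2\<close>. For every slack \<open>e\<close> the sequence
    thus eventually lies in a closed sublevel set, which then contains \<open>p\<close>.\<close>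
  have fp: "f p \<le> ereal (c - (norm (x - p))\<^sup>2 / 2)"
  proof (rule ereal_le_epsilon2)
    fix e :: real assume "e > 0"
    define C where "C = {u \<in> S. f u \<le> ereal (c - (norm (x - p))\<^sup>2 / 2 + e)}"
    have "closedin (top_of_set S) C" unfolding C_def by (rule Gamma0_closedin[OF f])
    then obtain T where T: "closed T" "C = S \<inter> T" by (auto simp: closedin_closed)
    have "\<forall>\<^sub>F n in sequentially. c + 1 / Suc n - (norm (x - Y n))\<^sup>2 / 2
        < c + 0 - (norm (x - p))\<^sup>2 / 2 + e"
      using \<open>e > 0\<close> by (intro order_tendstoD(2)[OF lim]) simp
    then have "\<forall>\<^sub>F n in sequentially. Y n \<in> T"
    proof eventually_elim
      case (elim n)
      then have "F n \<le> c - (norm (x - p))\<^sup>2 / 2 + e" using FY[of n] by linarith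
      then have "Y n \<in> C" using Y F by (simp add: C_def)
      then show ?case using T by auto
    qed
    then have "p \<in> T" using p(2) T(1) by (intro Lim_in_closed_set[of T Y sequentially p]) auto
    then have "p \<in> C" using p T by auto
    then show "f p \<le> ereal (c - (norm (x - p))\<^sup>2 / 2) + ereal e" by (simp add: C_def)
  qed
  have "f p + ereal ((norm (x - p))\<^sup>2 / 2) \<le> ereal c"
    using add_right_mono[OF fp, of "ereal ((norm (x - p))\<^sup>2 / 2)"] by simp
  then show ?thesis using p(1) cl by (intro bexI[of _ p]) (auto simp: \<phi>_def intro: order_trans)
qed

text \<open>Removes the second-order term that remains after a variation along a segment has been
  divided by its length \<open>t\<close>.\<close>

lemma quadratic_perturbation_nonneg:
  fixes a b :: real
  assumes "\<And>t. 0 < t \<Longrightarrow> t < 1 \<Longrightarrow> 0 \<le> a + t * b"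
  shows "0 \<le> a"
proof -
  have "((\<lambda>t. a + t * b) \<longlongrightarrow> a + 0 * b) (at_right 0)" by (intro tendsto_intros)
  moreover have "\<forall>\<^sub>F t in at_right (0::real). 0 \<le> a + t * b"
    unfolding eventually_at_right_field using assms by (intro exI[of _ 1]) auto
  ultimately show ?thesis
    using tendsto_lowerbound[of "\<lambda>t. a + t * b" "a + 0 * b" "at_right 0" 0] by simp
qed

text \<open>First-order optimality: \<open>p\<close> is compared with the points of the segment
  towards \<open>y\<close>, the inequality is divided by the step length, and the step tends to
  0.\<close>

lemma minimizer_subgradient:
  fixes S :: "'a::real_inner set"
  assumes f: "Gamma0 S f" and S: "subspace S" and p: "p \<in> S"
    and min: "\<And>y. y \<in> S \<Longrightarrow>
      f p + ereal ((norm (x - p))\<^sup>2 / 2) \<le> f y + ereal ((norm (x - y))\<^sup>2 / 2)"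
  shows "f p < \<infinity>" "y \<in> S \<Longrightarrow> ereal ((y - p) \<bullet> (x - p)) + f p \<le> f y"
proof -
  obtain x0 where x0: "x0 \<in> S" "f x0 < \<infinity>"
    using f by (auto simp: Gamma0_def edom_def)
  have "f p + ereal ((norm (x - p))\<^sup>2 / 2) < \<infinity>"
    using min[OF x0(1)] x0(2) by (auto simp: le_less_trans)
  then show fp: "f p < \<infinity>" by auto
  moreover have "f p \<noteq> -\<infinity>" by (rule Gamma0_not_MInf[OF f p])
  ultimately obtain c where c: "f p = ereal c" by (cases "f p") auto
  assume y: "y \<in> S"
  show "ereal ((y - p) \<bullet> (x - p)) + f p \<le> f y"
  proof (cases "f y")
    case (real v)
    have "0 \<le> (v - c - (y - p) \<bullet> (x - p)) + t * ((norm (y - p))\<^sup>2 / 2)" if t: "0 < t" "t < 1" for t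
    proof -
      let ?q = "(1 - t) *\<^sub>R p + t *\<^sub>R y"
      have q: "?q \<in> S" using S p y by (simp add: subspace_add subspace_scale)
      have "f ?q \<le> ereal (1 - t) * f p + ereal t * f y"
        by (intro Gamma0_convexD[OF f p y] t)
      then have "f ?q \<le> ereal ((1 - t) * c + t * v)" by (simp add: c real)
      then have "f ?q + ereal ((norm (x - ?q))\<^sup>2 / 2)
          \<le> ereal ((1 - t) * c + t * v) + ereal ((norm (x - ?q))\<^sup>2 / 2)"
        by (rule add_right_mono)
      from order_trans[OF min[OF q] this]
      have "c + (norm (x - p))\<^sup>2 / 2 \<le> (1 - t) * c + t * v + (norm (x - ?q))\<^sup>2 / 2"
        by (simp add: c)
      moreover have "x - ?q = (x - p) - t *\<^sub>R (y - p)" by (simp add: algebra_simps)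
      then have "(norm (x - ?q))\<^sup>2 = (norm (x - p))\<^sup>2 - 2 * t * ((y - p) \<bullet> (x - p)) + t\<^sup>2 * (norm (y - p))\<^sup>2"
        by (simp only: norm_diff_scaleR_sq)
      ultimately have "0 \<le> t * ((v - c - (y - p) \<bullet> (x - p)) + t * ((norm (y - p))\<^sup>2 / 2))"
        by (simp add: algebra_simps power2_eq_square)
      then show ?thesis using t by (simp add: zero_le_mult_iff)
    qed
    then have "0 \<le> v - c - (y - p) \<bullet> (x - p)" by (rule quadratic_perturbation_nonneg)
    then show ?thesis by (simp add: c real)
  next
    case MInf
    then show ?thesis using Gamma0_not_MInf[OF f y] by simp
  qed simp
qed

lemma subdiff_monotone:
  assumes f: "Gamma0 S f" and "u \<in> subdiff S f p" "v \<in> subdiff S f q"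
  shows "0 \<le> (p - q) \<bullet> (u - v)"
proof -
  have fin: "\<bar>f p\<bar> \<noteq> \<infinity>" "\<bar>f q\<bar> \<noteq> \<infinity>"
    using assms by (auto simp: subdiff_def Gamma0_def)
  then obtain a b where ab: "f p = ereal a" "f q = ereal b" by auto
  have "ereal ((q - p) \<bullet> u) + f p \<le> f q" "ereal ((p - q) \<bullet> v) + f q \<le> f p"
    using assms by (auto simp: subdiff_def)
  then have "(q - p) \<bullet> u + a \<le> b" "(p - q) \<bullet> v + b \<le> a" by (auto simp: ab)
  then show ?thesis by (simp add: inner_diff_left inner_diff_right)
qed

text \<open>\<open>prox\<close> is a definite description, so uniqueness is needed too: for two
  minimisers \<open>p\<close> and \<open>q\<close>, monotonicity of the subdifferential applied to
  \<open>x - p\<close> and \<open>x - q\<close> forces \<open>p = q\<close>.\<close>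

lemma prox_subdiff:
  fixes S :: "'a::real_inner set"
  assumes f: "Gamma0 S f" and S: "subspace S" "complete S" and x: "x \<in> S"
  shows "x - prox S f x \<in> subdiff S f (prox S f x)"
proof -
  let ?P = "\<lambda>p. p \<in> S \<and> (\<forall>y\<in>S. f p + ereal ((norm (x - p))\<^sup>2 / 2) \<le> f y + ereal ((norm (x - y))\<^sup>2 / 2))"
  have sub: "x - p \<in> subdiff S f p" if "?P p" for p
    using minimizer_subgradient[OF f S(1), of p x] that x S(1)
    by (auto simp: subdiff_def subspace_diff)
  have uniq: "p = q" if "?P p" "?P q" for p q
  proof -
    have "0 \<le> (p - q) \<bullet> ((x - p) - (x - q))"
      by (rule subdiff_monotone[OF f sub[OF that(1)] sub[OF that(2)]])
    then have "(p - q) \<bullet> (p - q) \<le> 0" by (simp add: inner_diff_left inner_diff_right)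
    then show ?thesis by (metis inner_eq_zero_iff inner_ge_zero order_antisym right_minus_eq)
  qed
  obtain p where p: "?P p" using prox_minimizer_exists[OF f S, of x] by (elim bexE) simp
  have "?P (prox S f x)" unfolding prox_def by (rule theI[of ?P, OF p]) (rule uniq[OF _ p])
  then show ?thesis by (rule sub)
qed

text \<open>The representer minimises \<open>(norm u)\<^sup>2 / 2 - \<phi> u\<close> on
  \<open>S\<close>, so it is the proximal point of \<open>- \<phi>\<close> at 0, and its existence
  is a case of the result on proximal points.\<close>

lemma riesz_representation_subspace:
  fixes S :: "'a::real_inner set" and \<phi> :: "'a \<Rightarrow> real"
  assumes S: "subspace S" "complete S"
    and lin: "\<And>u v. u \<in> S \<Longrightarrow> v \<in> S \<Longrightarrow> \<phi> (u + v) = \<phi> u + \<phi> v"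
      "\<And>c u. u \<in> S \<Longrightarrow> \<phi> (c *\<^sub>R u) = c * \<phi> u"
    and bdd: "\<And>u. u \<in> S \<Longrightarrow> \<bar>\<phi> u\<bar> \<le> C * norm u"
  obtains a where "a \<in> S" "\<And>u. u \<in> S \<Longrightarrow> \<phi> u = a \<bullet> u"
proof -
  define f where "f u = ereal (- \<phi> u)" for u
  have diff: "\<phi> (u - v) = \<phi> u - \<phi> v" if "u \<in> S" "v \<in> S" for u v
    using lin(1)[of u "(-1) *\<^sub>R v"] lin(2)[of v "-1"] that S(1) by (simp add: subspace_neg)
  have zS: "0 \<in> S" using S(1) by (rule subspace_0)
  have "continuous_on S \<phi>"
  proof (rule continuous_on_iff[THEN iffD2], intro ballI allI impI)
    fix u e assume u: "u \<in> S" and e: "(0::real) < e"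
    have "dist (\<phi> v) (\<phi> u) < e" if v: "v \<in> S" "dist v u < e / (\<bar>C\<bar> + 1)" for v
    proof -
      have "dist (\<phi> v) (\<phi> u) = \<bar>\<phi> (v - u)\<bar>" using diff v u by (simp add: dist_real_def)
      also have "\<dots> \<le> C * norm (v - u)" using v u S(1) by (intro bdd subspace_diff)
      also have "\<dots> \<le> (\<bar>C\<bar> + 1) * norm (v - u)" by (intro mult_right_mono) auto
      also have "\<dots> < e" using v(2) by (simp add: dist_norm field_simps)
      finally show ?thesis .
    qed
    then show "\<exists>d>0. \<forall>v\<in>S. dist v u < d \<longrightarrow> dist (\<phi> v) (\<phi> u) < e"
      using e by (intro exI[of _ "e / (\<bar>C\<bar> + 1)"]) (auto simp: divide_simps)
  qed
  then have cont: "continuous_on S (\<lambda>u. - \<phi> u)" by (intro continuous_intros)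
  have "closedin (top_of_set S) {x \<in> S. f x \<le> c}" for c
  proof (cases c)
    case (real r)
    then have "{x \<in> S. f x \<le> c} = S \<inter> (\<lambda>u. - \<phi> u) -` {..r}" by (auto simp: f_def)
    then show ?thesis using continuous_closedin_preimage[OF cont, of "{..r}"] by simp
  next
    case PInf
    then have "{x \<in> S. f x \<le> c} = S" by auto
    then show ?thesis by simp
  next
    case MInf
    then have "{x \<in> S. f x \<le> c} = {}" by (auto simp: f_def)
    then show ?thesis by (metis closedin_empty)
  qed
  then have G: "Gamma0 S f" using S(1) zS
    by (auto simp: Gamma0_def edom_def f_def lin subspace_scale intro!: exI[of _ 0])
  define a where "a = prox S f 0"
  have "0 - a \<in> subdiff S f a" unfolding a_def by (rule prox_subdiff[OF G S zS])
  then have a: "a \<in> S" and *: "\<And>y. y \<in> S \<Longrightarrow> \<phi> y - \<phi> a \<le> (y - a) \<bullet> a"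
    by (auto simp: subdiff_def f_def)
  \<comment> \<open>Testing with \<open>u + a\<close> cancels \<open>a\<close>; the bound for
    \<open>u\<close> and for its negative then gives equality.\<close>
  have le: "\<phi> u \<le> a \<bullet> u" if "u \<in> S" for u
    using *[of "u + a"] that a S(1) lin(1)[of u a] by (simp add: subspace_add inner_commute)
  have "\<phi> u = a \<bullet> u" if "u \<in> S" for u
    using le[OF that] le[of "(-1) *\<^sub>R u"] lin(2)[OF that, of "-1"] that S(1)
    by (simp add: subspace_neg)
  with a show thesis by (rule that)
qed

text \<open>\<open>adjoint\<close> is defined by choice and satisfies its identity once some adjoint
  exists. The Riesz representation of \<open>T u \<bullet> v\<close> as a functional of
  \<open>u\<close> supplies one.\<close>

lemma inner_adjoint:
  fixes T :: "'a::{real_inner,complete_space} \<Rightarrow> 'b::real_inner"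
  assumes T: "bounded_linear T"
  shows "u \<bullet> adjoint T v = T u \<bullet> v" "adjoint T v \<bullet> u = v \<bullet> T u"
proof -
  interpret bounded_linear T by fact
  have "\<exists>a. \<forall>u. T u \<bullet> v = u \<bullet> a" for v
  proof -
    have "\<bar>T u \<bullet> v\<bar> \<le> onorm T * norm v * norm u" for u
    proof -
      have "\<bar>T u \<bullet> v\<bar> \<le> norm (T u) * norm v" by (rule Cauchy_Schwarz_ineq2)
      also have "\<dots> \<le> (onorm T * norm u) * norm v" by (intro mult_right_mono onorm[OF T]) auto
      finally show ?thesis by (simp add: ac_simps)
    qed
    then obtain a where "\<And>u. T u \<bullet> v = a \<bullet> u"
      using riesz_representation_subspace[OF subspace_UNIV complete_UNIV,
          of "\<lambda>u. T u \<bullet> v" "onorm T * norm v"]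
      by (auto simp: add scaleR inner_add_left)
    then show ?thesis by (metis inner_commute)
  qed
  then have "\<exists>g. \<forall>u v. T u \<bullet> v = u \<bullet> g v" by metis
  then have "\<forall>u v. T u \<bullet> v = u \<bullet> adjoint T v" unfolding adjoint_def by (rule someI_ex)
  then show "u \<bullet> adjoint T v = T u \<bullet> v" "adjoint T v \<bullet> u = v \<bullet> T u"
    by (simp_all add: inner_commute)
qed

lemma linear_adjoint:
  fixes T :: "'a::{real_inner,complete_space} \<Rightarrow> 'b::real_inner"
  assumes T: "bounded_linear T"
  shows "linear (adjoint T)"
proof (rule linearI)
  show "adjoint T (a + b) = adjoint T a + adjoint T b" for a b
    by (rule vector_eq_ldot[THEN iffD1]) (simp add: inner_adjoint[OF T] inner_add_right)
  show "adjoint T (c *\<^sub>R a) = c *\<^sub>R adjoint T a" for c a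
    by (rule vector_eq_ldot[THEN iffD1]) (simp add: inner_adjoint[OF T])
qed

text \<open>The functionals bounded by \<^term>\<open>C * norm u\<close> form a compact set in the topology of pointwise
  convergence, so cluster points exist along some finer filter; no subsequence is needed.\<close>

lemma weak_cluster_filter:
  fixes S :: "'a::real_inner set" and F :: "'b filter"
  assumes S: "subspace S" "complete S" and F: "F \<noteq> bot"
    and x: "\<And>n. x n \<in> S" and bdd: "\<And>n. norm (x n) \<le> C"
  obtains G a where "G \<le> F" "G \<noteq> bot" "a \<in> S" "\<And>u. u \<in> S \<Longrightarrow> ((\<lambda>n. x n \<bullet> u) \<longlongrightarrow> a \<bullet> u) G"
proof -
  define \<Phi> where "\<Phi> n u = x n \<bullet> u" for n u
  \<comment> \<open>Linearity is not imposed on \<open>Q\<close>: it stays a product of compact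
    intervals, and Tychonoff's theorem applies. Uniqueness of limits recovers linearity for the
    cluster point.\<close>
  define Q where "Q = (\<Pi>\<^sub>E u\<in>(UNIV::'a set). {- (C * norm u)..C * norm u})"
  have "compact Q"
    unfolding compactin_euclidean_iff[symmetric] euclidean_product_topology[symmetric] Q_def
    by (subst compactin_PiE) auto
  have "\<bar>x n \<bullet> u\<bar> \<le> C * norm u" for n u
    by (rule order_trans[OF Cauchy_Schwarz_ineq2]) (intro mult_right_mono bdd, simp)
  then have \<Phi>Q: "\<Phi> n \<in> Q" for n by (auto simp: Q_def \<Phi>_def PiE_iff abs_le_iff minus_le_iff)
  have "filtermap \<Phi> F \<noteq> bot" "\<forall>\<^sub>F \<psi> in filtermap \<Phi> F. \<psi> \<in> Q"
    using F \<Phi>Q by (auto simp: filtermap_bot_iff eventually_filtermap)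
  then obtain \<phi> where \<phi>: "\<phi> \<in> Q" "inf (nhds \<phi>) (filtermap \<Phi> F) \<noteq> bot"
    using \<open>compact Q\<close> unfolding compact_filter by blast
  \<comment> \<open>Pulling the neighbourhoods of the cluster point back to the index set gives a
    filter finer than \<open>F\<close> along which \<open>\<Phi>\<close> converges to
    \<open>\<phi>\<close>.\<close>
  define G where "G = inf (filtercomap \<Phi> (nhds \<phi>)) F"
  have GF: "G \<le> F" by (simp add: G_def)
  have Gb: "G \<noteq> bot"
  proof
    assume "G = bot"
    then have "eventually (\<lambda>_. False) G" by simp
    then obtain P R where PR: "eventually P (filtercomap \<Phi> (nhds \<phi>))" "eventually R F"
      "\<And>n. P n \<Longrightarrow> R n \<Longrightarrow> False"
      unfolding G_def eventually_inf by blast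
    obtain P' where P': "eventually P' (nhds \<phi>)" "\<And>n. P' (\<Phi> n) \<Longrightarrow> P n"
      using PR(1) unfolding eventually_filtercomap by blast
    have "eventually (\<lambda>\<psi>. \<not> P' \<psi>) (filtermap \<Phi> F)"
      unfolding eventually_filtermap using PR(2) by eventually_elim (use PR P' in blast)
    with P'(1) have "eventually (\<lambda>_. False) (inf (nhds \<phi>) (filtermap \<Phi> F))"
      unfolding eventually_inf by blast
    with \<phi>(2) show False by (simp add: trivial_limit_def)
  qed
  have lim: "((\<lambda>n. x n \<bullet> u) \<longlongrightarrow> \<phi> u) G" for u
  proof -
    have "filterlim \<Phi> (nhds \<phi>) G"
      unfolding G_def by (intro filterlim_mono[OF filterlim_filtercomap order_refl]) simp
    then have "((\<lambda>n. \<Phi> n u) \<longlongrightarrow> \<phi> u) G"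
      using continuous_on_tendsto_compose[OF
          continuous_on_product_then_coordinatewise[OF continuous_on_id, of UNIV u]] by auto
    then show ?thesis by (simp add: \<Phi>_def)
  qed
  have "\<phi> (u + v) = \<phi> u + \<phi> v" for u v
    by (rule tendsto_unique[OF Gb lim]) (unfold inner_add_right, intro tendsto_intros lim)
  moreover have "\<phi> (c *\<^sub>R u) = c * \<phi> u" for c u
    by (rule tendsto_unique[OF Gb lim]) (unfold inner_scaleR_right, intro tendsto_intros lim)
  moreover have "\<bar>\<phi> u\<bar> \<le> C * norm u" for u
    using \<phi>(1) by (auto simp: Q_def PiE_iff abs_le_iff minus_le_iff)
  ultimately obtain a where "a \<in> S" "\<And>u. u \<in> S \<Longrightarrow> \<phi> u = a \<bullet> u"
    using riesz_representation_subspace[OF S, of \<phi> C] by blast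
  then show thesis using lim GF Gb by (intro that[of G a]) (auto, metis)
qed

section \<open>The forward-backward-forward iteration with summable errors\<close>

text \<open>Subtracting the partial sums of the errors makes the sequence decreasing and bounded
  below.\<close>

lemma summable_perturbation_convergent:
  fixes a e :: "nat \<Rightarrow> real"
  assumes pos: "\<And>n. 0 \<le> a n" "\<And>n. 0 \<le> e n" and e: "summable e"
    and step: "\<And>n. a (Suc n) \<le> a n + e n"
  shows "convergent a"
proof -
  define b where "b n = a n - sum e {..<n}" for n
  have dec: "decseq b" using step by (intro decseq_SucI) (simp add: b_def algebra_simps)
  have "- suminf e \<le> b n" for n
    using pos(1)[of n] sum_le_suminf[OF e, of "{..<n}"] pos(2) by (simp add: b_def)
  then have "convergent b"
    using decseq_convergent[OF dec, of "- suminf e"] by (metis convergent_def)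
  moreover have "convergent (\<lambda>n. sum e {..<n})"
    using e by (simp add: summable_iff_convergent)
  ultimately have "convergent (\<lambda>n. b n + sum e {..<n})" by (rule convergent_add)
  then show ?thesis by (simp add: b_def)
qed

text \<open>Opial's lemma for filters. If \<open>a\<close> and \<open>b\<close> are weak cluster
  points in \<open>Z\<close>, the convergent distances to them make
  \<open>z n \<bullet> (b - a)\<close> converge; its limit is the value at \<open>a\<close> as well
  as the value at \<open>b\<close>, whence \<open>a = b\<close>.\<close>

lemma weak_conv_if_cluster_points:
  fixes S :: "'a::real_inner set" and z :: "nat \<Rightarrow> 'a"
  assumes S: "subspace S" "complete S" and z: "\<And>n. z n \<in> S" and bdd: "\<And>n. norm (z n) \<le> C"
    and conv: "\<And>w. w \<in> Z \<Longrightarrow> convergent (\<lambda>n. norm (z n - w))"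
    and cluster: "\<And>G a. G \<noteq> bot \<Longrightarrow> G \<le> sequentially \<Longrightarrow> a \<in> S \<Longrightarrow>
      (\<And>u. u \<in> S \<Longrightarrow> ((\<lambda>n. z n \<bullet> u) \<longlongrightarrow> a \<bullet> u) G) \<Longrightarrow> a \<in> Z"
  obtains a where "a \<in> S" "a \<in> Z" "weak_conv S z a"
proof -
  obtain G a where G: "G \<le> sequentially" "G \<noteq> bot" and a: "a \<in> S"
    and lim: "\<And>u. u \<in> S \<Longrightarrow> ((\<lambda>n. z n \<bullet> u) \<longlongrightarrow> a \<bullet> u) G"
    by (rule weak_cluster_filter[OF S sequentially_bot, of z C]) (use z bdd in auto)
  have aZ: "a \<in> Z" by (rule cluster[OF G(2,1) a lim])
  have "(\<lambda>n. z n \<bullet> u) \<longlonglongrightarrow> a \<bullet> u" if u: "u \<in> S" for u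
  proof (rule ccontr)
    assume "\<not> ?thesis"
    then obtain e where e: "e > 0" "\<not> (\<forall>\<^sub>F n in sequentially. dist (z n \<bullet> u) (a \<bullet> u) < e)"
      by (auto simp: tendsto_iff)
    \<comment> \<open>Restricts to the indices at which weak convergence against \<open>u\<close>
      fails; the cluster point found along this filter has to equal \<open>a\<close>, a
      contradiction.\<close>
    define F where "F = inf sequentially (principal {n. \<not> dist (z n \<bullet> u) (a \<bullet> u) < e})"
    have "F \<noteq> bot"
      using e(2) unfolding F_def trivial_limit_def eventually_inf_principal by simp
    then obtain G' b where G': "G' \<le> F" "G' \<noteq> bot" and b: "b \<in> S"
      and lim': "\<And>u. u \<in> S \<Longrightarrow> ((\<lambda>n. z n \<bullet> u) \<longlongrightarrow> b \<bullet> u) G'"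
      by (rule weak_cluster_filter[OF S, of F z C]) (use z bdd in auto)
    have G's: "G' \<le> sequentially" using G'(1) by (auto simp: F_def)
    have bZ: "b \<in> Z" by (rule cluster[OF G'(2) G's b lim'])
    obtain la lb where "(\<lambda>n. norm (z n - a)) \<longlonglongrightarrow> la" "(\<lambda>n. norm (z n - b)) \<longlonglongrightarrow> lb"
      using conv[OF aZ] conv[OF bZ] by (auto simp: convergent_def)
    \<comment> \<open>Polarisation: this expression is \<open>z n \<bullet> (b - a)\<close> written
      through the two convergent distances.\<close>
    then have "(\<lambda>n. ((norm b)\<^sup>2 - (norm a)\<^sup>2 + (norm (z n - a))\<^sup>2 - (norm (z n - b))\<^sup>2) / 2)
        \<longlonglongrightarrow> ((norm b)\<^sup>2 - (norm a)\<^sup>2 + la\<^sup>2 - lb\<^sup>2) / 2" (is "_ \<longlonglongrightarrow> ?l")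
      by (intro tendsto_intros) auto
    moreover have "((norm b)\<^sup>2 - (norm a)\<^sup>2 + (norm (z n - a))\<^sup>2 - (norm (z n - b))\<^sup>2) / 2
        = z n \<bullet> (b - a)" for n
      by (simp add: power2_norm_eq_inner inner_diff_left inner_diff_right inner_commute)
    ultimately obtain l where l: "(\<lambda>n. z n \<bullet> (b - a)) \<longlonglongrightarrow> l" by simp
    have ba: "b - a \<in> S" using S(1) a b by (simp add: subspace_diff)
    have "l = a \<bullet> (b - a)"
      by (rule tendsto_unique[OF G(2) tendsto_mono[OF G(1) l] lim[OF ba]])
    moreover have "l = b \<bullet> (b - a)"
      by (rule tendsto_unique[OF G'(2) tendsto_mono[OF G's l] lim'[OF ba]])
    ultimately have "(b - a) \<bullet> (b - a) = 0" by (simp add: inner_diff_left)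
    then have "b = a" by simp
    then have "\<forall>\<^sub>F n in G'. dist (z n \<bullet> u) (a \<bullet> u) < e"
      using lim'[OF u] e(1) by (auto simp: tendsto_iff)
    moreover have "\<forall>\<^sub>F n in G'. \<not> dist (z n \<bullet> u) (a \<bullet> u) < e"
      by (rule filter_leD[OF G'(1)]) (simp add: F_def eventually_inf_principal)
    ultimately have "\<forall>\<^sub>F n in G'. False" by eventually_elim simp
    with G'(2) show False by (simp add: trivial_limit_def)
  qed
  then show thesis using a aZ by (intro that[of a]) (auto simp: weak_conv_def)
qed

lemma tendsto_inner_bounded_null:
  fixes p u :: "'b \<Rightarrow> 'a::real_inner"
  assumes "\<And>n. norm (p n) \<le> C" and u: "(u \<longlongrightarrow> 0) F"
  shows "((\<lambda>n. p n \<bullet> u n) \<longlongrightarrow> 0) F"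
proof (rule Lim_null_comparison)
  show "\<forall>\<^sub>F n in F. norm (p n \<bullet> u n) \<le> C * norm (u n)"
  proof (rule always_eventually, rule allI)
    fix n
    have "\<bar>p n \<bullet> u n\<bar> \<le> norm (p n) * norm (u n)" by (rule Cauchy_Schwarz_ineq2)
    also have "\<dots> \<le> C * norm (u n)" by (intro mult_right_mono assms) simp
    finally show "norm (p n \<bullet> u n) \<le> C * norm (u n)" by simp
  qed
  show "((\<lambda>n. C * norm (u n)) \<longlongrightarrow> 0) F"
    using tendsto_mult_right_zero[OF tendsto_norm_zero[OF u]] .
qed

text \<open>\<open>(1 / c) *\<^sub>R (s - p) \<in> A p\<close> says that \<open>p\<close> is the
  value at \<open>s\<close> of the resolvent of \<open>A\<close> with parameter \<open>c\<close>.
  Maximality of \<open>A\<close> enters in this form, as surjectivity of the identity plus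
  \<open>c\<close> times \<open>A\<close>, in the spirit of Minty's theorem.\<close>

locale monotone_lipschitz_inclusion =
  fixes S :: "'a::real_inner set" and A :: "'a \<Rightarrow> 'a set" and B :: "'a \<Rightarrow> 'a" and \<beta> :: real
  assumes S: "subspace S" "complete S"
    and A_carrier: "u \<in> A p \<Longrightarrow> p \<in> S"
    and A_range: "u \<in> A p \<Longrightarrow> u \<in> S"
    and A_mono: "u \<in> A p \<Longrightarrow> v \<in> A q \<Longrightarrow> 0 \<le> (p - q) \<bullet> (u - v)"
    and A_resolvent: "0 < c \<Longrightarrow> s \<in> S \<Longrightarrow> \<exists>p. (1 / c) *\<^sub>R (s - p) \<in> A p"
    and B_carrier: "p \<in> S \<Longrightarrow> B p \<in> S"
    and B_mono: "p \<in> S \<Longrightarrow> q \<in> S \<Longrightarrow> 0 \<le> (p - q) \<bullet> (B p - B q)"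
    and B_lip: "p \<in> S \<Longrightarrow> q \<in> S \<Longrightarrow> norm (B p - B q) \<le> \<beta> * norm (p - q)"
    and \<beta>_pos: "0 < \<beta>"
begin

text \<open>Monotonicity gives the firm inequality
  \<open>(norm (p - q))\<^sup>2 \<le> (p - q) \<bullet> (s - t)\<close>; Cauchy-Schwarz does the
  rest.\<close>

lemma resolvent_nonexpansive:
  assumes c: "0 < c" and p: "(1 / c) *\<^sub>R (s - p) \<in> A p" and q: "(1 / c) *\<^sub>R (t - q) \<in> A q"
  shows "norm (p - q) \<le> norm (s - t)"
proof (cases "p = q")
  case False
  have "(1 / c) *\<^sub>R (s - p) - (1 / c) *\<^sub>R (t - q) = (1 / c) *\<^sub>R ((s - t) - (p - q))"
    by (simp add: algebra_simps)
  then have "0 \<le> (p - q) \<bullet> ((s - t) - (p - q))"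
    using A_mono[OF p q] c by (simp add: zero_le_divide_iff)
  then have "(norm (p - q))\<^sup>2 \<le> (p - q) \<bullet> (s - t)"
    by (simp add: power2_norm_eq_inner inner_diff_right)
  also have "\<dots> \<le> norm (p - q) * norm (s - t)" by (rule norm_cauchy_schwarz)
  finally show ?thesis using False by (simp add: power2_eq_square)
qed simp

text \<open>Tseng's estimate. With \<open>a = p - w\<close>, \<open>e = z - p\<close> and
  \<open>d = B z - B p\<close>, the old distance to \<open>w\<close> is the norm of
  \<open>a + e\<close> and the new one the norm of \<open>a + c *\<^sub>R d\<close>. Monotonicity of
  \<open>A\<close> and \<open>B\<close> yields
  \<open>c * (a \<bullet> d) \<le> a \<bullet> e\<close> for the mixed terms, and the Lipschitz
  bound handles the square of \<open>d\<close>.\<close>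

lemma forward_backward_forward_step:
  assumes z: "z \<in> S" and c: "0 < c" and w: "- B w \<in> A w"
    and p: "(1 / c) *\<^sub>R (z - c *\<^sub>R B z - p) \<in> A p"
  shows "(norm (p + c *\<^sub>R (B z - B p) - w))\<^sup>2
    \<le> (norm (z - w))\<^sup>2 - (1 - (c * \<beta>)\<^sup>2) * (norm (p - z))\<^sup>2"
proof -
  define a d e where "a = p - w" and "d = B z - B p" and "e = z - p"
  have pS: "p \<in> S" and wS: "w \<in> S" using A_carrier p w by auto
  have "0 \<le> a \<bullet> ((1 / c) *\<^sub>R (z - c *\<^sub>R B z - p) - - B w)"
    unfolding a_def by (rule A_mono[OF p w])
  moreover have "0 \<le> a \<bullet> (B p - B w)"
    unfolding a_def by (rule B_mono[OF pS wS])
  ultimately have "0 \<le> a \<bullet> ((1 / c) *\<^sub>R (z - c *\<^sub>R B z - p) - - B w) + a \<bullet> (B p - B w)" by simp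
  also have "\<dots> = a \<bullet> (((1 / c) *\<^sub>R (z - c *\<^sub>R B z - p) - - B w) + (B p - B w))"
    by (simp only: inner_add_right)
  also have "((1 / c) *\<^sub>R (z - c *\<^sub>R B z - p) - - B w) + (B p - B w) = (1 / c) *\<^sub>R (e - c *\<^sub>R d)"
    using c by (simp add: d_def e_def algebra_simps)
  finally have ae: "c * (a \<bullet> d) \<le> a \<bullet> e"
    using c by (simp add: zero_le_divide_iff inner_diff_right)
  have "norm d \<le> \<beta> * norm e" unfolding d_def e_def by (rule B_lip[OF z pS])
  then have "(norm d)\<^sup>2 \<le> (\<beta> * norm e)\<^sup>2" by (rule power_mono) simp
  then have "c\<^sup>2 * (norm d)\<^sup>2 \<le> c\<^sup>2 * (\<beta> * norm e)\<^sup>2" by (intro mult_left_mono) auto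
  then have dle: "c\<^sup>2 * (norm d)\<^sup>2 \<le> (c * \<beta>)\<^sup>2 * (norm e)\<^sup>2" by (simp add: power_mult_distrib)
  have 1: "(norm (p + c *\<^sub>R (B z - B p) - w))\<^sup>2 = (norm (a - (- c) *\<^sub>R d))\<^sup>2"
    by (simp add: a_def d_def algebra_simps)
  have 2: "(norm (z - w))\<^sup>2 = (norm (a - (- 1) *\<^sub>R e))\<^sup>2"
    by (simp add: a_def e_def algebra_simps)
  have 3: "norm (p - z) = norm e" by (simp add: e_def norm_minus_commute)
  have "(norm (a - (- c) *\<^sub>R d))\<^sup>2 \<le> (norm (a - (- 1) *\<^sub>R e))\<^sup>2 - (1 - (c * \<beta>)\<^sup>2) * (norm e)\<^sup>2"
    unfolding norm_diff_scaleR_sq using ae dle by (simp add: inner_commute algebra_simps)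
  then show ?thesis unfolding 1 2 3 .
qed

text \<open>Minty's device: testing against the resolvent of \<open>A + B\<close> at \<open>z\<close>, which is the fixed point
  of a contraction, forces equality.\<close>

lemma zero_if_monotonically_related:
  assumes z: "z \<in> S" and rel: "\<And>p u. u \<in> A p \<Longrightarrow> 0 \<le> (z - p) \<bullet> (- u - B p)"
  shows "- B z \<in> A z"
proof -
  \<comment> \<open>This parameter makes the map \<open>T\<close> below a contraction with factor
    1/2.\<close>
  define c where "c = 1 / (2 * \<beta>)"
  have c: "0 < c" "c * \<beta> = 1 / 2" using \<beta>_pos by (auto simp: c_def)
  obtain J where J: "\<And>s. s \<in> S \<Longrightarrow> (1 / c) *\<^sub>R (s - J s) \<in> A (J s)"
    using A_resolvent[OF c(1)] by metis
  \<comment> \<open>At a fixed point \<open>p\<close>, \<open>z - p\<close> is \<open>c\<close>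
    times a value of \<open>A + B\<close> at \<open>p\<close>, so \<open>p\<close> is the resolvent
    of the sum at \<open>z\<close>.\<close>
  define T where "T p = J (z - c *\<^sub>R B p)" for p
  have arg: "z - c *\<^sub>R B p \<in> S" if "p \<in> S" for p
    using z that S(1) B_carrier by (simp add: subspace_diff subspace_scale)
  have "\<exists>!p. p \<in> S \<and> T p = p"
  proof (rule Banach_fix[OF S(2), of "1/2" T])
    show "S \<noteq> {}" using z by auto
    show "T ` S \<subseteq> S" using A_carrier J arg by (auto simp: T_def)
    show "dist (T p) (T q) \<le> 1 / 2 * dist p q" if pq: "p \<in> S" "q \<in> S" for p q
    proof -
      have "norm (T p - T q) \<le> norm ((z - c *\<^sub>R B p) - (z - c *\<^sub>R B q))"
        unfolding T_def using J arg pq by (intro resolvent_nonexpansive[OF c(1)]) auto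
      also have "\<dots> = norm (c *\<^sub>R (B q - B p))" by (simp add: algebra_simps)
      also have "\<dots> = c * norm (B p - B q)" using c by (simp add: norm_minus_commute)
      also have "\<dots> \<le> c * (\<beta> * norm (p - q))"
        using c pq by (intro mult_left_mono B_lip) auto
      also have "\<dots> = 1 / 2 * norm (p - q)" using c by simp
      finally show ?thesis by (simp add: dist_norm)
    qed
  qed auto
  then obtain p where p: "p \<in> S" "T p = p" by blast
  then have u: "(1 / c) *\<^sub>R (z - c *\<^sub>R B p - p) \<in> A p" using J[OF arg[OF p(1)]] by (simp add: T_def)
  have "- ((1 / c) *\<^sub>R (z - c *\<^sub>R B p - p)) - B p = (- (1 / c)) *\<^sub>R (z - p)"
    using c by (simp add: algebra_simps)
  then have "0 \<le> (z - p) \<bullet> ((- (1 / c)) *\<^sub>R (z - p))" using rel[OF u] by simp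
  then have "(z - p) \<bullet> (z - p) \<le> 0" using c by (simp add: divide_le_0_iff)
  then have "z = p" by (metis inner_eq_zero_iff inner_ge_zero order_antisym right_minus_eq)
  moreover have "(1 / c) *\<^sub>R (z - c *\<^sub>R B z - z) = - B z" using c by simp
  ultimately show ?thesis using u by simp
qed

text \<open>Weak-strong closedness of the graph of \<open>A + B\<close>: \<open>u n\<close> is a
  value of the sum at \<open>p n\<close>. Monotonicity against a fixed graph point passes to the
  limit since \<open>p n\<close> is bounded and \<open>u\<close> tends to 0; Minty's criterion then
  applies to \<open>z\<close>.\<close>

lemma zero_if_weak_cluster_point:
  assumes G: "G \<noteq> bot" and z: "z \<in> S"
    and graph: "\<And>n. u n - B (p n) \<in> A (p n)" and bdd: "\<And>n. norm (p n) \<le> C"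
    and u: "(u \<longlongrightarrow> 0) G" and weak: "\<And>w. w \<in> S \<Longrightarrow> ((\<lambda>n. p n \<bullet> w) \<longlongrightarrow> z \<bullet> w) G"
  shows "- B z \<in> A z"
proof (rule zero_if_monotonically_related[OF z])
  fix q v assume v: "v \<in> A q"
  have qS: "q \<in> S" using v by (rule A_carrier)
  have vS: "v + B q \<in> S" using A_range[OF v] B_carrier[OF qS] S(1) by (simp add: subspace_add)
  have nonneg: "0 \<le> (p n - q) \<bullet> u n - (p n \<bullet> (v + B q) - q \<bullet> (v + B q))" for n
  proof -
    have "0 \<le> (p n - q) \<bullet> (u n - B (p n) - v)" by (rule A_mono[OF graph v])
    moreover have "0 \<le> (p n - q) \<bullet> (B (p n) - B q)"
      by (rule B_mono[OF A_carrier[OF graph] qS])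
    ultimately show ?thesis
      by (simp add: inner_diff_left inner_diff_right inner_add_right)
  qed
  have "norm (p n - q) \<le> C + norm q" for n
    using norm_triangle_ineq4[of "p n" q] bdd[of n] by linarith
  then have "((\<lambda>n. (p n - q) \<bullet> u n) \<longlongrightarrow> 0) G" using u by (rule tendsto_inner_bounded_null)
  then have "((\<lambda>n. (p n - q) \<bullet> u n - (p n \<bullet> (v + B q) - q \<bullet> (v + B q)))
      \<longlongrightarrow> 0 - (z \<bullet> (v + B q) - q \<bullet> (v + B q))) G"
    by (intro tendsto_intros weak vS)
  then have "0 \<le> 0 - (z \<bullet> (v + B q) - q \<bullet> (v + B q))"
    by (rule tendsto_lowerbound[OF _ _ G]) (use nonneg in auto)
  then show "0 \<le> (z - q) \<bullet> (- v - B q)"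
    by (simp add: inner_diff_left inner_diff_right inner_add_right)
qed

text \<open>\<open>s\<close>, \<open>p\<close>, \<open>q\<close> are the inexact forward, backward
  and forward points, and \<open>J n\<close> is the exact backward point of \<open>s n\<close>. The
  conclusion also exports exact backward points \<open>P n\<close> with residuals \<open>u n\<close>
  in the values of \<open>A + B\<close>, because the strong convergence proofs start from the
  vanishing products.\<close>

theorem forward_backward_forward_weak_convergence:
  fixes z s J p q :: "nat \<Rightarrow> 'a" and \<gamma> :: "nat \<Rightarrow> real"
  assumes zero: "- B w \<in> A w"
    and \<epsilon>: "0 < \<epsilon>" and \<gamma>: "\<And>n. \<epsilon> \<le> \<gamma> n" "\<And>n. \<gamma> n * \<beta> \<le> 1 - \<epsilon>"
    and carrier: "z 0 \<in> S" "\<And>n. s n \<in> S" "\<And>n. p n \<in> S" "\<And>n. q n \<in> S"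
    and J: "\<And>n. (1 / \<gamma> n) *\<^sub>R (s n - J n) \<in> A (J n)"
    and err: "summable (\<lambda>n. norm (s n - (z n - \<gamma> n *\<^sub>R B (z n))))"
      "summable (\<lambda>n. norm (p n - J n))"
      "summable (\<lambda>n. norm (q n - (p n - \<gamma> n *\<^sub>R B (p n))))"
    and upd: "\<And>n. z (Suc n) = z n - s n + q n"
  obtains z' P u where "- B z' \<in> A z'" "weak_conv S z z'" "\<And>n. u n - B (P n) \<in> A (P n)"
    "(\<lambda>n. P n - z n) \<longlonglongrightarrow> 0" "(\<lambda>n. (P n - z') \<bullet> u n) \<longlonglongrightarrow> 0"
proof -
  have zS: "z n \<in> S" for n
    by (induction n) (use carrier upd S(1) in \<open>auto simp: subspace_add subspace_diff\<close>)
  have \<gamma>0: "0 < \<gamma> n" for n using \<epsilon> \<gamma>(1)[of n] by linarith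
  have fS: "z n - \<gamma> n *\<^sub>R B (z n) \<in> S" for n
    using zS B_carrier S(1) by (simp add: subspace_diff subspace_scale)
  have "\<exists>P. (1 / \<gamma> n) *\<^sub>R (z n - \<gamma> n *\<^sub>R B (z n) - P) \<in> A P" for n
    by (rule A_resolvent[OF \<gamma>0 fS])
  \<comment> \<open>Exact backward point of the exact forward point; unlike \<open>J n\<close> it
    does not inherit the error of \<open>s n\<close>.\<close>
  then obtain P where P: "\<And>n. (1 / \<gamma> n) *\<^sub>R (z n - \<gamma> n *\<^sub>R B (z n) - P n) \<in> A (P n)" by metis
  have PS: "P n \<in> S" for n by (rule A_carrier[OF P])
  define z1 where "z1 n = P n + \<gamma> n *\<^sub>R (B (z n) - B (P n))" for n
  \<comment> \<open>The error of \<open>s\<close> counts once directly and twice through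
    \<open>p n - P n\<close>, which enters both by itself and through \<open>B\<close>. The error of
    \<open>p\<close> counts twice for the same reason.\<close>
  define e where "e n = 3 * norm (s n - (z n - \<gamma> n *\<^sub>R B (z n))) + 2 * norm (p n - J n)
      + norm (q n - (p n - \<gamma> n *\<^sub>R B (p n)))" for n
  have e: "summable e" unfolding e_def by (intro summable_add summable_mult err)
  have e0: "0 \<le> e n" for n by (simp add: e_def)
  have close: "norm (z (Suc n) - z1 n) \<le> e n" for n
  proof -
    have JP: "norm (J n - P n) \<le> norm (s n - (z n - \<gamma> n *\<^sub>R B (z n)))"
      by (rule resolvent_nonexpansive[OF \<gamma>0 J P])
    have pP: "norm (p n - P n) \<le> norm (p n - J n) + norm (J n - P n)"
      using norm_triangle_ineq[of "p n - J n" "J n - P n"] by simp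
    have "norm (\<gamma> n *\<^sub>R (B (p n) - B (P n))) \<le> \<gamma> n * (\<beta> * norm (p n - P n))"
      using \<gamma>0[of n] B_lip[OF carrier(3) PS] by simp
    also have "\<dots> \<le> 1 * norm (p n - P n)"
      unfolding mult.assoc[symmetric] using \<gamma>(2)[of n] \<epsilon> by (intro mult_right_mono) auto
    finally have Bp: "norm (\<gamma> n *\<^sub>R (B (p n) - B (P n))) \<le> norm (p n - P n)" by simp
    have tri: "norm (a - b + c - d) \<le> norm a + norm b + norm c + norm d" for a b c d :: 'a
      using norm_triangle_ineq4[of "a - b + c" d] norm_triangle_ineq[of "a - b" c]
        norm_triangle_ineq4[of a b] by linarith
    have "z (Suc n) - z1 n = (q n - (p n - \<gamma> n *\<^sub>R B (p n))) - (s n - (z n - \<gamma> n *\<^sub>R B (z n)))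
        + (p n - P n) - \<gamma> n *\<^sub>R (B (p n) - B (P n))"
      by (simp add: upd z1_def algebra_simps)
    with tri have "norm (z (Suc n) - z1 n) \<le> norm (q n - (p n - \<gamma> n *\<^sub>R B (p n)))
        + norm (s n - (z n - \<gamma> n *\<^sub>R B (z n)))
        + norm (p n - P n) + norm (\<gamma> n *\<^sub>R (B (p n) - B (P n)))"
      by metis
    then show ?thesis using JP pP Bp unfolding e_def by linarith
  qed
  have \<epsilon>1: "\<epsilon> \<le> 1"
    using \<gamma>(2)[of 0] mult_nonneg_nonneg[of "\<gamma> 0" \<beta>] \<gamma>0[of 0] \<beta>_pos by linarith
  have gap: "\<epsilon> * (norm (P n - z n))\<^sup>2 \<le> (norm (z n - w))\<^sup>2 - (norm (z1 n - w))\<^sup>2"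
    if w: "- B w \<in> A w" for w n
  proof -
    \<comment> \<open>Squaring the step size bound gives
      \<open>\<epsilon> \<le> 1 - (\<gamma> n * \<beta>)\<^sup>2\<close>, a decrease that is uniform
      in \<open>n\<close>.\<close>
    have "(\<gamma> n * \<beta>)\<^sup>2 \<le> (1 - \<epsilon>)\<^sup>2"
      using \<gamma>(2) \<gamma>0[of n] \<beta>_pos by (intro power_mono) auto
    also have "\<dots> \<le> 1 - \<epsilon>" using \<epsilon> \<epsilon>1 by (simp add: power2_eq_square mult_left_le)
    finally have "\<epsilon> * (norm (P n - z n))\<^sup>2 \<le> (1 - (\<gamma> n * \<beta>)\<^sup>2) * (norm (P n - z n))\<^sup>2"
      by (intro mult_right_mono) auto
    then show ?thesis
      using forward_backward_forward_step[OF zS \<gamma>0 w P, of n] unfolding z1_def by linarith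
  qed
  have fejer: "convergent (\<lambda>n. norm (z n - w))" if w: "- B w \<in> A w" for w
  proof (rule summable_perturbation_convergent[OF _ e0 e])
    fix n
    have "0 \<le> \<epsilon> * (norm (P n - z n))\<^sup>2" using \<epsilon> by simp
    then have "(norm (z1 n - w))\<^sup>2 \<le> (norm (z n - w))\<^sup>2" using gap[OF w, of n] by linarith
    then have "norm (z1 n - w) \<le> norm (z n - w)" by (rule power2_le_imp_le) simp
    moreover have "norm (z (Suc n) - w) \<le> norm (z (Suc n) - z1 n) + norm (z1 n - w)"
      using norm_triangle_ineq[of "z (Suc n) - z1 n" "z1 n - w"] by simp
    ultimately show "norm (z (Suc n) - w) \<le> norm (z n - w) + e n" using close[of n] by linarith
  qed simp
  obtain l where l: "(\<lambda>n. norm (z n - w)) \<longlonglongrightarrow> l"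
    using fejer[OF zero] by (auto simp: convergent_def)
  \<comment> \<open>The exact and the perturbed successor have the same limiting distance to
    \<open>w\<close>, so the decrease in \<open>gap\<close> tends to 0 and with it
    \<open>P n - z n\<close>.\<close>
  have "(\<lambda>n. norm (z1 n - w) - norm (z (Suc n) - w)) \<longlonglongrightarrow> 0"
  proof (rule Lim_null_comparison[OF _ summable_LIMSEQ_zero[OF e]], intro always_eventually allI)
    fix n
    have "\<bar>norm (z1 n - w) - norm (z (Suc n) - w)\<bar> \<le> norm ((z1 n - w) - (z (Suc n) - w))"
      by (rule norm_triangle_ineq3)
    also have "\<dots> = norm (z (Suc n) - z1 n)" by (simp add: norm_minus_commute)
    finally show "norm (norm (z1 n - w) - norm (z (Suc n) - w)) \<le> e n"
      using close[of n] by simp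
  qed
  from tendsto_add[OF this LIMSEQ_Suc[OF l]] have "(\<lambda>n. norm (z1 n - w)) \<longlonglongrightarrow> l" by simp
  then have "(\<lambda>n. ((norm (z n - w))\<^sup>2 - (norm (z1 n - w))\<^sup>2) / \<epsilon>) \<longlonglongrightarrow> (l\<^sup>2 - l\<^sup>2) / \<epsilon>"
    using \<epsilon> by (intro tendsto_intros l) auto
  then have "(\<lambda>n. ((norm (z n - w))\<^sup>2 - (norm (z1 n - w))\<^sup>2) / \<epsilon>) \<longlonglongrightarrow> 0" by simp
  then have "(\<lambda>n. (norm (P n - z n))\<^sup>2) \<longlonglongrightarrow> 0"
    by (rule Lim_null_comparison[rotated], intro always_eventually allI)
      (use gap[OF zero] \<epsilon> in \<open>simp add: pos_le_divide_eq mult.commute\<close>)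
  then have "(\<lambda>n. sqrt ((norm (P n - z n))\<^sup>2)) \<longlonglongrightarrow> sqrt 0" by (rule tendsto_real_sqrt)
  then have nPz: "(\<lambda>n. norm (P n - z n)) \<longlonglongrightarrow> 0" by simp
  then have Pz: "(\<lambda>n. P n - z n) \<longlonglongrightarrow> 0" by (rule tendsto_norm_zero_cancel)
  \<comment> \<open>Adding \<open>B (P n)\<close> to the graph value of \<open>A\<close> gives a
    value of \<open>A + B\<close>. It equals \<open>(z n - P n)\<close> divided by the step size,
    minus \<open>B (z n) - B (P n)\<close>, so \<open>norm (P n - z n)\<close> controls it.\<close>
  define u where "u n = (1 / \<gamma> n) *\<^sub>R (z n - \<gamma> n *\<^sub>R B (z n) - P n) + B (P n)" for n
  have u: "u n - B (P n) \<in> A (P n)" for n using P by (simp add: u_def)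
  have u0: "u \<longlonglongrightarrow> 0"
  proof (rule Lim_null_comparison[of _ "\<lambda>n. (1 / \<epsilon> + \<beta>) * norm (P n - z n)"],
      intro always_eventually allI)
    fix n
    have "u n = (1 / \<gamma> n) *\<^sub>R (z n - P n) - (B (z n) - B (P n))"
      using \<gamma>0[of n] by (simp add: u_def algebra_simps)
    then have "norm (u n) \<le> norm ((1 / \<gamma> n) *\<^sub>R (z n - P n)) + norm (B (z n) - B (P n))"
      using norm_triangle_ineq4 by metis
    also have "norm ((1 / \<gamma> n) *\<^sub>R (z n - P n)) = (1 / \<gamma> n) * norm (P n - z n)"
      using \<gamma>0[of n] by (simp add: norm_minus_commute)
    also have "\<dots> \<le> (1 / \<epsilon>) * norm (P n - z n)"
      using \<gamma>(1)[of n] \<epsilon> by (intro mult_right_mono divide_left_mono) auto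
    also have "norm (B (z n) - B (P n)) \<le> \<beta> * norm (P n - z n)"
      using B_lip[OF zS PS] by (simp add: norm_minus_commute)
    finally show "norm (u n) \<le> (1 / \<epsilon> + \<beta>) * norm (P n - z n)" by (simp add: algebra_simps)
  next
    show "(\<lambda>n. (1 / \<epsilon> + \<beta>) * norm (P n - z n)) \<longlonglongrightarrow> 0" by (rule tendsto_mult_right_zero[OF nPz])
  qed
  have "Bseq (\<lambda>n. norm (z n - w))" using fejer[OF zero] by (rule convergent_imp_Bseq)
  then obtain C1 where C1: "\<And>n. norm (z n - w) \<le> C1" by (auto simp: Bseq_def)
  have zC: "norm (z n) \<le> C1 + norm w" for n
    using norm_triangle_ineq[of "z n - w" w] C1[of n] by simp
  have "Bseq (\<lambda>n. P n - z n)" using Pz by (intro convergent_imp_Bseq convergentI)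
  then obtain C2 where C2: "\<And>n. norm (P n - z n) \<le> C2" by (auto simp: Bseq_def)
  have PC: "norm (P n) \<le> C2 + (C1 + norm w)" for n
    using norm_triangle_ineq[of "P n - z n" "z n"] C2[of n] zC[of n] by simp
  obtain z' where z': "z' \<in> S" "z' \<in> {w. - B w \<in> A w}" "weak_conv S z z'"
  proof (rule weak_conv_if_cluster_points[OF S, of z "C1 + norm w" "{w. - B w \<in> A w}"])
    fix G a assume G: "G \<noteq> bot" "G \<le> sequentially" and a: "a \<in> S"
      and lim: "\<And>u. u \<in> S \<Longrightarrow> ((\<lambda>n. z n \<bullet> u) \<longlongrightarrow> a \<bullet> u) G"
    have "((\<lambda>n. P n \<bullet> v) \<longlongrightarrow> a \<bullet> v) G" if "v \<in> S" for v
    proof -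
      have "((\<lambda>n. (P n - z n) \<bullet> v + z n \<bullet> v) \<longlongrightarrow> 0 \<bullet> v + a \<bullet> v) G"
        by (intro tendsto_intros lim that tendsto_mono[OF G(2) Pz])
      then show ?thesis by (simp add: inner_diff_left)
    qed
    then show "a \<in> {w. - B w \<in> A w}"
      using zero_if_weak_cluster_point[OF G(1) a u PC tendsto_mono[OF G(2) u0]] by simp
  qed (use zS zC fejer in auto)
  have "norm (P n - z') \<le> C2 + (C1 + norm w) + norm z'" for n
    using norm_triangle_ineq4[of "P n" z'] PC[of n] by linarith
  then have "(\<lambda>n. (P n - z') \<bullet> u n) \<longlonglongrightarrow> 0" using u0 by (rule tendsto_inner_bounded_null)
  then show thesis using z' u Pz by (intro that) auto
qed

end

section \<open>Finitely supported families of vectors\<close>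

instantiation poly_mapping :: (type, real_vector) real_vector
begin

definition scaleR_poly_mapping :: "real \<Rightarrow> ('a \<Rightarrow>\<^sub>0 'b) \<Rightarrow> 'a \<Rightarrow>\<^sub>0 'b"
  where "scaleR_poly_mapping c f = Poly_Mapping.map (\<lambda>x. c *\<^sub>R x) f"

lemma lookup_scaleR [simp]:
  fixes f :: "'a \<Rightarrow>\<^sub>0 'b"
  shows "Poly_Mapping.lookup (c *\<^sub>R f) k = c *\<^sub>R Poly_Mapping.lookup f k"
  by (simp add: scaleR_poly_mapping_def map.rep_eq when_def)

instance
  by standard (auto intro!: poly_mapping_eqI simp: lookup_add algebra_simps)

end

instantiation poly_mapping :: (type, real_inner) real_inner
begin

definition inner_poly_mapping :: "('a \<Rightarrow>\<^sub>0 'b) \<Rightarrow> ('a \<Rightarrow>\<^sub>0 'b) \<Rightarrow> real"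
  where "inner_poly_mapping f g =
    (\<Sum>k\<in>Poly_Mapping.keys f. Poly_Mapping.lookup f k \<bullet> Poly_Mapping.lookup g k)"

definition norm_poly_mapping :: "('a \<Rightarrow>\<^sub>0 'b) \<Rightarrow> real"
  where "norm_poly_mapping f = sqrt (f \<bullet> f)"

definition sgn_poly_mapping :: "('a \<Rightarrow>\<^sub>0 'b) \<Rightarrow> 'a \<Rightarrow>\<^sub>0 'b"
  where "sgn_poly_mapping f = inverse (norm f) *\<^sub>R f"

definition dist_poly_mapping :: "('a \<Rightarrow>\<^sub>0 'b) \<Rightarrow> ('a \<Rightarrow>\<^sub>0 'b) \<Rightarrow> real"
  where "dist_poly_mapping f g = norm (f - g)"

definition uniformity_poly_mapping :: "(('a \<Rightarrow>\<^sub>0 'b) \<times> ('a \<Rightarrow>\<^sub>0 'b)) filter"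
  where "uniformity_poly_mapping = (INF e\<in>{0<..}. principal {(x, y). dist x y < e})"

definition open_poly_mapping :: "('a \<Rightarrow>\<^sub>0 'b) set \<Rightarrow> bool"
  where "open_poly_mapping U \<longleftrightarrow> (\<forall>x\<in>U. eventually (\<lambda>(x', y). x' = x \<longrightarrow> y \<in> U) uniformity)"

text \<open>Terms outside the support of \<open>f\<close> vanish. A common finite index set removes
  the asymmetry of the definition and lets families with different supports be added.\<close>

lemma inner_poly_mapping_superset:
  fixes f g :: "'a \<Rightarrow>\<^sub>0 'b"
  assumes "finite I" "Poly_Mapping.keys f \<subseteq> I"
  shows "f \<bullet> g = (\<Sum>k\<in>I. Poly_Mapping.lookup f k \<bullet> Poly_Mapping.lookup g k)"
  unfolding inner_poly_mapping_def
  by (rule sum.mono_neutral_left) (use assms in \<open>auto simp: in_keys_iff\<close>)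

instance
proof
  fix f g h :: "'a \<Rightarrow>\<^sub>0 'b" and c :: real
  define I where "I = Poly_Mapping.keys f \<union> Poly_Mapping.keys g"
  have I: "finite I" "Poly_Mapping.keys f \<subseteq> I" "Poly_Mapping.keys g \<subseteq> I"
    "Poly_Mapping.keys (f + g) \<subseteq> I" "Poly_Mapping.keys (c *\<^sub>R f) \<subseteq> I"
    by (auto simp: I_def in_keys_iff lookup_add)
  show "f \<bullet> g = g \<bullet> f"
    by (simp add: inner_poly_mapping_superset[OF I(1,2)] inner_poly_mapping_superset[OF I(1,3)]
        inner_commute)
  show "(f + g) \<bullet> h = f \<bullet> h + g \<bullet> h"
    by (simp add: inner_poly_mapping_superset[OF I(1,2)] inner_poly_mapping_superset[OF I(1,3)]
        inner_poly_mapping_superset[OF I(1,4)] lookup_add inner_add_left sum.distrib)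
  show "(c *\<^sub>R f) \<bullet> g = c * (f \<bullet> g)"
    by (simp add: inner_poly_mapping_superset[OF I(1,2)] inner_poly_mapping_superset[OF I(1,5)]
        sum_distrib_left)
  show "0 \<le> f \<bullet> f" unfolding inner_poly_mapping_def by (intro sum_nonneg) simp
  show "f \<bullet> f = 0 \<longleftrightarrow> f = 0"
    unfolding inner_poly_mapping_def
    by (subst sum_nonneg_eq_0_iff) (auto simp: in_keys_iff intro: poly_mapping_eqI)
qed (auto simp: norm_poly_mapping_def sgn_poly_mapping_def dist_poly_mapping_def
    uniformity_poly_mapping_def open_poly_mapping_def)

end

lemma norm_poly_mapping_superset:
  fixes f :: "'a \<Rightarrow>\<^sub>0 'b::real_inner"
  assumes "finite I" "Poly_Mapping.keys f \<subseteq> I"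
  shows "norm f = L2_set (\<lambda>k. norm (Poly_Mapping.lookup f k)) I"
  by (simp add: norm_eq_sqrt_inner[of f] inner_poly_mapping_superset[OF assms] L2_set_def
      power2_norm_eq_inner)

lemma norm_lookup_le:
  fixes f :: "'a \<Rightarrow>\<^sub>0 'b::real_inner"
  shows "norm (Poly_Mapping.lookup f k) \<le> norm f"
  using member_le_L2_set[of "insert k (Poly_Mapping.keys f)" k "\<lambda>k. norm (Poly_Mapping.lookup f k)"]
  by (subst norm_poly_mapping_superset[of "insert k (Poly_Mapping.keys f)"]) auto

text \<open>Cutting off outside \<open>I\<close> makes the support finite for every \<open>F\<close>
  as soon as \<open>I\<close> is finite, so functions known only on the blocks can be packed
  directly.\<close>

definition finsupp_on :: "'a set \<Rightarrow> ('a \<Rightarrow> 'b) \<Rightarrow> 'a \<Rightarrow>\<^sub>0 'b::zero"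
  where "finsupp_on I F = Abs_poly_mapping (\<lambda>k. if k \<in> I then F k else 0)"

lemma lookup_finsupp_on [simp]:
  assumes "finite I"
  shows "Poly_Mapping.lookup (finsupp_on I F) k = (if k \<in> I then F k else 0)"
  unfolding finsupp_on_def
  by (subst lookup_Abs_poly_mapping) (auto intro: finite_subset[OF _ assms])

text \<open>Supports are confined to one fixed index set; growing supports are what makes the whole
  type incomplete.\<close>

definition finsupp_space :: "'a set \<Rightarrow> ('a \<Rightarrow> 'b set) \<Rightarrow> ('a \<Rightarrow>\<^sub>0 'b::zero) set"
  where "finsupp_space I C = {f. Poly_Mapping.keys f \<subseteq> I \<and> (\<forall>k\<in>I. Poly_Mapping.lookup f k \<in> C k)}"

lemma subspace_finsupp_space:
  assumes "\<And>k. k \<in> I \<Longrightarrow> subspace (C k)"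
  shows "subspace (finsupp_space I C)"
proof (rule subspaceI)
  fix f g assume fg: "f \<in> finsupp_space I C" "g \<in> finsupp_space I C"
  have "Poly_Mapping.keys (f + g) \<subseteq> Poly_Mapping.keys f \<union> Poly_Mapping.keys g"
    by (rule Poly_Mapping.keys_add)
  then show "f + g \<in> finsupp_space I C"
    using fg assms by (auto simp: finsupp_space_def lookup_add subspace_add)
next
  fix f and c :: real assume "f \<in> finsupp_space I C"
  moreover have "Poly_Mapping.keys (c *\<^sub>R f) \<subseteq> Poly_Mapping.keys f" by (auto simp: in_keys_iff)
  ultimately show "c *\<^sub>R f \<in> finsupp_space I C"
    using assms by (auto simp: finsupp_space_def subspace_scale)
qed (use assms in \<open>auto simp: finsupp_space_def subspace_0\<close>)

text \<open>Coordinates are nonexpansive and hence Cauchy. Conversely the norm is at most the finite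
  sum of the coordinate norms, so coordinatewise convergence suffices.\<close>

lemma complete_finsupp_space:
  fixes C :: "'a \<Rightarrow> 'b::real_inner set"
  assumes I: "finite I" and C: "\<And>k. k \<in> I \<Longrightarrow> complete (C k)"
  shows "complete (finsupp_space I C)"
  unfolding complete_def
proof (intro allI impI)
  fix F :: "nat \<Rightarrow> 'a \<Rightarrow>\<^sub>0 'b"
  assume "(\<forall>n. F n \<in> finsupp_space I C) \<and> Cauchy F"
  then have F: "\<And>n. Poly_Mapping.keys (F n) \<subseteq> I" "\<And>n k. k \<in> I \<Longrightarrow> Poly_Mapping.lookup (F n) k \<in> C k"
    and cau: "Cauchy F" by (simp_all add: finsupp_space_def)
  have "\<exists>l\<in>C k. (\<lambda>n. Poly_Mapping.lookup (F n) k) \<longlonglongrightarrow> l" if k: "k \<in> I" for k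
  proof -
    have "Cauchy (\<lambda>n. Poly_Mapping.lookup (F n) k)"
    proof (rule metric_CauchyI)
      fix e :: real assume "e > 0"
      then obtain N where "\<And>m n. m \<ge> N \<Longrightarrow> n \<ge> N \<Longrightarrow> dist (F m) (F n) < e"
        using metric_CauchyD[OF cau] by blast
      moreover have "dist (Poly_Mapping.lookup (F m) k) (Poly_Mapping.lookup (F n) k) \<le> dist (F m) (F n)" for m n
        using norm_lookup_le[of "F m - F n" k] by (simp add: dist_norm lookup_minus)
      ultimately show "\<exists>N. \<forall>m\<ge>N. \<forall>n\<ge>N. dist (Poly_Mapping.lookup (F m) k) (Poly_Mapping.lookup (F n) k) < e"
        by (meson le_less_trans)
    qed
    then show ?thesis
      using C[OF k, unfolded complete_def, rule_format, of "\<lambda>n. Poly_Mapping.lookup (F n) k"] F(2)[OF k]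
      by auto
  qed
  then obtain l where l: "\<And>k. k \<in> I \<Longrightarrow> l k \<in> C k" "\<And>k. k \<in> I \<Longrightarrow> (\<lambda>n. Poly_Mapping.lookup (F n) k) \<longlonglongrightarrow> l k"
    by metis
  let ?l = "finsupp_on I l"
  have kl: "Poly_Mapping.keys ?l \<subseteq> I" using I by (auto simp: in_keys_iff split: if_splits)
  have "F \<longlonglongrightarrow> ?l"
  proof (rule LIM_zero_cancel, rule Lim_null_comparison, intro always_eventually allI)
    fix n
    have "Poly_Mapping.keys (F n - ?l) \<subseteq> I"
      using keys_diff[of "F n" ?l] F(1)[of n] kl by (meson Un_least order_trans)
    then have "norm (F n - ?l) \<le> (\<Sum>k\<in>I. norm (Poly_Mapping.lookup (F n - ?l) k))"
      by (simp add: norm_poly_mapping_superset[OF I] L2_set_le_sum)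
    also have "\<dots> = (\<Sum>k\<in>I. norm (Poly_Mapping.lookup (F n) k - l k))"
      using I by (intro sum.cong) (auto simp: lookup_minus)
    finally show "norm (F n - ?l) \<le> (\<Sum>k\<in>I. norm (Poly_Mapping.lookup (F n) k - l k))" .
  next
    have "(\<lambda>n. \<Sum>k\<in>I. norm (Poly_Mapping.lookup (F n) k - l k)) \<longlonglongrightarrow> (\<Sum>k\<in>I. norm (l k - l k))"
      by (intro tendsto_intros l)
    then show "(\<lambda>n. \<Sum>k\<in>I. norm (Poly_Mapping.lookup (F n) k - l k)) \<longlonglongrightarrow> 0" by simp
  qed
  moreover have "?l \<in> finsupp_space I C"
    using l(1) kl I by (auto simp: finsupp_space_def)
  ultimately show "\<exists>l\<in>finsupp_space I C. F \<longlonglongrightarrow> l" by blast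
qed

lemma complete_Times_inner:
  fixes S :: "'a::real_inner set" and T :: "'b::real_inner set"
  assumes "complete S" "complete T"
  shows "complete (S \<times> T)"
  unfolding complete_def
proof (intro allI impI)
  fix F :: "nat \<Rightarrow> 'a \<times> 'b" assume "(\<forall>n. F n \<in> S \<times> T) \<and> Cauchy F"
  then have F: "\<And>n. fst (F n) \<in> S" "\<And>n. snd (F n) \<in> T" and cF: "Cauchy F"
    by (simp_all add: mem_Times_iff)
  note cau = Cauchy_fst[OF cF] Cauchy_snd[OF cF]
  obtain a where a: "a \<in> S" "(\<lambda>n. fst (F n)) \<longlonglongrightarrow> a"
    using assms(1)[unfolded complete_def, rule_format, of "\<lambda>n. fst (F n)"] F(1) cau(1) by auto
  obtain b where b: "b \<in> T" "(\<lambda>n. snd (F n)) \<longlonglongrightarrow> b"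
    using assms(2)[unfolded complete_def, rule_format, of "\<lambda>n. snd (F n)"] F(2) cau(2) by auto
  show "\<exists>l\<in>S \<times> T. F \<longlonglongrightarrow> l"
    using a b tendsto_Pair[OF a(2) b(2)] by (intro bexI[of _ "(a, b)"]) auto
qed

text \<open>Coordinates of the product space: \<open>a\<close> is the x-part, and
  \<open>b k\<close>, \<open>c k\<close>, \<open>d k\<close> are the parts y, v, w of block
  \<open>k\<close>. Values outside the blocks are discarded.\<close>

definition tuple :: "nat \<Rightarrow> 'h \<Rightarrow> (nat \<Rightarrow> 'h) \<Rightarrow> (nat \<Rightarrow> 'g) \<Rightarrow> (nat \<Rightarrow> 'k)
    \<Rightarrow> 'h::real_inner \<times> (nat \<Rightarrow>\<^sub>0 'h \<times> 'g::real_inner \<times> 'k::real_inner)"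
  where "tuple r a b c d = (a, finsupp_on {1..r} (\<lambda>k. (b k, c k, d k)))"

lemma tuple_cong:
  assumes "\<And>k. k \<in> {1..r} \<Longrightarrow> b k = b' k" "\<And>k. k \<in> {1..r} \<Longrightarrow> c k = c' k"
    "\<And>k. k \<in> {1..r} \<Longrightarrow> d k = d' k"
  shows "tuple r a b c d = tuple r a b' c' d'"
  unfolding tuple_def using assms by (auto intro!: poly_mapping_eqI)

lemma tuple_eq_iff:
  "tuple r a b c d = tuple r a' b' c' d' \<longleftrightarrow>
    a = a' \<and> (\<forall>k\<in>{1..r}. b k = b' k \<and> c k = c' k \<and> d k = d' k)"
proof
  assume "tuple r a b c d = tuple r a' b' c' d'"
  then have eq: "finsupp_on {1..r} (\<lambda>k. (b k, c k, d k)) = finsupp_on {1..r} (\<lambda>k. (b' k, c' k, d' k))"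
    and "a = a'" by (simp_all add: tuple_def)
  moreover have "(b k, c k, d k) = (b' k, c' k, d' k)" if "k \<in> {1..r}" for k
    using arg_cong[OF eq, of "\<lambda>f. Poly_Mapping.lookup f k"] that by simp
  ultimately show "a = a' \<and> (\<forall>k\<in>{1..r}. b k = b' k \<and> c k = c' k \<and> d k = d' k)" by simp
qed (auto intro: tuple_cong)

lemma tuple_add: "tuple r a b c d + tuple r a' b' c' d'
    = tuple r (a + a') (\<lambda>k. b k + b' k) (\<lambda>k. c k + c' k) (\<lambda>k. d k + d' k)"
  unfolding tuple_def by (auto intro!: poly_mapping_eqI simp: lookup_add)

lemma tuple_diff: "tuple r a b c d - tuple r a' b' c' d'
    = tuple r (a - a') (\<lambda>k. b k - b' k) (\<lambda>k. c k - c' k) (\<lambda>k. d k - d' k)"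
  unfolding tuple_def by (auto intro!: poly_mapping_eqI simp: lookup_minus)

lemma tuple_scaleR: "t *\<^sub>R tuple r a b c d
    = tuple r (t *\<^sub>R a) (\<lambda>k. t *\<^sub>R b k) (\<lambda>k. t *\<^sub>R c k) (\<lambda>k. t *\<^sub>R d k)"
  unfolding tuple_def by (auto intro!: poly_mapping_eqI)

lemma tuple_uminus: "- tuple r a b c d = tuple r (- a) (\<lambda>k. - b k) (\<lambda>k. - c k) (\<lambda>k. - d k)"
  using tuple_scaleR[of "-1" r a b c d] by simp

lemma tuple_inner: "tuple r a b c d \<bullet> tuple r a' b' c' d'
    = a \<bullet> a' + (\<Sum>k\<in>{1..r}. b k \<bullet> b' k + c k \<bullet> c' k + d k \<bullet> d' k)"
proof -
  have "Poly_Mapping.keys (finsupp_on {1..r} (\<lambda>k. (b k, c k, d k))) \<subseteq> {1..r}"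
    by (auto simp: in_keys_iff split: if_splits)
  then show ?thesis
    by (simp add: tuple_def inner_poly_mapping_superset[of "{1..r}"] add.assoc)
qed

lemma tuple_norm_sq: "(norm (tuple r a b c d))\<^sup>2
    = (norm a)\<^sup>2 + (\<Sum>k\<in>{1..r}. (norm (b k))\<^sup>2 + (norm (c k))\<^sup>2 + (norm (d k))\<^sup>2)"
  by (simp only: power2_norm_eq_inner tuple_inner)

lemma tuple_norm_le: "norm (tuple r a b c d)
    \<le> norm a + (\<Sum>k\<in>{1..r}. norm (b k) + norm (c k) + norm (d k))"
proof -
  let ?F = "finsupp_on {1..r} (\<lambda>k. (b k, c k, d k))"
  have "Poly_Mapping.keys ?F \<subseteq> {1..r}" by (auto simp: in_keys_iff split: if_splits)
  then have "norm ?F = L2_set (\<lambda>k. norm (Poly_Mapping.lookup ?F k)) {1..r}"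
    by (rule norm_poly_mapping_superset[rotated]) simp
  also have "\<dots> \<le> (\<Sum>k\<in>{1..r}. norm (Poly_Mapping.lookup ?F k))"
    by (rule L2_set_le_sum) simp
  also have "\<dots> \<le> (\<Sum>k\<in>{1..r}. norm (b k) + norm (c k) + norm (d k))"
  proof (rule sum_mono)
    fix k assume "k \<in> {1..r}"
    then show "norm (Poly_Mapping.lookup ?F k) \<le> norm (b k) + norm (c k) + norm (d k)"
      using norm_Pair_le[of "b k" "(c k, d k)"] norm_Pair_le[of "c k" "d k"] by simp
  qed
  finally have "norm ?F \<le> (\<Sum>k\<in>{1..r}. norm (b k) + norm (c k) + norm (d k))" .
  then show ?thesis using norm_Pair_le[of a ?F] by (simp add: tuple_def)
qed

lemma tuple_component_norm_le:
  shows "norm a \<le> norm (tuple r a b c d)" "k \<in> {1..r} \<Longrightarrow> norm (c k) \<le> norm (tuple r a b c d)"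
proof -
  show "norm a \<le> norm (tuple r a b c d)"
    by (rule power2_le_imp_le) (auto simp: tuple_norm_sq intro!: sum_nonneg)
  assume k: "k \<in> {1..r}"
  have "(norm (c k))\<^sup>2 \<le> (norm (b k))\<^sup>2 + (norm (c k))\<^sup>2 + (norm (d k))\<^sup>2" by simp
  also have "\<dots> \<le> (\<Sum>k\<in>{1..r}. (norm (b k))\<^sup>2 + (norm (c k))\<^sup>2 + (norm (d k))\<^sup>2)"
    by (rule member_le_sum[OF k]) auto
  also have "\<dots> \<le> (norm (tuple r a b c d))\<^sup>2" by (simp add: tuple_norm_sq)
  finally show "norm (c k) \<le> norm (tuple r a b c d)" by (rule power2_le_imp_le) simp
qed

definition tuple_space :: "nat \<Rightarrow> (nat \<Rightarrow> 'g::real_inner set) \<Rightarrow> (nat \<Rightarrow> 'k::real_inner set)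
    \<Rightarrow> ('h::real_inner \<times> (nat \<Rightarrow>\<^sub>0 'h \<times> 'g \<times> 'k)) set"
  where "tuple_space r G K = UNIV \<times> finsupp_space {1..r} (\<lambda>k. UNIV \<times> G k \<times> K k)"

lemma tuple_mem_space_iff:
  "tuple r a b c d \<in> tuple_space r G K \<longleftrightarrow> (\<forall>k\<in>{1..r}. c k \<in> G k \<and> d k \<in> K k)"
  by (auto simp: tuple_def tuple_space_def finsupp_space_def in_keys_iff split: if_splits)

lemma tuple_space_cases:
  assumes "s \<in> tuple_space r G K"
  obtains a b c d where "s = tuple r a b c d" "\<forall>k\<in>{1..r}. c k \<in> G k \<and> d k \<in> K k"
proof -
  obtain a F where s: "s = (a, F)" and F: "Poly_Mapping.keys F \<subseteq> {1..r}"
    "\<And>k. k \<in> {1..r} \<Longrightarrow> Poly_Mapping.lookup F k \<in> UNIV \<times> G k \<times> K k"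
    using assms by (auto simp: tuple_space_def finsupp_space_def)
  have "F = finsupp_on {1..r} (Poly_Mapping.lookup F)"
    using F(1) by (intro poly_mapping_eqI) (auto simp: in_keys_iff)
  then have "s = tuple r a (\<lambda>k. fst (Poly_Mapping.lookup F k))
      (\<lambda>k. fst (snd (Poly_Mapping.lookup F k))) (\<lambda>k. snd (snd (Poly_Mapping.lookup F k)))"
    by (simp add: s tuple_def)
  then show thesis using F(2) by (elim that) (auto simp: mem_Times_iff)
qed

lemma tuple_space_subspace:
  assumes "\<And>k. k \<in> {1..r} \<Longrightarrow> subspace (G k)" "\<And>k. k \<in> {1..r} \<Longrightarrow> subspace (K k)"
  shows "subspace (tuple_space r G K)"
  unfolding tuple_space_def by (intro subspace_Times subspace_UNIV subspace_finsupp_space assms)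

lemma tuple_space_complete:
  assumes "\<And>k. k \<in> {1..r} \<Longrightarrow> complete (G k)" "\<And>k. k \<in> {1..r} \<Longrightarrow> complete (K k)"
  shows "complete (tuple_space r G K :: ('h::{real_inner,complete_space} \<times> _) set)"
  unfolding tuple_space_def
  by (intro complete_Times_inner complete_UNIV complete_finsupp_space assms finite_atLeastAtMost)

section \<open>Subgradients, conjugates and uniform convexity\<close>

lemma Gamma0_scale:
  assumes f: "Gamma0 S f" and c: "0 < c"
  shows "Gamma0 S (\<lambda>u. ereal c * f u)"
  unfolding Gamma0_def
proof (intro conjI ballI allI)
  show "ereal c * f x \<noteq> -\<infinity>" if "x \<in> S" for x
    using Gamma0_not_MInf[OF f that] c by (cases "f x") auto
  show "edom S (\<lambda>u. ereal c * f u) \<noteq> {}"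
  proof -
    obtain x where x: "x \<in> S" "f x < \<infinity>" using f by (auto simp: Gamma0_def edom_def)
    then have "ereal c * f x < \<infinity>" using c by (cases "f x") auto
    then show ?thesis using x by (auto simp: edom_def)
  qed
  show "ereal c * f ((1 - t) *\<^sub>R x + t *\<^sub>R y)
      \<le> ereal (1 - t) * (ereal c * f x) + ereal t * (ereal c * f y)"
    if xy: "x \<in> S" "y \<in> S" and t: "t \<in> {0<..<1}" for x y t
  proof -
    have "ereal c * f ((1 - t) *\<^sub>R x + t *\<^sub>R y) \<le> ereal c * (ereal (1 - t) * f x + ereal t * f y)"
      using t c by (intro ereal_mult_left_mono Gamma0_convexD[OF f xy]) auto
    also have "\<dots> = ereal c * (ereal (1 - t) * f x) + ereal c * (ereal t * f y)"
      by (rule ereal_pos_distrib) (use c in auto)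
    also have "\<dots> = ereal (1 - t) * (ereal c * f x) + ereal t * (ereal c * f y)"
      by (simp add: ac_simps)
    finally show ?thesis .
  qed
  show "closedin (top_of_set S) {x \<in> S. ereal c * f x \<le> b}" for b
  proof -
    have "ereal c * f x \<le> b \<longleftrightarrow> f x \<le> ereal (1 / c) * b" for x
      using c by (cases "f x"; cases b) (auto simp: field_simps)
    then show ?thesis using Gamma0_closedin[OF f] by simp
  qed
qed

lemma prox_scaled_subdiff:
  fixes S :: "'a::real_inner set"
  assumes f: "Gamma0 S f" and S: "subspace S" "complete S" and c: "0 < c" and x: "x \<in> S"
  shows "(1 / c) *\<^sub>R (x - prox S (\<lambda>u. ereal c * f u) x)
    \<in> subdiff S f (prox S (\<lambda>u. ereal c * f u) x)"
proof -
  define p where "p = prox S (\<lambda>u. ereal c * f u) x"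
  have sub: "x - p \<in> subdiff S (\<lambda>u. ereal c * f u) p"
    unfolding p_def by (rule prox_subdiff[OF Gamma0_scale[OF f c] S x])
  then have p: "p \<in> S" "ereal c * f p < \<infinity>" and xp: "x - p \<in> S" by (auto simp: subdiff_def)
  have "\<bar>f p\<bar> \<noteq> \<infinity>" using Gamma0_not_MInf[OF f p(1)] p(2) c by (cases "f p") auto
  then obtain v where v: "f p = ereal v" by auto
  have "ereal ((y - p) \<bullet> ((1 / c) *\<^sub>R (x - p))) + f p \<le> f y" if y: "y \<in> S" for y
  proof -
    have "ereal ((y - p) \<bullet> (x - p)) + ereal c * f p \<le> ereal c * f y"
      using sub y by (auto simp: subdiff_def)
    then show ?thesis
      unfolding v inner_scaleR_right using c Gamma0_not_MInf[OF f y] by (cases "f y") (auto simp: field_simps)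
  qed
  then show ?thesis
    unfolding p_def[symmetric] using p v S(1) xp by (auto simp: subdiff_def subspace_scale)
qed

text \<open>By Moreau's decomposition \<open>s - c *\<^sub>R q\<close> is the proximal point of
  \<open>c\<close> times the conjugate. With \<open>p = s - c *\<^sub>R q\<close>, the claim
  \<open>p \<in> subdiff S f q\<close> puts \<open>(1 / c) *\<^sub>R (s - p) = q\<close> into the
  inverse subdifferential at \<open>p\<close>: the backward step for the inverse, obtained without
  proximity operators of conjugates.\<close>

lemma moreau_decomposition_subdiff:
  fixes S :: "'a::real_inner set"
  assumes f: "Gamma0 S f" and S: "subspace S" "complete S" and c: "0 < c" and s: "s \<in> S"
  defines "q \<equiv> prox S (\<lambda>u. ereal (1 / c) * f u) ((1 / c) *\<^sub>R s)"
  shows "s - c *\<^sub>R q \<in> subdiff S f q"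
proof -
  have "(1 / (1 / c)) *\<^sub>R ((1 / c) *\<^sub>R s - q) \<in> subdiff S f q"
    unfolding q_def using c s S by (intro prox_scaled_subdiff f S) (auto simp: subspace_scale)
  moreover have "(1 / (1 / c)) *\<^sub>R ((1 / c) *\<^sub>R s - q) = s - c *\<^sub>R q"
    using c by (simp add: scaleR_diff_right)
  ultimately show ?thesis by simp
qed

section \<open>Fenchel-Young relations, uniform convexity and gradients\<close>

lemma subdiff_real:
  assumes f: "Gamma0 S f" and u: "u \<in> subdiff S f x"
  shows "x \<in> S" "u \<in> S" "f x = ereal (real_of_ereal (f x))"
proof -
  show "x \<in> S" "u \<in> S" using u by (auto simp: subdiff_def)
  then have "f x \<noteq> -\<infinity>" "f x < \<infinity>" using Gamma0_not_MInf[OF f] u by (auto simp: subdiff_def)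
  then show "f x = ereal (real_of_ereal (f x))" by (cases "f x") auto
qed

text \<open>Equality case of the Fenchel-Young inequality: the supremum is attained at
  \<open>x\<close>.\<close>

lemma conj_at_subgradient:
  assumes f: "Gamma0 S f" and u: "u \<in> subdiff S f x"
  shows "conj S f u = ereal (u \<bullet> x - real_of_ereal (f x))"
proof -
  note fx = subdiff_real[OF f u]
  have "ereal (u \<bullet> y) - f y \<le> ereal (u \<bullet> x - real_of_ereal (f x))" if y: "y \<in> S" for y
  proof -
    have "ereal ((y - x) \<bullet> u) + ereal (real_of_ereal (f x)) \<le> f y"
      using u y fx(3) by (auto simp: subdiff_def)
    then show ?thesis by (cases "f y") (auto simp: inner_diff_right inner_commute[of _ u])
  qed
  moreover have "ereal (u \<bullet> x) - f x = ereal (u \<bullet> x - real_of_ereal (f x))"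
    by (subst fx(3)) simp
  ultimately show ?thesis unfolding conj_def using fx(1) by (intro antisym SUP_least) (auto intro: SUP_upper2)
qed

lemma conj_ge_affine:
  assumes "x \<in> S" "f x = ereal c"
  shows "ereal (u \<bullet> x - c) \<le> conj S f u"
  unfolding conj_def using assms by (intro SUP_upper2[of x]) auto

text \<open>Fenchel-Young, with equality at \<open>u\<close>, is already the subgradient inequality
  of the conjugate; this half of the inversion rule involves no biconjugate.\<close>

lemma subdiff_conj:
  assumes f: "Gamma0 S f" and u: "u \<in> subdiff S f x"
  shows "x \<in> subdiff S (conj S f) u"
proof -
  note fx = subdiff_real[OF f u]
  have "ereal ((v - u) \<bullet> x) + conj S f u \<le> conj S f v" for v
    using conj_ge_affine[of x S f "real_of_ereal (f x)" v, OF fx(1,3)]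
    by (simp add: conj_at_subgradient[OF f u] inner_diff_left)
  then show ?thesis using fx(1,2) conj_at_subgradient[OF f u] by (auto simp: subdiff_def)
qed

text \<open>Uniform convexity at the midpoint of \<open>x\<close> and \<open>p n\<close>, combined
  with the subgradient inequalities at both ends, bounds the modulus of the distance by twice the
  monotonicity product.\<close>

lemma unif_convex_at_tendsto:
  fixes S :: "'a::real_inner set"
  assumes S: "subspace S"
    and uc: "unif_convex_at S f x" and fx: "f x \<noteq> -\<infinity>"
    and u: "u \<in> subdiff S f x" and un: "\<And>n. un n \<in> subdiff S f (p n)"
    and lim: "(\<lambda>n. (p n - x) \<bullet> (un n - u)) \<longlonglongrightarrow> 0"
  shows "p \<longlonglongrightarrow> x"
proof -
  obtain \<phi> :: "real \<Rightarrow> ereal" where \<phi>: "mono_on {0..} \<phi>" "\<forall>t\<ge>0. 0 \<le> \<phi> t"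
    "\<forall>t\<ge>0. \<phi> t = 0 \<longleftrightarrow> t = 0"
    "\<forall>y\<in>edom S f. \<forall>\<alpha>\<in>{0<..<1::real}.
      f (\<alpha> *\<^sub>R x + (1 - \<alpha>) *\<^sub>R y) + ereal (\<alpha> * (1 - \<alpha>)) * \<phi> (norm (x - y))
        \<le> ereal \<alpha> * f x + ereal (1 - \<alpha>) * f y"
    using uc unfolding unif_convex_at_def by (elim conjE exE)
  note mono = \<phi>(1) and pos = \<phi>(2)[rule_format] and zero = \<phi>(3)[rule_format]
    and conv = \<phi>(4)[rule_format]
  have xS: "x \<in> S" and fxI: "f x < \<infinity>" using u by (auto simp: subdiff_def)
  with fx obtain a where a: "f x = ereal a" by (cases "f x") auto
  have bound: "\<phi> (norm (x - p n)) \<le> ereal (2 * ((p n - x) \<bullet> (un n - u)))" for n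
  proof -
    have pS: "p n \<in> S" and fp: "f (p n) < \<infinity>" using un[of n] by (auto simp: subdiff_def)
    have "ereal ((p n - x) \<bullet> u) + f x \<le> f (p n)" using u pS by (auto simp: subdiff_def)
    with fp a obtain b where b: "f (p n) = ereal b" by (cases "f (p n)") auto
    have "ereal ((x - p n) \<bullet> un n) + f (p n) \<le> f x" using un[of n] xS by (auto simp: subdiff_def)
    then have 1: "(x - p n) \<bullet> un n + b \<le> a" by (simp add: a b)
    let ?m = "(1/2) *\<^sub>R x + (1 - 1/2) *\<^sub>R p n"
    have mS: "?m \<in> S" using S xS pS by (simp add: subspace_add subspace_scale)
    have "(?m - x) \<bullet> u = ((p n - x) \<bullet> u) / 2"
      by (simp add: inner_add_left inner_diff_left field_simps)
    moreover have "ereal ((?m - x) \<bullet> u) + f x \<le> f ?m" using u mS by (auto simp: subdiff_def)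
    ultimately have "ereal (((p n - x) \<bullet> u) / 2 + a) \<le> f ?m" by (simp only: a plus_ereal.simps)
    then have "ereal (((p n - x) \<bullet> u) / 2 + a) + ereal (1/2 * (1 - 1/2)) * \<phi> (norm (x - p n))
        \<le> f ?m + ereal (1/2 * (1 - 1/2)) * \<phi> (norm (x - p n))"
      by (rule add_right_mono)
    also have "\<dots> \<le> ereal (1/2) * f x + ereal (1 - 1/2) * f (p n)"
      using pS fp by (intro conv) (auto simp: edom_def)
    finally have 2: "ereal (((p n - x) \<bullet> u) / 2 + a) + ereal (1/4) * \<phi> (norm (x - p n))
        \<le> ereal (a / 2 + b / 2)" by (simp add: a b)
    then show ?thesis
    proof (cases "\<phi> (norm (x - p n))")
      case (real t)
      then have "((p n - x) \<bullet> u) / 2 + a + t / 4 \<le> a / 2 + b / 2" using 2 by simp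
      then have "t \<le> 2 * (b - a - (p n - x) \<bullet> u)" by (simp add: field_simps)
      also have "\<dots> \<le> 2 * ((p n - x) \<bullet> (un n - u))" using 1 by (simp add: inner_diff_left inner_diff_right)
      finally show ?thesis by (simp add: real)
    qed (use 2 in auto)
  qed
  show ?thesis
  proof (rule tendstoI)
    fix e :: real assume e: "e > 0"
    then have "0 < \<phi> e" using pos[of e] zero[of e] by (simp add: order_less_le)
    \<comment> \<open>The modulus need not be continuous or finite. A real number strictly between 0
      and \<open>\<phi> e\<close> suffices, since monotonicity converts a modulus below
      \<open>\<phi> e\<close> into a distance below \<open>e\<close>.\<close>
    then obtain d where d: "0 < d" "ereal d < \<phi> e"
      by (metis ereal_dense2 ereal_less(2) zero_ereal_def less_ereal.simps(1))
    have "(\<lambda>n. 2 * ((p n - x) \<bullet> (un n - u))) \<longlonglongrightarrow> 0" by (rule tendsto_mult_right_zero[OF lim])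
    then have "\<forall>\<^sub>F n in sequentially. 2 * ((p n - x) \<bullet> (un n - u)) < d"
      using d(1) by (rule order_tendstoD)
    then show "\<forall>\<^sub>F n in sequentially. dist (p n) x < e"
    proof eventually_elim
      case (elim n)
      have "\<phi> (norm (x - p n)) \<le> ereal (2 * ((p n - x) \<bullet> (un n - u)))" by (rule bound)
      also have "\<dots> < ereal d" using elim by simp
      finally have "\<phi> (norm (x - p n)) < \<phi> e" using d(2) by simp
      then have "\<not> e \<le> norm (x - p n)"
        using mono e by (auto simp: mono_on_def not_le[symmetric])
      then show ?case by (simp add: dist_norm norm_minus_commute)
    qed
  qed
qed

text \<open>The derivative along the segment is a limit of difference quotients, each at most
  \<open>l v - l u\<close> by convexity.\<close>

lemma convex_gradient_le:
  fixes l :: "'a::real_inner \<Rightarrow> real"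
  assumes diff: "(l has_derivative (\<lambda>d. gr \<bullet> d)) (at u)" and conv: "convex_on UNIV l"
  shows "l u + gr \<bullet> (v - u) \<le> l v"
proof -
  let ?\<psi> = "\<lambda>t. l (u + t *\<^sub>R (v - u))"
  have "((\<lambda>t. u + t *\<^sub>R (v - u)) has_derivative (\<lambda>t. t *\<^sub>R (v - u))) (at 0)"
    by (auto intro!: derivative_eq_intros)
  moreover have "(l has_derivative (\<lambda>d. gr \<bullet> d)) (at (u + 0 *\<^sub>R (v - u)))" using diff by simp
  ultimately have "(?\<psi> has_derivative (\<lambda>t. gr \<bullet> (t *\<^sub>R (v - u)))) (at 0)"
    by (rule has_derivative_compose)
  then have "(?\<psi> has_real_derivative (gr \<bullet> (v - u))) (at 0)"
    by (simp add: has_field_derivative_def mult_commute_abs)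
  then have "((\<lambda>t. (?\<psi> t - ?\<psi> 0) / (t - 0)) \<longlongrightarrow> gr \<bullet> (v - u)) (at 0)"
    unfolding has_field_derivative_iff by simp
  then have lim: "((\<lambda>t. (?\<psi> t - ?\<psi> 0) / (t - 0)) \<longlongrightarrow> gr \<bullet> (v - u)) (at_right 0)"
    by (rule tendsto_mono[rotated]) (simp add: at_le)
  have "\<forall>\<^sub>F t in at_right (0::real). (?\<psi> t - ?\<psi> 0) / (t - 0) \<le> l v - l u"
    unfolding eventually_at_right_field
  proof (intro exI[of _ 1] conjI allI impI)
    fix t :: real assume t: "0 < t" "t < 1"
    have "l ((1 - t) *\<^sub>R u + t *\<^sub>R v) \<le> (1 - t) * l u + t * l v"
      using t by (intro convex_onD[OF conv]) auto
    moreover have "(1 - t) *\<^sub>R u + t *\<^sub>R v = u + t *\<^sub>R (v - u)" by (simp add: algebra_simps)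
    ultimately show "(?\<psi> t - ?\<psi> 0) / (t - 0) \<le> l v - l u" using t by (simp add: field_simps)
  qed simp
  then have "gr \<bullet> (v - u) \<le> l v - l u" by (rule tendsto_upperbound[OF lim]) simp
  then show ?thesis by simp
qed

text \<open>Source of the constant under the square root in beta. Here \<open>l k\<close> and
  \<open>m k\<close> stand for the norms of \<open>L k\<close> and \<open>M k\<close>, and
  \<open>a\<close>, \<open>b k\<close> for those of x and the y-parts; the left side bounds the
  squared norm of the family of \<open>L k (x - y k)\<close> and \<open>M k (y k)\<close>.\<close>

lemma sum_squares_coupling_bound:
  fixes l m b :: "'i \<Rightarrow> real" and a X :: real
  assumes X: "\<And>k. k \<in> I \<Longrightarrow> (l k)\<^sup>2 + (m k)\<^sup>2 \<le> X" and X0: "0 \<le> X"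
  shows "(\<Sum>k\<in>I. (l k * a + l k * b k)\<^sup>2 + (m k * b k)\<^sup>2)
    \<le> ((\<Sum>k\<in>I. (l k)\<^sup>2) + X) * (a\<^sup>2 + (\<Sum>k\<in>I. (b k)\<^sup>2))"
proof -
  define \<Lambda> N Q where "\<Lambda> = (\<Sum>k\<in>I. (l k)\<^sup>2)" and "N = (\<Sum>k\<in>I. (b k)\<^sup>2)"
    and "Q = (\<Sum>k\<in>I. l k * (l k * b k))"
  have nonneg: "0 \<le> \<Lambda>" "0 \<le> N" by (auto simp: \<Lambda>_def N_def sum_nonneg)
  have lb: "(\<Sum>k\<in>I. (l k * b k)\<^sup>2) + (\<Sum>k\<in>I. (m k * b k)\<^sup>2) \<le> X * N"
    unfolding N_def sum_distrib_left sum.distrib[symmetric]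
  proof (rule sum_mono)
    fix k assume "k \<in> I"
    then have "((l k)\<^sup>2 + (m k)\<^sup>2) * (b k)\<^sup>2 \<le> X * (b k)\<^sup>2" by (intro mult_right_mono X) auto
    then show "(l k * b k)\<^sup>2 + (m k * b k)\<^sup>2 \<le> X * (b k)\<^sup>2"
      by (simp add: power_mult_distrib distrib_right)
  qed
  have "(\<Sum>k\<in>I. (m k * b k)\<^sup>2) \<ge> 0" by (rule sum_nonneg) simp
  then have lb': "(\<Sum>k\<in>I. (l k * b k)\<^sup>2) \<le> X * N" using lb by linarith
  have "Q\<^sup>2 \<le> \<Lambda> * (\<Sum>k\<in>I. (l k * b k)\<^sup>2)"
    unfolding Q_def \<Lambda>_def by (rule Cauchy_Schwarz_ineq_sum)
  also have "\<dots> \<le> \<Lambda> * (X * N)" by (rule mult_left_mono[OF lb' nonneg(1)])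
  finally have Q: "Q\<^sup>2 \<le> \<Lambda> * (X * N)" .
  \<comment> \<open>The cross term: Cauchy-Schwarz bounds \<open>Q\<^sup>2\<close>, and the
    arithmetic-geometric mean inequality, written as a difference of two squares, distributes it
    over \<open>X * a\<^sup>2\<close> and \<open>\<Lambda> * N\<close>.\<close>
  have "(2 * a * Q)\<^sup>2 \<le> (X * a\<^sup>2 + \<Lambda> * N)\<^sup>2"
  proof -
    have "(2 * a * Q)\<^sup>2 = 4 * a\<^sup>2 * Q\<^sup>2" by (simp add: power_mult_distrib)
    also have "\<dots> \<le> 4 * a\<^sup>2 * (\<Lambda> * (X * N))" by (rule mult_left_mono[OF Q]) simp
    also have "\<dots> = (X * a\<^sup>2 + \<Lambda> * N)\<^sup>2 - (X * a\<^sup>2 - \<Lambda> * N)\<^sup>2"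
      by (simp add: power2_eq_square algebra_simps)
    also have "\<dots> \<le> (X * a\<^sup>2 + \<Lambda> * N)\<^sup>2" by simp
    finally show ?thesis .
  qed
  then have aQ: "2 * a * Q \<le> X * a\<^sup>2 + \<Lambda> * N"
    by (rule power2_le_imp_le) (use X0 nonneg in auto)
  have "(\<Sum>k\<in>I. (l k * a + l k * b k)\<^sup>2 + (m k * b k)\<^sup>2)
      = (\<Sum>k\<in>I. a\<^sup>2 * (l k)\<^sup>2 + 2 * a * (l k * (l k * b k)) + (l k * b k)\<^sup>2 + (m k * b k)\<^sup>2)"
    by (rule sum.cong) (simp_all add: power2_eq_square algebra_simps)
  also have "\<dots> = a\<^sup>2 * \<Lambda> + 2 * a * Q + (\<Sum>k\<in>I. (l k * b k)\<^sup>2) + (\<Sum>k\<in>I. (m k * b k)\<^sup>2)"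
    unfolding \<Lambda>_def Q_def sum_distrib_left sum.distrib ..
  also have "\<dots> \<le> a\<^sup>2 * \<Lambda> + (X * a\<^sup>2 + \<Lambda> * N) + X * N" using aQ lb by linarith
  also have "\<dots> = (\<Lambda> + X) * (a\<^sup>2 + N)" by (simp add: algebra_simps)
  finally show ?thesis by (simp add: \<Lambda>_def N_def)
qed

section \<open>The primal-dual inclusion of the parallel sum system\<close>

locale parallel_sum_system =
  fixes r :: nat and z :: "'h::{real_inner,complete_space}"
    and f :: "'h \<Rightarrow> ereal" and gradl :: "'h \<Rightarrow> 'h" and mu :: real
    and G :: "nat \<Rightarrow> 'g::{real_inner,complete_space} set"
    and K :: "nat \<Rightarrow> 'k::{real_inner,complete_space} set"
    and g :: "nat \<Rightarrow> 'g \<Rightarrow> ereal" and h :: "nat \<Rightarrow> 'k \<Rightarrow> ereal"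
    and L :: "nat \<Rightarrow> 'h \<Rightarrow> 'g" and M :: "nat \<Rightarrow> 'h \<Rightarrow> 'k"
  assumes r_pos: "r \<ge> 1"
    and f_G0: "Gamma0 UNIV f"
    and grad_mono: "0 \<le> (u - u') \<bullet> (gradl u - gradl u')"
    and mu_nonneg: "0 \<le> mu"
    and grad_lip: "norm (gradl u - gradl u') \<le> mu * norm (u - u')"
    and G_hilb: "k \<in> {1..r} \<Longrightarrow> hilbert_sub (G k)"
    and K_hilb: "k \<in> {1..r} \<Longrightarrow> hilbert_sub (K k)"
    and g_G0: "k \<in> {1..r} \<Longrightarrow> Gamma0 (G k) (g k)"
    and h_G0: "k \<in> {1..r} \<Longrightarrow> Gamma0 (K k) (h k)"
    and L_bl: "k \<in> {1..r} \<Longrightarrow> bounded_linear (L k)"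
    and M_bl: "k \<in> {1..r} \<Longrightarrow> bounded_linear (M k)"
    and L_mem: "k \<in> {1..r} \<Longrightarrow> L k u \<in> G k"
    and M_mem: "k \<in> {1..r} \<Longrightarrow> M k u \<in> K k"
begin

text \<open>Skew linear part of B. The v- and w-rows are minus the map sending the x- and y-parts to
  \<open>L k (a - b k)\<close> and \<open>M k (b k)\<close>; the x- and y-rows are the adjoint of
  that map.\<close>

definition coupling :: "'h \<Rightarrow> (nat \<Rightarrow> 'h) \<Rightarrow> (nat \<Rightarrow> 'g) \<Rightarrow> (nat \<Rightarrow> 'k) \<Rightarrow> 'h \<times> (nat \<Rightarrow>\<^sub>0 'h \<times> 'g \<times> 'k)"
  where "coupling a b c d = tuple r (\<Sum>k\<in>{1..r}. adjoint (L k) (c k))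
    (\<lambda>k. adjoint (M k) (d k) - adjoint (L k) (c k)) (\<lambda>k. - L k (a - b k)) (\<lambda>k. - M k (b k))"

text \<open>An upper bound for the norm of the coupling; \<open>mu + tau\<close> is beta.\<close>

definition tau :: real
  where "tau = sqrt ((\<Sum>k\<in>{1..r}. (onorm (L k))\<^sup>2)
    + Max ((\<lambda>k. (onorm (L k))\<^sup>2 + (onorm (M k))\<^sup>2) ` {1..r}))"

definition Bop :: "'h \<times> (nat \<Rightarrow>\<^sub>0 'h \<times> 'g \<times> 'k) \<Rightarrow> 'h \<times> (nat \<Rightarrow>\<^sub>0 'h \<times> 'g \<times> 'k)"
  where "Bop s = (gradl (fst s), 0) + coupling (fst s) (\<lambda>k. fst (Poly_Mapping.lookup (snd s) k))
    (\<lambda>k. fst (snd (Poly_Mapping.lookup (snd s) k))) (\<lambda>k. snd (snd (Poly_Mapping.lookup (snd s) k)))"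

text \<open>Inverse subdifferentials are encoded by exchanging point and value: \<open>c' k\<close>
  belongs to the inverse at \<open>c k\<close>. The y-rows of A are 0, so its resolvent keeps the
  y-parts; this is why the algorithm has a single point \<open>p1\<close> in those rows.\<close>

definition Aop :: "'h \<times> (nat \<Rightarrow>\<^sub>0 'h \<times> 'g \<times> 'k) \<Rightarrow> ('h \<times> (nat \<Rightarrow>\<^sub>0 'h \<times> 'g \<times> 'k)) set"
  where "Aop s = {u. \<exists>a b c d a' c' d'. s = tuple r a b c d \<and> u = tuple r a' (\<lambda>_. 0) c' d' \<and>
    a' + z \<in> subdiff UNIV f a \<and>
    (\<forall>k\<in>{1..r}. c k \<in> subdiff (G k) (g k) (c' k) \<and> d k \<in> subdiff (K k) (h k) (d' k))}"

lemma Aop_tuple_iff: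
  "tuple r a' b' c' d' \<in> Aop (tuple r a b c d) \<longleftrightarrow> a' + z \<in> subdiff UNIV f a \<and>
    (\<forall>k\<in>{1..r}. b' k = 0 \<and> c k \<in> subdiff (G k) (g k) (c' k) \<and> d k \<in> subdiff (K k) (h k) (d' k))"
proof
  assume "tuple r a' b' c' d' \<in> Aop (tuple r a b c d)"
  then obtain A B C D A' C' D' where
    "tuple r a b c d = tuple r A B C D" "tuple r a' b' c' d' = tuple r A' (\<lambda>_. 0) C' D'"
    "A' + z \<in> subdiff UNIV f A"
    "\<forall>k\<in>{1..r}. C k \<in> subdiff (G k) (g k) (C' k) \<and> D k \<in> subdiff (K k) (h k) (D' k)"
    unfolding Aop_def by blast
  then show "a' + z \<in> subdiff UNIV f a \<and>
    (\<forall>k\<in>{1..r}. b' k = 0 \<and> c k \<in> subdiff (G k) (g k) (c' k) \<and> d k \<in> subdiff (K k) (h k) (d' k))"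
    unfolding tuple_eq_iff by simp
next
  assume *: "a' + z \<in> subdiff UNIV f a \<and>
    (\<forall>k\<in>{1..r}. b' k = 0 \<and> c k \<in> subdiff (G k) (g k) (c' k) \<and> d k \<in> subdiff (K k) (h k) (d' k))"
  then have "tuple r a' b' c' d' = tuple r a' (\<lambda>_. 0) c' d'" by (intro tuple_cong) auto
  with * show "tuple r a' b' c' d' \<in> Aop (tuple r a b c d)"
    unfolding Aop_def by blast
qed

lemmas adjoint_diff_L = linear_diff[OF linear_adjoint[OF L_bl]]
lemmas adjoint_diff_M = linear_diff[OF linear_adjoint[OF M_bl]]
lemmas diff_L = linear_diff[OF bounded_linear.linear[OF L_bl]]
lemmas diff_M = linear_diff[OF bounded_linear.linear[OF M_bl]]
lemmas subspace_G = G_hilb[unfolded hilbert_sub_def, THEN conjunct1]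
lemmas subspace_K = K_hilb[unfolded hilbert_sub_def, THEN conjunct1]

lemma complete_G: "k \<in> {1..r} \<Longrightarrow> complete (G k)"
  using G_hilb by (simp add: hilbert_sub_def complete_eq_closed)

lemma complete_K: "k \<in> {1..r} \<Longrightarrow> complete (K k)"
  using K_hilb by (simp add: hilbert_sub_def complete_eq_closed)

section \<open>Skewness and norm of the coupling\<close>

lemma coupling_diff:
  "coupling a b c d - coupling a' b' c' d'
    = coupling (a - a') (\<lambda>k. b k - b' k) (\<lambda>k. c k - c' k) (\<lambda>k. d k - d' k)"
  unfolding coupling_def tuple_diff tuple_eq_iff
  by (simp add: sum_subtractf[symmetric] adjoint_diff_L adjoint_diff_M diff_L diff_M)

text \<open>Once all adjoints are moved, block \<open>k\<close> contributes
  \<open>- (a \<bullet> adjoint (L k) (c k))\<close>, and these terms cancel the x-row.\<close>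

lemma coupling_skew: "tuple r a b c d \<bullet> coupling a b c d = 0"
proof -
  have "b k \<bullet> (adjoint (M k) (d k) - adjoint (L k) (c k)) + c k \<bullet> (- L k (a - b k)) + d k \<bullet> (- M k (b k))
      = - (a \<bullet> adjoint (L k) (c k))" if "k \<in> {1..r}" for k
    using that by (simp add: inner_diff_right inner_adjoint[OF L_bl] inner_adjoint[OF M_bl] diff_L
        inner_commute)
  then have "(\<Sum>k\<in>{1..r}. b k \<bullet> (adjoint (M k) (d k) - adjoint (L k) (c k)) + c k \<bullet> (- L k (a - b k)) + d k \<bullet> (- M k (b k)))
      = (\<Sum>k\<in>{1..r}. - (a \<bullet> adjoint (L k) (c k)))"
    by (intro sum.cong) auto
  then show ?thesis
    unfolding coupling_def tuple_inner by (simp add: inner_sum_right sum_negf)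
qed

lemma tau_nonneg: "0 \<le> tau"
  and tau_sq: "tau\<^sup>2 = (\<Sum>k\<in>{1..r}. (onorm (L k))\<^sup>2)
    + Max ((\<lambda>k. (onorm (L k))\<^sup>2 + (onorm (M k))\<^sup>2) ` {1..r})"
proof -
  have "0 \<le> (onorm (L 1))\<^sup>2 + (onorm (M 1))\<^sup>2" by simp
  also have "\<dots> \<le> Max ((\<lambda>k. (onorm (L k))\<^sup>2 + (onorm (M k))\<^sup>2) ` {1..r})"
    using r_pos by (intro Max_ge) auto
  finally have "0 \<le> Max ((\<lambda>k. (onorm (L k))\<^sup>2 + (onorm (M k))\<^sup>2) ` {1..r})" .
  then have "0 \<le> (\<Sum>k\<in>{1..r}. (onorm (L k))\<^sup>2) + Max ((\<lambda>k. (onorm (L k))\<^sup>2 + (onorm (M k))\<^sup>2) ` {1..r})"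
    by (intro add_nonneg_nonneg sum_nonneg) auto
  then show "0 \<le> tau" "tau\<^sup>2 = (\<Sum>k\<in>{1..r}. (onorm (L k))\<^sup>2)
    + Max ((\<lambda>k. (onorm (L k))\<^sup>2 + (onorm (M k))\<^sup>2) ` {1..r})"
    by (simp_all add: tau_def)
qed

lemma primal_coupling_norm_le:
  "norm (tuple r (0::'h) (\<lambda>_. 0) (\<lambda>k. L k (a - b k)) (\<lambda>k. M k (b k)))
    \<le> tau * norm (tuple r a b (\<lambda>_. 0::'g) (\<lambda>_. 0::'k))"
proof (rule power2_le_imp_le)
  let ?X = "Max ((\<lambda>k. (onorm (L k))\<^sup>2 + (onorm (M k))\<^sup>2) ` {1..r})"
  have X: "(onorm (L k))\<^sup>2 + (onorm (M k))\<^sup>2 \<le> ?X" if "k \<in> {1..r}" for k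
    using that by (intro Max_ge) auto
  have X0: "0 \<le> ?X"
    by (rule order_trans[OF _ X[of 1]]) (use r_pos in auto)
  have "(\<Sum>k\<in>{1..r}. (norm (L k (a - b k)))\<^sup>2 + (norm (M k (b k)))\<^sup>2)
      \<le> (\<Sum>k\<in>{1..r}. (onorm (L k) * norm a + onorm (L k) * norm (b k))\<^sup>2 + (onorm (M k) * norm (b k))\<^sup>2)"
  proof (intro sum_mono add_mono power_mono)
    fix k assume k: "k \<in> {1..r}"
    have "norm (L k (a - b k)) \<le> norm (L k a) + norm (L k (b k))"
      unfolding diff_L[OF k] by (rule norm_triangle_ineq4)
    also have "\<dots> \<le> onorm (L k) * norm a + onorm (L k) * norm (b k)"
      by (intro add_mono onorm[OF L_bl[OF k]])
    finally show "norm (L k (a - b k)) \<le> onorm (L k) * norm a + onorm (L k) * norm (b k)" .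
    show "norm (M k (b k)) \<le> onorm (M k) * norm (b k)" by (rule onorm[OF M_bl[OF k]])
  qed auto
  also have "\<dots> \<le> tau\<^sup>2 * ((norm a)\<^sup>2 + (\<Sum>k\<in>{1..r}. (norm (b k))\<^sup>2))"
    unfolding tau_sq by (rule sum_squares_coupling_bound[OF X X0])
  finally show "(norm (tuple r (0::'h) (\<lambda>_. 0) (\<lambda>k. L k (a - b k)) (\<lambda>k. M k (b k))))\<^sup>2
      \<le> (tau * norm (tuple r a b (\<lambda>_. 0::'g) (\<lambda>_. 0::'k)))\<^sup>2"
    unfolding power_mult_distrib tuple_norm_sq by simp
qed (simp add: tau_nonneg)

text \<open>This map is the adjoint of the one in \<open>primal_coupling_norm_le\<close>, so it has
  the same bound: the squared norm of its value \<open>?X\<close> is the inner product of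
  \<open>?Y\<close> with the primal map at \<open>?X\<close>.\<close>

lemma dual_coupling_norm_le:
  "norm (tuple r (\<Sum>k\<in>{1..r}. adjoint (L k) (c k)) (\<lambda>k. adjoint (M k) (d k) - adjoint (L k) (c k))
      (\<lambda>_. 0::'g) (\<lambda>_. 0::'k))
    \<le> tau * norm (tuple r (0::'h) (\<lambda>_. 0) c d)"
proof -
  define a b where "a = (\<Sum>k\<in>{1..r}. adjoint (L k) (c k))"
    and "b k = adjoint (M k) (d k) - adjoint (L k) (c k)" for k
  let ?X = "tuple r a b (\<lambda>_. 0::'g) (\<lambda>_. 0::'k)" and ?Y = "tuple r (0::'h) (\<lambda>_. 0) c d"
  have "?X \<bullet> ?X = a \<bullet> (\<Sum>k\<in>{1..r}. adjoint (L k) (c k))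
      + (\<Sum>k\<in>{1..r}. b k \<bullet> (adjoint (M k) (d k) - adjoint (L k) (c k)))"
    unfolding tuple_inner by (simp add: a_def b_def)
  also have "\<dots> = (\<Sum>k\<in>{1..r}. a \<bullet> adjoint (L k) (c k) + b k \<bullet> (adjoint (M k) (d k) - adjoint (L k) (c k)))"
    by (simp add: inner_sum_right sum.distrib)
  also have "\<dots> = (\<Sum>k\<in>{1..r}. L k (a - b k) \<bullet> c k + M k (b k) \<bullet> d k)"
  proof (rule sum.cong)
    fix k assume "k \<in> {1..r}"
    then show "a \<bullet> adjoint (L k) (c k) + b k \<bullet> (adjoint (M k) (d k) - adjoint (L k) (c k))
        = L k (a - b k) \<bullet> c k + M k (b k) \<bullet> d k"
      by (simp add: inner_diff_right inner_diff_left inner_adjoint[OF L_bl] inner_adjoint[OF M_bl] diff_L)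
  qed simp
  also have "\<dots> = tuple r (0::'h) (\<lambda>_. 0) (\<lambda>k. L k (a - b k)) (\<lambda>k. M k (b k)) \<bullet> ?Y"
    unfolding tuple_inner by simp
  also have "\<dots> \<le> norm (tuple r (0::'h) (\<lambda>_. 0) (\<lambda>k. L k (a - b k)) (\<lambda>k. M k (b k))) * norm ?Y"
    by (rule norm_cauchy_schwarz)
  also have "\<dots> \<le> (tau * norm ?X) * norm ?Y"
    by (intro mult_right_mono primal_coupling_norm_le) simp
  finally have "norm ?X * norm ?X \<le> norm ?X * (tau * norm ?Y)"
    by (simp add: norm_eq_sqrt_inner[of ?X] ac_simps)
  moreover have "0 \<le> tau * norm ?Y" using tau_nonneg by simp
  ultimately have "norm ?X \<le> tau * norm ?Y"
    by (metis mult_left_le_imp_le norm_ge_zero order_le_less)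
  then show ?thesis unfolding a_def b_def .
qed

text \<open>Each half reads one group of rows and writes the other. The squared norms add up on both
  sides, so the common bound for the halves is a bound for the whole.\<close>

lemma coupling_norm_le: "norm (coupling a b c d) \<le> tau * norm (tuple r a b c d)"
proof (rule power2_le_imp_le)
  let ?P = "tuple r (\<Sum>k\<in>{1..r}. adjoint (L k) (c k))
      (\<lambda>k. adjoint (M k) (d k) - adjoint (L k) (c k)) (\<lambda>_. 0::'g) (\<lambda>_. 0::'k)"
    and ?D = "tuple r (0::'h) (\<lambda>_. 0) (\<lambda>k. L k (a - b k)) (\<lambda>k. M k (b k))"
  have "(norm (coupling a b c d))\<^sup>2 = (norm ?P)\<^sup>2 + (norm ?D)\<^sup>2"
    unfolding coupling_def tuple_norm_sq by (simp add: sum.distrib)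
  also have "\<dots> \<le> (tau * norm (tuple r (0::'h) (\<lambda>_. 0) c d))\<^sup>2
      + (tau * norm (tuple r a b (\<lambda>_. 0::'g) (\<lambda>_. 0::'k)))\<^sup>2"
    by (intro add_mono power_mono dual_coupling_norm_le primal_coupling_norm_le) auto
  also have "\<dots> = (tau * norm (tuple r a b c d))\<^sup>2"
    unfolding power_mult_distrib tuple_norm_sq by (simp add: sum.distrib algebra_simps)
  finally show "(norm (coupling a b c d))\<^sup>2 \<le> (tau * norm (tuple r a b c d))\<^sup>2" .
qed (simp add: tau_nonneg)

section \<open>The operators A and B in coordinates\<close>

lemma Bop_tuple: "Bop (tuple r a b c d) = tuple r (gradl a) (\<lambda>_. 0) (\<lambda>_. 0) (\<lambda>_. 0) + coupling a b c d"
proof -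
  have "coupling a (\<lambda>k. fst (Poly_Mapping.lookup (snd (tuple r a b c d)) k))
      (\<lambda>k. fst (snd (Poly_Mapping.lookup (snd (tuple r a b c d)) k)))
      (\<lambda>k. snd (snd (Poly_Mapping.lookup (snd (tuple r a b c d)) k))) = coupling a b c d"
    unfolding coupling_def tuple_eq_iff by (simp add: tuple_def)
  moreover have "(gradl a, 0) = tuple r (gradl a) (\<lambda>_. 0) (\<lambda>_. 0::'g) (\<lambda>_. 0::'k)"
    by (auto simp: tuple_def zero_prod_def intro!: poly_mapping_eqI)
  moreover have "fst (tuple r a b c d) = a" by (simp add: tuple_def)
  ultimately show ?thesis unfolding Bop_def by simp
qed

lemma Bop_tuple_components: "Bop (tuple r a b c d) = tuple r (gradl a + (\<Sum>k\<in>{1..r}. adjoint (L k) (c k)))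
    (\<lambda>k. adjoint (M k) (d k) - adjoint (L k) (c k)) (\<lambda>k. - L k (a - b k)) (\<lambda>k. - M k (b k))"
  unfolding Bop_tuple coupling_def tuple_add by simp

lemma Bop_diff: "Bop (tuple r a b c d) - Bop (tuple r a' b' c' d')
    = tuple r (gradl a - gradl a') (\<lambda>_. 0) (\<lambda>_. 0) (\<lambda>_. 0)
      + coupling (a - a') (\<lambda>k. b k - b' k) (\<lambda>k. c k - c' k) (\<lambda>k. d k - d' k)"
proof -
  have "Bop (tuple r a b c d) - Bop (tuple r a' b' c' d')
      = (tuple r (gradl a) (\<lambda>_. 0) (\<lambda>_. 0) (\<lambda>_. 0) - tuple r (gradl a') (\<lambda>_. 0) (\<lambda>_. 0) (\<lambda>_. 0))
        + (coupling a b c d - coupling a' b' c' d')"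
    unfolding Bop_tuple by simp
  then show ?thesis unfolding coupling_diff by (simp add: tuple_diff)
qed

lemma Bop_inner_diff:
  "(tuple r a b c d - tuple r a' b' c' d') \<bullet> (Bop (tuple r a b c d) - Bop (tuple r a' b' c' d'))
    = (a - a') \<bullet> (gradl a - gradl a')"
  unfolding Bop_diff inner_add_right tuple_diff coupling_skew tuple_inner by simp

lemma Aop_inner_diff:
  "(tuple r a b c d - tuple r a' b' c' d') \<bullet> (tuple r u (\<lambda>_. 0) v w - tuple r u' (\<lambda>_. 0) v' w')
    = (a - a') \<bullet> (u - u')
      + (\<Sum>k\<in>{1..r}. (c k - c' k) \<bullet> (v k - v' k) + (d k - d' k) \<bullet> (w k - w' k))"
  unfolding tuple_diff tuple_inner by simp

text \<open>A acts row by row, hence so does its resolvent: a proximal step for \<open>f\<close>,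
  the identity on the y-parts, and Moreau's decomposition for the inverses. These are the backward
  steps of the algorithm.\<close>

lemma resolvent_tuple:
  fixes sa :: 'h and sb :: "nat \<Rightarrow> 'h"
  assumes c: "0 < c" and sc: "\<And>k. k \<in> {1..r} \<Longrightarrow> sc k \<in> G k" and sd: "\<And>k. k \<in> {1..r} \<Longrightarrow> sd k \<in> K k"
  defines "p \<equiv> tuple r (prox UNIV (\<lambda>u. ereal c * f u) (sa + c *\<^sub>R z)) sb
      (\<lambda>k. sc k - c *\<^sub>R prox (G k) (\<lambda>u. ereal (1 / c) * g k u) ((1 / c) *\<^sub>R sc k))
      (\<lambda>k. sd k - c *\<^sub>R prox (K k) (\<lambda>u. ereal (1 / c) * h k u) ((1 / c) *\<^sub>R sd k))"
  shows "(1 / c) *\<^sub>R (tuple r sa sb sc sd - p) \<in> Aop p"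
proof -
  let ?P = "prox UNIV (\<lambda>u. ereal c * f u) (sa + c *\<^sub>R z)"
    and ?Q = "\<lambda>k. prox (G k) (\<lambda>u. ereal (1 / c) * g k u) ((1 / c) *\<^sub>R sc k)"
    and ?R = "\<lambda>k. prox (K k) (\<lambda>u. ereal (1 / c) * h k u) ((1 / c) *\<^sub>R sd k)"
  have eq: "(1 / c) *\<^sub>R (tuple r sa sb sc sd - p) = tuple r ((1 / c) *\<^sub>R (sa - ?P)) (\<lambda>_. 0) ?Q ?R"
    unfolding p_def tuple_diff tuple_scaleR tuple_eq_iff using c by simp
   \<comment> \<open>Evaluating the proximity operator at \<open>sa + c *\<^sub>R z\<close> adds
     \<open>z\<close> to the subgradient, matching the shift in \<open>Aop\<close>.\<close>
   have "(1 / c) *\<^sub>R ((sa + c *\<^sub>R z) - ?P) \<in> subdiff UNIV f ?P"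
    by (rule prox_scaled_subdiff[OF f_G0 subspace_UNIV complete_UNIV c]) simp
  moreover have "(1 / c) *\<^sub>R ((sa + c *\<^sub>R z) - ?P) = (1 / c) *\<^sub>R (sa - ?P) + z"
    using c by (simp add: algebra_simps)
  moreover have "sc k - c *\<^sub>R ?Q k \<in> subdiff (G k) (g k) (?Q k)" if k: "k \<in> {1..r}" for k
    by (rule moreau_decomposition_subdiff[OF g_G0[OF k] subspace_G[OF k] complete_G[OF k] c sc[OF k]])
  moreover have "sd k - c *\<^sub>R ?R k \<in> subdiff (K k) (h k) (?R k)" if k: "k \<in> {1..r}" for k
    by (rule moreau_decomposition_subdiff[OF h_G0[OF k] subspace_K[OF k] complete_K[OF k] c sd[OF k]])
  ultimately show ?thesis unfolding eq unfolding p_def Aop_tuple_iff by simp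
qed

lemma monotone_lipschitz_inclusion_system:
  assumes beta: "0 < mu + tau"
  shows "monotone_lipschitz_inclusion (tuple_space r G K) Aop Bop (mu + tau)"
proof
  show "subspace (tuple_space r G K)"
    by (intro tuple_space_subspace subspace_G subspace_K)
  show "complete (tuple_space r G K :: ('h \<times> (nat \<Rightarrow>\<^sub>0 'h \<times> 'g \<times> 'k)) set)"
    by (intro tuple_space_complete complete_G complete_K)
  show "p \<in> tuple_space r G K" if "u \<in> Aop p" for u p
    using that by (auto simp: Aop_def tuple_mem_space_iff subdiff_def)
  show "u \<in> tuple_space r G K" if "u \<in> Aop p" for u p
    using that by (auto simp: Aop_def tuple_mem_space_iff subdiff_def)
  show "0 \<le> (p - q) \<bullet> (u - v)" if "u \<in> Aop p" "v \<in> Aop q" for u v p q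
  proof -
    obtain a b c d a' c' d' where 1: "p = tuple r a b c d" "u = tuple r a' (\<lambda>_. 0) c' d'"
      "a' + z \<in> subdiff UNIV f a" "\<forall>k\<in>{1..r}. c k \<in> subdiff (G k) (g k) (c' k) \<and> d k \<in> subdiff (K k) (h k) (d' k)"
      using \<open>u \<in> Aop p\<close> unfolding Aop_def by blast
    obtain A B C D A' C' D' where 2: "q = tuple r A B C D" "v = tuple r A' (\<lambda>_. 0) C' D'"
      "A' + z \<in> subdiff UNIV f A" "\<forall>k\<in>{1..r}. C k \<in> subdiff (G k) (g k) (C' k) \<and> D k \<in> subdiff (K k) (h k) (D' k)"
      using \<open>v \<in> Aop q\<close> unfolding Aop_def by blast
    have "0 \<le> (a - A) \<bullet> ((a' + z) - (A' + z))" by (rule subdiff_monotone[OF f_G0 1(3) 2(3)])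
    moreover have "0 \<le> (c k - C k) \<bullet> (c' k - C' k) + (d k - D k) \<bullet> (d' k - D' k)" if k: "k \<in> {1..r}" for k
      using subdiff_monotone[OF g_G0[OF k], of "c k" "c' k" "C k" "C' k"]
        subdiff_monotone[OF h_G0[OF k], of "d k" "d' k" "D k" "D' k"] 1(4) 2(4) k
      by (simp add: inner_commute)
    then have "0 \<le> (\<Sum>k\<in>{1..r}. (c k - C k) \<bullet> (c' k - C' k) + (d k - D k) \<bullet> (d' k - D' k))"
      by (rule sum_nonneg)
    ultimately show ?thesis unfolding 1 2 Aop_inner_diff by simp
  qed
  show "Bop p \<in> tuple_space r G K" if "p \<in> tuple_space r G K" for p
  proof -
    obtain a b c d where "p = tuple r a b c d" using \<open>p \<in> _\<close> by (rule tuple_space_cases)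
    then show ?thesis
      using L_mem M_mem by (simp add: Bop_tuple_components tuple_mem_space_iff subspace_neg subspace_G subspace_K)
  qed
  show "0 \<le> (p - q) \<bullet> (Bop p - Bop q)" if "p \<in> tuple_space r G K" "q \<in> tuple_space r G K" for p q
  proof -
    obtain a b c d where p: "p = tuple r a b c d" using \<open>p \<in> _\<close> by (rule tuple_space_cases)
    obtain a' b' c' d' where q: "q = tuple r a' b' c' d'" using \<open>q \<in> _\<close> by (rule tuple_space_cases)
    show ?thesis unfolding p q Bop_inner_diff by (rule grad_mono)
  qed
  show "norm (Bop p - Bop q) \<le> (mu + tau) * norm (p - q)"
    if "p \<in> tuple_space r G K" "q \<in> tuple_space r G K" for p q
  proof -
    obtain a b c d where p: "p = tuple r a b c d" using \<open>p \<in> _\<close> by (rule tuple_space_cases)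
    obtain a' b' c' d' where q: "q = tuple r a' b' c' d'" using \<open>q \<in> _\<close> by (rule tuple_space_cases)
    let ?d = "tuple r (a - a') (\<lambda>k. b k - b' k) (\<lambda>k. c k - c' k) (\<lambda>k. d k - d' k)"
    have "norm (Bop p - Bop q) \<le> norm (tuple r (gradl a - gradl a') (\<lambda>_. 0) (\<lambda>_. 0::'g) (\<lambda>_. 0::'k))
        + norm (coupling (a - a') (\<lambda>k. b k - b' k) (\<lambda>k. c k - c' k) (\<lambda>k. d k - d' k))"
      unfolding p q Bop_diff by (rule norm_triangle_ineq)
    also have "\<dots> \<le> norm (gradl a - gradl a') + tau * norm ?d"
      using tuple_norm_le[of r "gradl a - gradl a'" "\<lambda>_. 0" "\<lambda>_. 0::'g" "\<lambda>_. 0::'k"]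
      by (intro add_mono coupling_norm_le) simp
    also have "norm (gradl a - gradl a') \<le> mu * norm ?d"
      by (rule order_trans[OF grad_lip mult_left_mono[OF tuple_component_norm_le(1) mu_nonneg]])
    finally show ?thesis unfolding p q tuple_diff by (simp add: algebra_simps)
  qed
  show "\<exists>p. (1 / c) *\<^sub>R (s - p) \<in> Aop p" if "0 < c" "s \<in> tuple_space r G K" for c s
  proof -
    obtain sa sb sc sd where s: "s = tuple r sa sb sc sd" and mem: "\<forall>k\<in>{1..r}. sc k \<in> G k \<and> sd k \<in> K k"
      using \<open>s \<in> _\<close> by (rule tuple_space_cases)
    show ?thesis
      unfolding s by (rule exI, rule resolvent_tuple[OF \<open>0 < c\<close>]) (use mem in auto)
  qed
qed (rule beta)

end

section \<open>Zeros of the inclusion solve both problems\<close>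

lemma summable_tuple_norm:
  assumes "summable (\<lambda>n. norm (a n))" "\<And>k. k \<in> {1..r} \<Longrightarrow> summable (\<lambda>n. norm (b k n))"
    "\<And>k. k \<in> {1..r} \<Longrightarrow> summable (\<lambda>n. norm (c k n))" "\<And>k. k \<in> {1..r} \<Longrightarrow> summable (\<lambda>n. norm (d k n))"
  shows "summable (\<lambda>n. norm (tuple r (a n) (\<lambda>k. b k n) (\<lambda>k. c k n) (\<lambda>k. d k n)))"
proof (rule summable_comparison_test')
  show "summable (\<lambda>n. norm (a n) + (\<Sum>k\<in>{1..r}. norm (b k n) + norm (c k n) + norm (d k n)))"
    by (intro summable_add summable_sum assms)
  show "norm (norm (tuple r (a n) (\<lambda>k. b k n) (\<lambda>k. c k n) (\<lambda>k. d k n)))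
    \<le> norm (a n) + (\<Sum>k\<in>{1..r}. norm (b k n) + norm (c k n) + norm (d k n))" if "n \<ge> 0" for n
    using tuple_norm_le by simp
qed

text \<open>The test vectors are tuples with a single nonzero coordinate.\<close>

lemma weak_conv_tuple_components:
  fixes x :: "nat \<Rightarrow> 'h::real_inner" and v :: "nat \<Rightarrow> nat \<Rightarrow> 'g::real_inner"
    and K :: "nat \<Rightarrow> 'k::real_inner set"
  assumes conv: "weak_conv (tuple_space r G K)
      (\<lambda>n. tuple r (x n) (\<lambda>k. y k n) (\<lambda>k. v k n) (\<lambda>k. w k n)) (tuple r x' y' v' w')"
    and G: "\<And>k. k \<in> {1..r} \<Longrightarrow> subspace (G k)" and K: "\<And>k. k \<in> {1..r} \<Longrightarrow> subspace (K k)"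
  shows "weak_conv UNIV x x'" "k \<in> {1..r} \<Longrightarrow> weak_conv (G k) (\<lambda>n. v k n) (v' k)"
proof -
  show "weak_conv UNIV x x'"
    unfolding weak_conv_def
  proof (intro ballI)
    fix u :: 'h
    have "tuple r u (\<lambda>_. 0) (\<lambda>_. 0) (\<lambda>_. 0) \<in> tuple_space r G K"
      using G K by (simp add: tuple_mem_space_iff subspace_0)
    from conv[unfolded weak_conv_def, rule_format, OF this]
    show "(\<lambda>n. x n \<bullet> u) \<longlonglongrightarrow> x' \<bullet> u" by (simp add: tuple_inner)
  qed
  assume k: "k \<in> {1..r}"
  show "weak_conv (G k) (\<lambda>n. v k n) (v' k)"
    unfolding weak_conv_def
  proof (intro ballI)
    fix u assume u: "u \<in> G k"
    have "tuple r (0::'h) (\<lambda>_. 0) (\<lambda>j. if j = k then u else 0) (\<lambda>_. 0) \<in> tuple_space r G K"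
      using G K u by (simp add: tuple_mem_space_iff subspace_0)
    from conv[unfolded weak_conv_def, rule_format, OF this]
    show "(\<lambda>n. v k n \<bullet> u) \<longlonglongrightarrow> v' k \<bullet> u"
      using k by (simp add: tuple_inner if_distrib[of "inner _"] sum.delta cong: if_cong)
  qed
qed

context parallel_sum_system
begin

text \<open>The optimality system. The zero y-row of A forces equal adjoint images, so their common
  value lies in both composed subdifferentials, at \<open>x - y k\<close> and at \<open>y k\<close>,
  as membership in the parallel sum asks.\<close>

lemma zero_tuple_iff:
  "- Bop (tuple r x y v w) \<in> Aop (tuple r x y v w) \<longleftrightarrow>
    z - gradl x - (\<Sum>k\<in>{1..r}. adjoint (L k) (v k)) \<in> subdiff UNIV f x \<and>
    (\<forall>k\<in>{1..r}. adjoint (L k) (v k) = adjoint (M k) (w k) \<and>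
      v k \<in> subdiff (G k) (g k) (L k (x - y k)) \<and> w k \<in> subdiff (K k) (h k) (M k (y k)))"
  unfolding Bop_tuple_components tuple_uminus Aop_tuple_iff by (auto simp: algebra_simps)

context
  fixes x y v w and ell :: "'h \<Rightarrow> real"
  assumes zero: "- Bop (tuple r x y v w) \<in> Aop (tuple r x y v w)"
    and ell_ge: "\<And>u. ell x + gradl x \<bullet> (u - x) \<le> ell u"
begin

lemma sub_f: "z - gradl x - (\<Sum>k\<in>{1..r}. adjoint (L k) (v k)) \<in> subdiff UNIV f x"
  and adj_eq: "k \<in> {1..r} \<Longrightarrow> adjoint (L k) (v k) = adjoint (M k) (w k)"
  and sub_g: "k \<in> {1..r} \<Longrightarrow> v k \<in> subdiff (G k) (g k) (L k (x - y k))"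
  and sub_h: "k \<in> {1..r} \<Longrightarrow> w k \<in> subdiff (K k) (h k) (M k (y k))"
  using zero unfolding zero_tuple_iff by auto

text \<open>This is the value of the \<open>k\<close>-th infimal convolution at \<open>x\<close>,
  attained at \<open>y k\<close>. Both summands are finite at a zero, so the passage to reals loses
  nothing.\<close>

definition value_gh :: "nat \<Rightarrow> real"
  where "value_gh k = real_of_ereal (g k (L k (x - y k))) + real_of_ereal (h k (M k (y k)))"

text \<open>Equivalently, \<open>adjoint (L k) (v k)\<close> is a subgradient of the infimal
  convolution at \<open>x\<close>. In the sum of the two subgradient inequalities the variable
  \<open>y'\<close> cancels because the adjoint images of \<open>v k\<close> and \<open>w k\<close>
  agree.\<close>

lemma infconv_ge:
  assumes k: "k \<in> {1..r}"
  shows "ereal (value_gh k + (x' - x) \<bullet> adjoint (L k) (v k))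
    \<le> infconv UNIV (\<lambda>u. g k (L k u)) (\<lambda>u. h k (M k u)) x'"
  unfolding infconv_def
proof (rule INF_greatest)
  fix y'
  note gx = subdiff_real(3)[OF g_G0[OF k] sub_g[OF k]] and hx = subdiff_real(3)[OF h_G0[OF k] sub_h[OF k]]
  have "ereal ((L k (x' - y') - L k (x - y k)) \<bullet> v k) + g k (L k (x - y k)) \<le> g k (L k (x' - y'))"
    "ereal ((M k y' - M k (y k)) \<bullet> w k) + h k (M k (y k)) \<le> h k (M k y')"
    using sub_g[OF k] sub_h[OF k] L_mem[OF k] M_mem[OF k] by (auto simp: subdiff_def)
  then have "(ereal ((L k (x' - y') - L k (x - y k)) \<bullet> v k) + g k (L k (x - y k)))
      + (ereal ((M k y' - M k (y k)) \<bullet> w k) + h k (M k (y k))) \<le> g k (L k (x' - y')) + h k (M k y')"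
    by (rule add_mono)
  moreover have "(L k (x' - y') - L k (x - y k)) \<bullet> v k + (M k y' - M k (y k)) \<bullet> w k
      = (x' - x) \<bullet> adjoint (L k) (v k)"
  proof -
    have "(L k (x' - y') - L k (x - y k)) \<bullet> v k = ((x' - y') - (x - y k)) \<bullet> adjoint (L k) (v k)"
      unfolding inner_adjoint[OF L_bl[OF k]] by (simp only: diff_L[OF k])
    moreover have "(M k y' - M k (y k)) \<bullet> w k = (y' - y k) \<bullet> adjoint (L k) (v k)"
      unfolding adj_eq[OF k] inner_adjoint[OF M_bl[OF k]] by (simp only: diff_M[OF k])
    ultimately show ?thesis by (simp add: inner_diff_left)
  qed
  then have "(ereal ((L k (x' - y') - L k (x - y k)) \<bullet> v k) + g k (L k (x - y k)))
      + (ereal ((M k y' - M k (y k)) \<bullet> w k) + h k (M k (y k)))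
      = ereal (value_gh k + (x' - x) \<bullet> adjoint (L k) (v k))"
    unfolding value_gh_def by (subst gx, subst hx) simp
  ultimately show "ereal (value_gh k + (x' - x) \<bullet> adjoint (L k) (v k)) \<le> g k (L k (x' - y')) + h k (M k y')"
    by simp
qed

lemma infconv_le:
  assumes k: "k \<in> {1..r}"
  shows "infconv UNIV (\<lambda>u. g k (L k u)) (\<lambda>u. h k (M k u)) x \<le> ereal (value_gh k)"
proof -
  have "infconv UNIV (\<lambda>u. g k (L k u)) (\<lambda>u. h k (M k u)) x \<le> g k (L k (x - y k)) + h k (M k (y k))"
    unfolding infconv_def by (rule INF_lower) simp
  also have "\<dots> = ereal (value_gh k)"
    unfolding value_gh_def
    by (subst subdiff_real(3)[OF g_G0[OF k] sub_g[OF k]], subst subdiff_real(3)[OF h_G0[OF k] sub_h[OF k]]) simp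
  finally show ?thesis .
qed

text \<open>Fermat's rule: every term has an affine minorant that is exact at \<open>x\<close>, and
  the slopes together with \<open>- z\<close> add up to 0.\<close>

lemma primal_optimal:
  "f x + (\<Sum>k\<in>{1..r}. infconv UNIV (\<lambda>u. g k (L k u)) (\<lambda>u. h k (M k u)) x) + ereal (ell x - x \<bullet> z)
    \<le> f x' + (\<Sum>k\<in>{1..r}. infconv UNIV (\<lambda>u. g k (L k u)) (\<lambda>u. h k (M k u)) x') + ereal (ell x' - x' \<bullet> z)"
proof -
  note fx = subdiff_real(3)[OF f_G0 sub_f]
  let ?a = "\<Sum>k\<in>{1..r}. adjoint (L k) (v k)" and ?f = "real_of_ereal (f x)"
  have "f x + (\<Sum>k\<in>{1..r}. infconv UNIV (\<lambda>u. g k (L k u)) (\<lambda>u. h k (M k u)) x) + ereal (ell x - x \<bullet> z)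
      \<le> f x + (\<Sum>k\<in>{1..r}. ereal (value_gh k)) + ereal (ell x - x \<bullet> z)"
    by (intro add_mono sum_mono infconv_le order_refl)
  also have "\<dots> = ereal (?f + (\<Sum>k\<in>{1..r}. value_gh k) + (ell x - x \<bullet> z))"
    by (subst fx) simp
  also have "\<dots> \<le> ereal ((x' - x) \<bullet> (z - gradl x - ?a) + ?f)
      + ereal (\<Sum>k\<in>{1..r}. value_gh k + (x' - x) \<bullet> adjoint (L k) (v k)) + ereal (ell x' - x' \<bullet> z)"
  proof -
    have "(\<Sum>k\<in>{1..r}. value_gh k + (x' - x) \<bullet> adjoint (L k) (v k))
        = (\<Sum>k\<in>{1..r}. value_gh k) + (x' - x) \<bullet> ?a"
      by (simp only: sum.distrib inner_sum_right)
    moreover have "(x' - x) \<bullet> (z - gradl x - ?a) = x' \<bullet> z - x \<bullet> z - gradl x \<bullet> (x' - x) - (x' - x) \<bullet> ?a"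
      by (simp only: inner_diff_right inner_diff_left inner_commute[of "gradl x"])
    ultimately show ?thesis using ell_ge[of x'] by simp
  qed
  also have "\<dots> \<le> f x' + (\<Sum>k\<in>{1..r}. infconv UNIV (\<lambda>u. g k (L k u)) (\<lambda>u. h k (M k u)) x')
      + ereal (ell x' - x' \<bullet> z)"
  proof (intro add_mono order_refl)
    have "ereal ((x' - x) \<bullet> (z - gradl x - ?a)) + f x \<le> f x'"
      using sub_f by (auto simp: subdiff_def)
    then show "ereal ((x' - x) \<bullet> (z - gradl x - ?a) + ?f) \<le> f x'"
      by (subst (asm) fx) simp
    show "ereal (\<Sum>k\<in>{1..r}. value_gh k + (x' - x) \<bullet> adjoint (L k) (v k))
        \<le> (\<Sum>k\<in>{1..r}. infconv UNIV (\<lambda>u. g k (L k u)) (\<lambda>u. h k (M k u)) x')"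
      unfolding sum_ereal[symmetric] by (intro sum_mono infconv_ge)
  qed
  finally show ?thesis .
qed

text \<open>Fenchel-Young at \<open>L k (x - y k)\<close> and \<open>M k (y k)\<close>. All feasible
  \<open>w'\<close> give the same bound, because their adjoint images equal that of
  \<open>v'\<close>.\<close>

lemma dual_term_ge:
  assumes k: "k \<in> {1..r}"
  shows "ereal (x \<bullet> adjoint (L k) v' - value_gh k)
    \<le> conj (G k) (g k) v' + infpost (K k) (adjoint (M k)) (conj (K k) (h k)) (adjoint (L k) v')"
proof -
  let ?g = "real_of_ereal (g k (L k (x - y k)))" and ?h = "real_of_ereal (h k (M k (y k)))"
  have "ereal (y k \<bullet> adjoint (L k) v' - ?h)
      \<le> infpost (K k) (adjoint (M k)) (conj (K k) (h k)) (adjoint (L k) v')"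
    unfolding infpost_def
  proof (rule INF_greatest)
    fix w' assume "w' \<in> {u \<in> K k. adjoint (M k) u = adjoint (L k) v'}"
    then have "y k \<bullet> adjoint (L k) v' = w' \<bullet> M k (y k)"
      using inner_adjoint(1)[OF M_bl[OF k], of "y k" w'] by (simp add: inner_commute)
    then show "ereal (y k \<bullet> adjoint (L k) v' - ?h) \<le> conj (K k) (h k) w'"
      using conj_ge_affine[of "M k (y k)" "K k" "h k" ?h w', OF M_mem[OF k] subdiff_real(3)[OF h_G0[OF k] sub_h[OF k]]]
      by simp
  qed
  moreover have "ereal (v' \<bullet> L k (x - y k) - ?g) \<le> conj (G k) (g k) v'"
    by (rule conj_ge_affine[of "L k (x - y k)" "G k" "g k" ?g, OF L_mem[OF k] subdiff_real(3)[OF g_G0[OF k] sub_g[OF k]]])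
  moreover have "ereal (x \<bullet> adjoint (L k) v' - value_gh k)
      = ereal (v' \<bullet> L k (x - y k) - ?g) + ereal (y k \<bullet> adjoint (L k) v' - ?h)"
  proof -
    have "v' \<bullet> L k (x - y k) = (x - y k) \<bullet> adjoint (L k) v'"
      unfolding inner_adjoint(1)[OF L_bl[OF k]] by (rule inner_commute)
    then show ?thesis by (simp add: value_gh_def inner_diff_left)
  qed
  ultimately show ?thesis by (metis add_mono)
qed

text \<open>\<open>w k\<close> is feasible for the postcomposition, and at a zero both Fenchel-Young
  relations are equalities.\<close>

lemma dual_term_le:
  assumes k: "k \<in> {1..r}"
  shows "conj (G k) (g k) (v k) + infpost (K k) (adjoint (M k)) (conj (K k) (h k)) (adjoint (L k) (v k))
    \<le> ereal (x \<bullet> adjoint (L k) (v k) - value_gh k)"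
proof -
  have "infpost (K k) (adjoint (M k)) (conj (K k) (h k)) (adjoint (L k) (v k)) \<le> conj (K k) (h k) (w k)"
    unfolding infpost_def using adj_eq[OF k] subdiff_real(2)[OF h_G0[OF k] sub_h[OF k]]
    by (intro INF_lower) simp
  then have "conj (G k) (g k) (v k) + infpost (K k) (adjoint (M k)) (conj (K k) (h k)) (adjoint (L k) (v k))
      \<le> conj (G k) (g k) (v k) + conj (K k) (h k) (w k)"
    by (rule add_left_mono)
  also have "\<dots> = ereal (v k \<bullet> L k (x - y k) + w k \<bullet> M k (y k) - value_gh k)"
    unfolding conj_at_subgradient[OF g_G0[OF k] sub_g[OF k]] conj_at_subgradient[OF h_G0[OF k] sub_h[OF k]]
    by (simp add: value_gh_def)
  also have "v k \<bullet> L k (x - y k) = (x - y k) \<bullet> adjoint (L k) (v k)"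
    unfolding inner_adjoint(1)[OF L_bl[OF k]] by (rule inner_commute)
  also have "w k \<bullet> M k (y k) = y k \<bullet> adjoint (L k) (v k)"
    unfolding adj_eq[OF k] inner_adjoint(1)[OF M_bl[OF k]] by (rule inner_commute)
  finally show ?thesis by (simp add: inner_diff_left)
qed

text \<open>Both sides are compared with minus the primal value at \<open>x\<close>: Fenchel-Young
  bounds every dual value below by it, and the value at \<open>v\<close> is at most this bound. The
  duality gap is thus zero.\<close>

lemma dual_optimal:
  "infconv UNIV (conj UNIV f) (conj UNIV (\<lambda>u. ereal (ell u))) (z - (\<Sum>k\<in>{1..r}. adjoint (L k) (v k)))
      + (\<Sum>k\<in>{1..r}. conj (G k) (g k) (v k)
          + infpost (K k) (adjoint (M k)) (conj (K k) (h k)) (adjoint (L k) (v k)))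
    \<le> infconv UNIV (conj UNIV f) (conj UNIV (\<lambda>u. ereal (ell u))) (z - (\<Sum>k\<in>{1..r}. adjoint (L k) (v' k)))
      + (\<Sum>k\<in>{1..r}. conj (G k) (g k) (v' k)
          + infpost (K k) (adjoint (M k)) (conj (K k) (h k)) (adjoint (L k) (v' k)))"
proof -
  note fx = subdiff_real(3)[OF f_G0 sub_f]
  let ?a = "\<lambda>v. \<Sum>k\<in>{1..r}. adjoint (L k) (v k)" and ?f = "real_of_ereal (f x)"
  let ?I = "infconv UNIV (conj UNIV f) (conj UNIV (\<lambda>u. ereal (ell u)))"
  have "conj UNIV (\<lambda>u. ereal (ell u)) (gradl x) \<le> ereal (gradl x \<bullet> x - ell x)"
    unfolding conj_def
  proof (rule SUP_least)
    fix u
    show "ereal (gradl x \<bullet> u) - ereal (ell u) \<le> ereal (gradl x \<bullet> x - ell x)"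
      using ell_ge[of u] by (simp add: inner_diff_right)
  qed
  moreover have "conj UNIV f (z - ?a v - gradl x) = ereal ((z - ?a v - gradl x) \<bullet> x - ?f)"
    using conj_at_subgradient[OF f_G0 sub_f] by (simp add: algebra_simps)
  ultimately have "conj UNIV f (z - ?a v - gradl x) + conj UNIV (\<lambda>u. ereal (ell u)) (gradl x)
      \<le> ereal ((z - ?a v - gradl x) \<bullet> x - ?f) + ereal (gradl x \<bullet> x - ell x)"
    by (intro add_mono) simp_all
  moreover have "?I (z - ?a v) \<le> conj UNIV f (z - ?a v - gradl x) + conj UNIV (\<lambda>u. ereal (ell u)) (gradl x)"
    unfolding infconv_def by (rule INF_lower) simp
  ultimately have "?I (z - ?a v) \<le> ereal ((z - ?a v - gradl x) \<bullet> x - ?f) + ereal (gradl x \<bullet> x - ell x)"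
    by (rule order_trans[rotated])
  also have "\<dots> = ereal ((z - ?a v) \<bullet> x - ?f - ell x)"
    by (simp add: inner_diff_left)
  finally have I_le: "?I (z - ?a v) \<le> ereal ((z - ?a v) \<bullet> x - ?f - ell x)" .
  have I_ge: "ereal (u \<bullet> x - ?f - ell x) \<le> ?I u" for u
    unfolding infconv_def
  proof (rule INF_greatest)
    fix b
    have "ereal ((u - b) \<bullet> x - ?f) + ereal (b \<bullet> x - ell x) \<le> conj UNIV f (u - b) + conj UNIV (\<lambda>u. ereal (ell u)) b"
      using fx by (intro add_mono conj_ge_affine) auto
    moreover have "ereal (u \<bullet> x - ?f - ell x) = ereal ((u - b) \<bullet> x - ?f) + ereal (b \<bullet> x - ell x)"
      by (simp add: inner_diff_left)
    ultimately show "ereal (u \<bullet> x - ?f - ell x) \<le> conj UNIV f (u - b) + conj UNIV (\<lambda>u. ereal (ell u)) b"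
      by (rule ord_eq_le_trans[rotated])
  qed
  \<comment> \<open>The dual variable cancels between the two kinds of terms, so the lower bound is
    one constant for all dual points.\<close>
  have total: "(z - ?a v) \<bullet> x - ?f - ell x + (\<Sum>k\<in>{1..r}. x \<bullet> adjoint (L k) (v k) - value_gh k)
      = z \<bullet> x - ?f - ell x - (\<Sum>k\<in>{1..r}. value_gh k)" for v
  proof -
    have "(\<Sum>k\<in>{1..r}. x \<bullet> adjoint (L k) (v k) - value_gh k) = ?a v \<bullet> x - (\<Sum>k\<in>{1..r}. value_gh k)"
      by (simp only: sum_subtractf inner_sum_right inner_commute[of "?a v" x])
    then show ?thesis by (simp add: inner_diff_left)
  qed
  have "?I (z - ?a v) + (\<Sum>k\<in>{1..r}. conj (G k) (g k) (v k)
        + infpost (K k) (adjoint (M k)) (conj (K k) (h k)) (adjoint (L k) (v k)))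
      \<le> ereal ((z - ?a v) \<bullet> x - ?f - ell x) + (\<Sum>k\<in>{1..r}. ereal (x \<bullet> adjoint (L k) (v k) - value_gh k))"
    by (intro add_mono I_le sum_mono dual_term_le)
  also have "\<dots> = ereal ((z - ?a v') \<bullet> x - ?f - ell x) + (\<Sum>k\<in>{1..r}. ereal (x \<bullet> adjoint (L k) (v' k) - value_gh k))"
    unfolding sum_ereal plus_ereal.simps total ..
  also have "\<dots> \<le> ?I (z - ?a v') + (\<Sum>k\<in>{1..r}. conj (G k) (g k) (v' k)
        + infpost (K k) (adjoint (M k)) (conj (K k) (h k)) (adjoint (L k) (v' k)))"
    by (intro add_mono I_ge sum_mono dual_term_ge)
  finally show ?thesis .
qed

end

end

section \<open>Convergence of the algorithm\<close>

context parallel_sum_system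
begin

text \<open>The graph inner product splits into nonnegative contributions of \<open>f\<close>, the \<open>g\<^sub>k\<close>, the
  \<open>h\<^sub>k\<close> and the gradient, so each of them vanishes in the limit once their sum does.\<close>

lemma componentwise_monotonicity_limits:
  assumes zero: "- Bop (tuple r x y v w) \<in> Aop (tuple r x y v w)"
    and graph: "\<And>n. u n - Bop (P n) \<in> Aop (P n)"
    and lim: "(\<lambda>n. (P n - tuple r x y v w) \<bullet> u n) \<longlonglongrightarrow> 0"
  obtains a b c d a' c' where "\<And>n. P n = tuple r (a n) (\<lambda>k. b n k) (\<lambda>k. c n k) (\<lambda>k. d n k)"
    "\<And>n. a' n \<in> subdiff UNIV f (a n)"
    "\<And>n k. k \<in> {1..r} \<Longrightarrow> c n k \<in> subdiff (G k) (g k) (c' n k)"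
    "(\<lambda>n. (a n - x) \<bullet> (a' n - (z - gradl x - (\<Sum>k\<in>{1..r}. adjoint (L k) (v k))))) \<longlonglongrightarrow> 0"
    "(\<lambda>n. (a n - x) \<bullet> (gradl (a n) - gradl x)) \<longlonglongrightarrow> 0"
    "\<And>k. k \<in> {1..r} \<Longrightarrow> (\<lambda>n. (c n k - v k) \<bullet> (c' n k - L k (x - y k))) \<longlonglongrightarrow> 0"
proof -
  have "\<exists>a b c d a' c' d'. P n = tuple r a b c d \<and> u n - Bop (P n) = tuple r a' (\<lambda>_. 0) c' d' \<and>
      a' + z \<in> subdiff UNIV f a \<and>
      (\<forall>k\<in>{1..r}. c k \<in> subdiff (G k) (g k) (c' k) \<and> d k \<in> subdiff (K k) (h k) (d' k))" for n
    using graph[of n] unfolding Aop_def by simp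
  then obtain a b c d a' c' d' where P: "\<And>n. P n = tuple r (a n) (b n) (c n) (d n)"
    and U: "\<And>n. u n - Bop (P n) = tuple r (a' n) (\<lambda>_. 0) (c' n) (d' n)"
    and sub: "\<And>n. a' n + z \<in> subdiff UNIV f (a n)"
      "\<And>n. \<forall>k\<in>{1..r}. c n k \<in> subdiff (G k) (g k) (c' n k) \<and> d n k \<in> subdiff (K k) (h k) (d' n k)"
    by metis
  let ?s = "\<Sum>k\<in>{1..r}. adjoint (L k) (v k)"
  have z: "z - gradl x - ?s \<in> subdiff UNIV f x"
    "\<And>k. k \<in> {1..r} \<Longrightarrow> adjoint (L k) (v k) = adjoint (M k) (w k)"
    "\<And>k. k \<in> {1..r} \<Longrightarrow> v k \<in> subdiff (G k) (g k) (L k (x - y k))"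
    "\<And>k. k \<in> {1..r} \<Longrightarrow> w k \<in> subdiff (K k) (h k) (M k (y k))"
    using zero unfolding zero_tuple_iff by auto
  have negB: "- Bop (tuple r x y v w) = tuple r (- gradl x - ?s) (\<lambda>_. 0) (\<lambda>k. L k (x - y k)) (\<lambda>k. M k (y k))"
    unfolding Bop_tuple_components tuple_uminus tuple_eq_iff using z(2) by simp
  define \<alpha> \<delta> where "\<alpha> n = (a n - x) \<bullet> (a' n + z - (z - gradl x - ?s))"
    and "\<delta> n = (a n - x) \<bullet> (gradl (a n) - gradl x)" for n
  define \<kappa> \<nu> where "\<kappa> n k = (c n k - v k) \<bullet> (c' n k - L k (x - y k))"
    and "\<nu> n k = (d n k - w k) \<bullet> (d' n k - M k (y k))" for n k
  have \<alpha>0: "0 \<le> \<alpha> n" for n unfolding \<alpha>_def by (rule subdiff_monotone[OF f_G0 sub(1) z(1)])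
  have \<delta>0: "0 \<le> \<delta> n" for n unfolding \<delta>_def by (rule grad_mono)
  have \<kappa>0: "0 \<le> \<kappa> n k" if k: "k \<in> {1..r}" for n k
    unfolding \<kappa>_def using subdiff_monotone[OF g_G0[OF k], of "c n k" "c' n k" "v k" "L k (x - y k)"] sub(2) z(3) k
    by (simp add: inner_commute)
  have \<nu>0: "0 \<le> \<nu> n k" if k: "k \<in> {1..r}" for n k
    unfolding \<nu>_def using subdiff_monotone[OF h_G0[OF k], of "d n k" "d' n k" "w k" "M k (y k)"] sub(2) z(4) k
    by (simp add: inner_commute)
  have total: "(P n - tuple r x y v w) \<bullet> u n = \<alpha> n + (\<Sum>k\<in>{1..r}. \<kappa> n k + \<nu> n k) + \<delta> n" for n
  proof -
    \<comment> \<open>The first bracket compares graph values of A and separates by rows; in the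
      second the skew coupling drops out and the gradient product remains.\<close>
    have "u n = ((u n - Bop (P n)) - (- Bop (tuple r x y v w))) + (Bop (P n) - Bop (tuple r x y v w))" by simp
    then have "(P n - tuple r x y v w) \<bullet> u n
        = (P n - tuple r x y v w) \<bullet> ((u n - Bop (P n)) - (- Bop (tuple r x y v w)))
          + (P n - tuple r x y v w) \<bullet> (Bop (P n) - Bop (tuple r x y v w))"
      by (metis inner_add_right)
    also have "(P n - tuple r x y v w) \<bullet> ((u n - Bop (P n)) - (- Bop (tuple r x y v w)))
        = \<alpha> n + (\<Sum>k\<in>{1..r}. \<kappa> n k + \<nu> n k)"
      unfolding U negB unfolding P Aop_inner_diff \<alpha>_def \<kappa>_def \<nu>_def by (simp add: algebra_simps)
    also have "(P n - tuple r x y v w) \<bullet> (Bop (P n) - Bop (tuple r x y v w)) = \<delta> n"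
      unfolding P Bop_inner_diff \<delta>_def ..
    finally show ?thesis .
  qed
  have sum0: "0 \<le> (\<Sum>k\<in>{1..r}. \<kappa> n k + \<nu> n k)" for n
    using \<kappa>0 \<nu>0 by (intro sum_nonneg add_nonneg_nonneg)
  have squeeze: "e \<longlonglongrightarrow> 0" if "\<And>n. 0 \<le> e n" "\<And>n. e n \<le> \<alpha> n + (\<Sum>k\<in>{1..r}. \<kappa> n k + \<nu> n k) + \<delta> n" for e
    by (rule tendsto_sandwich[OF _ _ tendsto_const lim[unfolded total]]) (use that in auto)
  have "\<alpha> \<longlonglongrightarrow> 0" using \<alpha>0 \<delta>0 sum0 by (intro squeeze) (auto intro: add_increasing2)
  moreover have "\<delta> \<longlonglongrightarrow> 0" using \<alpha>0 \<delta>0 sum0 by (intro squeeze) (auto intro: add_increasing)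
  moreover have "(\<lambda>n. \<kappa> n k) \<longlonglongrightarrow> 0" if k: "k \<in> {1..r}" for k
  proof (rule squeeze[OF \<kappa>0[OF k]])
    fix n
    have "\<kappa> n k \<le> \<kappa> n k + \<nu> n k" using \<nu>0[OF k] by simp
    also have "\<dots> \<le> (\<Sum>k\<in>{1..r}. \<kappa> n k + \<nu> n k)"
      using \<kappa>0 \<nu>0 by (intro member_le_sum[OF k] add_nonneg_nonneg) auto
    finally show "\<kappa> n k \<le> \<alpha> n + (\<Sum>k\<in>{1..r}. \<kappa> n k + \<nu> n k) + \<delta> n"
      using \<alpha>0[of n] \<delta>0[of n] by linarith
  qed
  ultimately show thesis
    using P sub unfolding \<alpha>_def \<delta>_def \<kappa>_def by (intro that[of a b c d "\<lambda>n. a' n + z" c']) auto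
qed

end

text \<open>A value of the parallel sum at \<open>x\<close> is a common value of both operators at
  two points with sum \<open>x\<close>; the second point becomes the auxiliary variable
  \<open>y k\<close>.\<close>

lemma op_parsum_composeD:
  assumes "b \<in> op_parsum (op_compose L A) (op_compose M B) x"
  obtains y v w where "v \<in> A (L (x - y))" "w \<in> B (M y)" "b = adjoint L v" "b = adjoint M w"
proof -
  obtain u y where "x = u + y" and b: "b \<in> adjoint L ` A (L u)" "b \<in> adjoint M ` B (M y)"
    using assms unfolding op_parsum_def op_inv_def op_add_def op_compose_def by auto
  then have "u = x - y" by simp
  with b show thesis by (auto elim!: imageE intro: that)
qed

theorem theorem4p3:
  fixes r :: nat
    and z :: "'h::{real_inner,complete_space}"
    and f :: "'h \<Rightarrow> ereal"
    and ell :: "'h \<Rightarrow> real" and gradl :: "'h \<Rightarrow> 'h" and mu :: real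
    and G :: "nat \<Rightarrow> 'g::{real_inner,complete_space} set"
    and K :: "nat \<Rightarrow> 'k::{real_inner,complete_space} set"
    and g :: "nat \<Rightarrow> 'g \<Rightarrow> ereal" and h :: "nat \<Rightarrow> 'k \<Rightarrow> ereal"
    and L :: "nat \<Rightarrow> 'h \<Rightarrow> 'g" and M :: "nat \<Rightarrow> 'h \<Rightarrow> 'k"
    and beta eps :: real and gamma :: "nat \<Rightarrow> real"
    and x s11 p11 q11 :: "nat \<Rightarrow> 'h"
    and y p1 q1 :: "nat \<Rightarrow> nat \<Rightarrow> 'h"
    and v s2 p2 q2 :: "nat \<Rightarrow> nat \<Rightarrow> 'g"
    and w s2r p2r q2r :: "nat \<Rightarrow> nat \<Rightarrow> 'k"
  assumes r_pos: "r \<ge> 1"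
    and f_G0: "Gamma0 UNIV f"
    and ell_diff: "\<forall>u. (ell has_derivative (\<lambda>d. gradl u \<bullet> d)) (at u)"
    and ell_convex: "convex_on UNIV ell"
    and mu_nonneg: "mu \<ge> 0"
    and grad_lip: "\<forall>u u'. norm (gradl u - gradl u') \<le> mu * norm (u - u')"
    and G_hilb: "\<forall>k\<in>{1..r}. hilbert_sub (G k)"
    and K_hilb: "\<forall>k\<in>{1..r}. hilbert_sub (K k)"
    and g_G0: "\<forall>k\<in>{1..r}. Gamma0 (G k) (g k)"
    and h_G0: "\<forall>k\<in>{1..r}. Gamma0 (K k) (h k)"
    and L_bl: "\<forall>k\<in>{1..r}. bounded_linear (L k) \<and> (\<forall>u. L k u \<in> G k)"
    and M_bl: "\<forall>k\<in>{1..r}. bounded_linear (M k) \<and> (\<forall>u. M k u \<in> K k)"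
    and beta_def: "beta = mu + sqrt ((\<Sum>k\<in>{1..r}. (onorm (L k))\<^sup>2)
                     + Max ((\<lambda>k. (onorm (L k))\<^sup>2 + (onorm (M k))\<^sup>2) ` {1..r}))"
    and beta_pos: "beta > 0"
    and sri1: "\<forall>k\<in>{1..r}. 0 \<in> sri (set_diff (edom UNIV (conj UNIV (\<lambda>u. g k (L k u))))
                                         (adjoint (M k) ` edom (K k) (conj (K k) (h k))))"
    and sri2: "\<forall>k\<in>{1..r}. 0 \<in> sri (set_diff (range (M k)) (edom (K k) (h k)))"
    and range_cond: "z \<in> op_ran (op_add (op_add (subdiff UNIV f)
              (op_sum {1..r} (\<lambda>k. op_parsum (op_compose (L k) (subdiff (G k) (g k)))
                                              (op_compose (M k) (subdiff (K k) (h k))))))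
              (\<lambda>u. {gradl u}))"
    and init_v: "\<forall>k\<in>{1..r}. v k 0 \<in> G k"
    and init_w: "\<forall>k\<in>{1..r}. w k 0 \<in> K k"
    and eps_range: "0 < eps" "eps < 1 / (beta + 1)"
    and gamma_range: "\<forall>n. eps \<le> gamma n \<and> gamma n \<le> (1 - eps) / beta"
    and in_G: "\<forall>k\<in>{1..r}. \<forall>n. s2 k n \<in> G k \<and> p2 k n \<in> G k \<and> q2 k n \<in> G k"
    and in_K: "\<forall>k\<in>{1..r}. \<forall>n. s2r k n \<in> K k \<and> p2r k n \<in> K k \<and> q2r k n \<in> K k"
    and err_s11: "summable (\<lambda>n. norm (s11 n -
              (x n - gamma n *\<^sub>R (gradl (x n) + (\<Sum>k\<in>{1..r}. adjoint (L k) (v k n))))))"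
    and err_p11: "summable (\<lambda>n. norm (p11 n -
              prox UNIV (\<lambda>u. ereal (gamma n) * f u) (s11 n + gamma n *\<^sub>R z)))"
    and err_p1: "\<forall>k\<in>{1..r}. summable (\<lambda>n. norm (p1 k n -
              (y k n + gamma n *\<^sub>R (adjoint (L k) (v k n) - adjoint (M k) (w k n)))))"
    and err_s2: "\<forall>k\<in>{1..r}. summable (\<lambda>n. norm (s2 k n -
              (v k n + gamma n *\<^sub>R L k (x n - y k n))))"
    and err_p2: "\<forall>k\<in>{1..r}. summable (\<lambda>n. norm (p2 k n -
              (s2 k n - gamma n *\<^sub>R prox (G k) (\<lambda>u. ereal (1 / gamma n) * g k u)
                                            ((1 / gamma n) *\<^sub>R s2 k n))))"
    and err_q2: "\<forall>k\<in>{1..r}. summable (\<lambda>n. norm (q2 k n -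
              (p2 k n + gamma n *\<^sub>R L k (p11 n - p1 k n))))"
    and upd_v: "\<forall>k\<in>{1..r}. \<forall>n. v k (Suc n) = v k n - s2 k n + q2 k n"
    and err_s2r: "\<forall>k\<in>{1..r}. summable (\<lambda>n. norm (s2r k n -
              (w k n + gamma n *\<^sub>R M k (y k n))))"
    and err_p2r: "\<forall>k\<in>{1..r}. summable (\<lambda>n. norm (p2r k n -
              (s2r k n - gamma n *\<^sub>R prox (K k) (\<lambda>u. ereal (1 / gamma n) * h k u)
                                             ((1 / gamma n) *\<^sub>R s2r k n))))"
    and err_q1: "\<forall>k\<in>{1..r}. summable (\<lambda>n. norm (q1 k n -
              (p1 k n + gamma n *\<^sub>R (adjoint (L k) (p2 k n) - adjoint (M k) (p2r k n)))))"
    and err_q2r: "\<forall>k\<in>{1..r}. summable (\<lambda>n. norm (q2r k n -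
              (p2r k n + gamma n *\<^sub>R M k (p1 k n))))"
    and upd_w: "\<forall>k\<in>{1..r}. \<forall>n. w k (Suc n) = w k n - s2r k n + q2r k n"
    and err_q11: "summable (\<lambda>n. norm (q11 n -
              (p11 n - gamma n *\<^sub>R (gradl (p11 n) + (\<Sum>k\<in>{1..r}. adjoint (L k) (p2 k n))))))"
    and upd_x: "\<forall>n. x (Suc n) = x n - s11 n + q11 n"
    and upd_y: "\<forall>k\<in>{1..r}. \<forall>n. y k (Suc n) = y k n - p1 k n + q1 k n"
  shows "\<exists>xbar :: 'h. \<exists>vbar :: nat \<Rightarrow> 'g.
     (\<forall>xx. f xbar + (\<Sum>k\<in>{1..r}. infconv UNIV (\<lambda>u. g k (L k u)) (\<lambda>u. h k (M k u)) xbar)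
              + ereal (ell xbar - xbar \<bullet> z)
          \<le> f xx + (\<Sum>k\<in>{1..r}. infconv UNIV (\<lambda>u. g k (L k u)) (\<lambda>u. h k (M k u)) xx)
              + ereal (ell xx - xx \<bullet> z)) \<and>
     (\<forall>k\<in>{1..r}. vbar k \<in> G k) \<and>
     (\<forall>vv :: nat \<Rightarrow> 'g. (\<forall>k\<in>{1..r}. vv k \<in> G k) \<longrightarrow>
        infconv UNIV (conj UNIV f) (conj UNIV (\<lambda>u. ereal (ell u)))
            (z - (\<Sum>k\<in>{1..r}. adjoint (L k) (vbar k)))
          + (\<Sum>k\<in>{1..r}. conj (G k) (g k) (vbar k)
               + infpost (K k) (adjoint (M k)) (conj (K k) (h k)) (adjoint (L k) (vbar k)))
        \<le> infconv UNIV (conj UNIV f) (conj UNIV (\<lambda>u. ereal (ell u)))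
            (z - (\<Sum>k\<in>{1..r}. adjoint (L k) (vv k)))
          + (\<Sum>k\<in>{1..r}. conj (G k) (g k) (vv k)
               + infpost (K k) (adjoint (M k)) (conj (K k) (h k)) (adjoint (L k) (vv k)))) \<and>
     weak_conv UNIV x xbar \<and>
     (\<forall>k\<in>{1..r}. weak_conv (G k) (\<lambda>n. v k n) (vbar k)) \<and>
     ((unif_convex_at UNIV f xbar \<or> unif_convex_at UNIV (\<lambda>u. ereal (ell u)) xbar)
        \<longrightarrow> x \<longlonglongrightarrow> xbar) \<and>
     (\<forall>k\<in>{1..r}. unif_convex_at (G k) (conj (G k) (g k)) (vbar k)
        \<longrightarrow> (\<lambda>n. v k n) \<longlonglongrightarrow> vbar k)"
proof -
  have ell_ge: "ell u + gradl u \<bullet> (u' - u) \<le> ell u'" for u u'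
    by (rule convex_gradient_le[OF ell_diff[rule_format] ell_convex])
  interpret parallel_sum_system r z f gradl mu G K g h L M
  proof (rule parallel_sum_system.intro)
    show "0 \<le> (u - u') \<bullet> (gradl u - gradl u')" for u u'
      using ell_ge[of u u'] ell_ge[of u' u] by (simp add: inner_diff_left inner_diff_right inner_commute)
  qed (rule r_pos f_G0 mu_nonneg grad_lip[rule_format] G_hilb[rule_format] K_hilb[rule_format]
      g_G0[rule_format] h_G0[rule_format] L_bl[THEN bspec, THEN conjunct1]
      M_bl[THEN bspec, THEN conjunct1] L_bl[THEN bspec, THEN conjunct2, rule_format]
      M_bl[THEN bspec, THEN conjunct2, rule_format]; assumption?)+
  have beta: "beta = mu + tau" by (simp add: beta_def tau_def)
  have "0 < mu + tau" using beta_pos beta by simp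
  from monotone_lipschitz_inclusion_system[OF this]
  interpret inclusion: monotone_lipschitz_inclusion "tuple_space r G K" Aop Bop "mu + tau" .
  \<comment> \<open>The range condition becomes a zero of the inclusion, which serves as reference
    point for the Fejer estimates.\<close>
  obtain x0 y0 v0 w0 where zero: "- Bop (tuple r x0 y0 v0 w0) \<in> Aop (tuple r x0 y0 v0 w0)"
  proof -
    obtain x0 a b where ab: "z = a + (\<Sum>k\<in>{1..r}. b k) + gradl x0" "a \<in> subdiff UNIV f x0"
      and b: "\<forall>k\<in>{1..r}. b k \<in> op_parsum (op_compose (L k) (subdiff (G k) (g k)))
        (op_compose (M k) (subdiff (K k) (h k))) x0"
      using range_cond unfolding op_ran_def op_add_def op_sum_def by auto
    have "\<forall>k\<in>{1..r}. \<exists>y v w. v \<in> subdiff (G k) (g k) (L k (x0 - y)) \<and> w \<in> subdiff (K k) (h k) (M k y) \<and>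
        b k = adjoint (L k) v \<and> b k = adjoint (M k) w"
      using b by (metis op_parsum_composeD)
    then obtain y0 v0 w0 where s: "\<And>k. k \<in> {1..r} \<Longrightarrow> v0 k \<in> subdiff (G k) (g k) (L k (x0 - y0 k)) \<and>
        w0 k \<in> subdiff (K k) (h k) (M k (y0 k)) \<and> b k = adjoint (L k) (v0 k) \<and> b k = adjoint (M k) (w0 k)"
      by metis
    have "(\<Sum>k\<in>{1..r}. b k) = (\<Sum>k\<in>{1..r}. adjoint (L k) (v0 k))"
      using s by (intro sum.cong) auto
    with ab have "z - gradl x0 - (\<Sum>k\<in>{1..r}. adjoint (L k) (v0 k)) \<in> subdiff UNIV f x0" by simp
    moreover have "adjoint (L k) (v0 k) = adjoint (M k) (w0 k)" if "k \<in> {1..r}" for k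
      using s[OF that] by metis
    ultimately show thesis using s by (intro that[of x0 y0 v0 w0]) (simp add: zero_tuple_iff)
  qed
  define Z where "Z n = tuple r (x n) (\<lambda>k. y k n) (\<lambda>k. v k n) (\<lambda>k. w k n)" for n
  \<comment> \<open>\<open>s\<close>, \<open>p\<close> and \<open>J\<close> share the y-parts
    \<open>p1\<close>, since the resolvent is the identity there; the y-part of
    \<open>p n - J n\<close> is therefore 0 and carries no error.\<close>
  define s where "s n = tuple r (s11 n) (\<lambda>k. p1 k n) (\<lambda>k. s2 k n) (\<lambda>k. s2r k n)" for n
  define p where "p n = tuple r (p11 n) (\<lambda>k. p1 k n) (\<lambda>k. p2 k n) (\<lambda>k. p2r k n)" for n
  define q where "q n = tuple r (q11 n) (\<lambda>k. q1 k n) (\<lambda>k. q2 k n) (\<lambda>k. q2r k n)" for n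
  define J where "J n = tuple r (prox UNIV (\<lambda>u. ereal (gamma n) * f u) (s11 n + gamma n *\<^sub>R z)) (\<lambda>k. p1 k n)
      (\<lambda>k. s2 k n - gamma n *\<^sub>R prox (G k) (\<lambda>u. ereal (1 / gamma n) * g k u) ((1 / gamma n) *\<^sub>R s2 k n))
      (\<lambda>k. s2r k n - gamma n *\<^sub>R prox (K k) (\<lambda>u. ereal (1 / gamma n) * h k u) ((1 / gamma n) *\<^sub>R s2r k n))" for n
  have gamma: "eps \<le> gamma n" "gamma n * (mu + tau) \<le> 1 - eps" "0 < gamma n" for n
    using gamma_range[rule_format, of n] eps_range(1) beta_pos beta by (auto simp: pos_le_divide_eq)
  have err1: "summable (\<lambda>n. norm (s n - (Z n - gamma n *\<^sub>R Bop (Z n))))"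
  proof -
    have "s n - (Z n - gamma n *\<^sub>R Bop (Z n)) = tuple r
        (s11 n - (x n - gamma n *\<^sub>R (gradl (x n) + (\<Sum>k\<in>{1..r}. adjoint (L k) (v k n)))))
        (\<lambda>k. p1 k n - (y k n + gamma n *\<^sub>R (adjoint (L k) (v k n) - adjoint (M k) (w k n))))
        (\<lambda>k. s2 k n - (v k n + gamma n *\<^sub>R L k (x n - y k n)))
        (\<lambda>k. s2r k n - (w k n + gamma n *\<^sub>R M k (y k n)))" for n
      unfolding s_def Z_def Bop_tuple_components tuple_scaleR tuple_diff tuple_eq_iff
      by (simp add: scaleR_diff_right)
    then show ?thesis using err_s11 err_p1 err_s2 err_s2r by (simp only:) (intro summable_tuple_norm, auto)
  qed
  have err2: "summable (\<lambda>n. norm (p n - J n))"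
    unfolding p_def J_def tuple_diff
    by (intro summable_tuple_norm) (use err_p11 err_p2 err_p2r in auto)
  have err3: "summable (\<lambda>n. norm (q n - (p n - gamma n *\<^sub>R Bop (p n))))"
  proof -
    have "q n - (p n - gamma n *\<^sub>R Bop (p n)) = tuple r
        (q11 n - (p11 n - gamma n *\<^sub>R (gradl (p11 n) + (\<Sum>k\<in>{1..r}. adjoint (L k) (p2 k n)))))
        (\<lambda>k. q1 k n - (p1 k n + gamma n *\<^sub>R (adjoint (L k) (p2 k n) - adjoint (M k) (p2r k n))))
        (\<lambda>k. q2 k n - (p2 k n + gamma n *\<^sub>R L k (p11 n - p1 k n)))
        (\<lambda>k. q2r k n - (p2r k n + gamma n *\<^sub>R M k (p1 k n)))" for n
      unfolding q_def p_def Bop_tuple_components tuple_scaleR tuple_diff tuple_eq_iff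
      by (simp add: scaleR_diff_right)
    then show ?thesis using err_q11 err_q1 err_q2 err_q2r by (simp only:) (intro summable_tuple_norm, auto)
  qed
  have mem: "Z 0 \<in> tuple_space r G K" "s n \<in> tuple_space r G K" "p n \<in> tuple_space r G K" "q n \<in> tuple_space r G K" for n
    using init_v init_w in_G in_K by (auto simp: Z_def s_def p_def q_def tuple_mem_space_iff)
  have res: "(1 / gamma n) *\<^sub>R (s n - J n) \<in> Aop (J n)" for n
    unfolding s_def J_def by (rule resolvent_tuple[OF gamma(3)]) (use in_G in_K in auto)
  have upd: "Z (Suc n) = Z n - s n + q n" for n
    unfolding Z_def s_def q_def tuple_diff tuple_add tuple_eq_iff using upd_x upd_y upd_v upd_w by simp
  obtain Z' P u where Z': "- Bop Z' \<in> Aop Z'" and weak: "weak_conv (tuple_space r G K) Z Z'"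
    and graph: "\<And>n. u n - Bop (P n) \<in> Aop (P n)" and PZ: "(\<lambda>n. P n - Z n) \<longlonglongrightarrow> 0"
    and Pu: "(\<lambda>n. (P n - Z') \<bullet> u n) \<longlonglongrightarrow> 0"
    by (rule inclusion.forward_backward_forward_weak_convergence[OF zero eps_range(1)
          gamma(1,2) mem res err1 err2 err3 upd]) (rule that; assumption)
  obtain xbar ybar vbar wbar where Z'_eq: "Z' = tuple r xbar ybar vbar wbar"
    using inclusion.A_carrier[OF Z'] by (rule tuple_space_cases)
  note zero' = Z'[unfolded Z'_eq]
  obtain a b c d a' c' where P_eq: "\<And>n. P n = tuple r (a n) (\<lambda>k. b n k) (\<lambda>k. c n k) (\<lambda>k. d n k)"
    and sub: "\<And>n. a' n \<in> subdiff UNIV f (a n)" "\<And>n k. k \<in> {1..r} \<Longrightarrow> c n k \<in> subdiff (G k) (g k) (c' n k)"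
    and lims: "(\<lambda>n. (a n - xbar) \<bullet> (a' n - (z - gradl xbar - (\<Sum>k\<in>{1..r}. adjoint (L k) (vbar k))))) \<longlonglongrightarrow> 0"
      "(\<lambda>n. (a n - xbar) \<bullet> (gradl (a n) - gradl xbar)) \<longlonglongrightarrow> 0"
      "\<And>k. k \<in> {1..r} \<Longrightarrow> (\<lambda>n. (c n k - vbar k) \<bullet> (c' n k - L k (xbar - ybar k))) \<longlonglongrightarrow> 0"
    by (rule componentwise_monotonicity_limits[OF zero' graph Pu[unfolded Z'_eq]]) (rule that; assumption)
  \<comment> \<open>The exact backward points approach the iterates in every coordinate, so strong
    convergence may be proved for \<open>a\<close> and \<open>c\<close> instead.\<close>
  have ax: "(\<lambda>n. a n - x n) \<longlonglongrightarrow> 0" and cv: "\<And>k. k \<in> {1..r} \<Longrightarrow> (\<lambda>n. c n k - v k n) \<longlonglongrightarrow> 0"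
  proof -
    have le: "norm (a n - x n) \<le> norm (P n - Z n)" "k \<in> {1..r} \<Longrightarrow> norm (c n k - v k n) \<le> norm (P n - Z n)" for n k
      unfolding P_eq Z_def tuple_diff by (rule tuple_component_norm_le)+
    show "(\<lambda>n. a n - x n) \<longlonglongrightarrow> 0"
      by (rule Lim_null_comparison[OF _ tendsto_norm_zero[OF PZ]]) (use le in auto)
    show "(\<lambda>n. c n k - v k n) \<longlonglongrightarrow> 0" if "k \<in> {1..r}" for k
      by (rule Lim_null_comparison[OF _ tendsto_norm_zero[OF PZ]]) (use le that in auto)
  qed
  note weak_components = weak_conv_tuple_components[OF weak[unfolded Z_def Z'_eq] subspace_G subspace_K]
  have strong_x: "x \<longlonglongrightarrow> xbar" if "a \<longlonglongrightarrow> xbar"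
    using tendsto_diff[OF that ax] by simp
  note sub_xv = sub_f[OF zero' ell_ge] sub_g[OF zero' ell_ge]
  have "x \<longlonglongrightarrow> xbar" if "unif_convex_at UNIV f xbar"
    using unif_convex_at_tendsto[OF subspace_UNIV that _ sub_xv(1) sub(1) lims(1)] Gamma0_not_MInf[OF f_G0, of xbar]
    by (intro strong_x) simp
  \<comment> \<open>The gradient is a subgradient of \<open>ell\<close>, so the same criterion
    applies to the gradient product.\<close>
  moreover have "x \<longlonglongrightarrow> xbar" if uc: "unif_convex_at UNIV (\<lambda>u. ereal (ell u)) xbar"
  proof (rule strong_x, rule unif_convex_at_tendsto[OF subspace_UNIV uc _ _ _ lims(2)])
    show "gradl xbar \<in> subdiff UNIV (\<lambda>u. ereal (ell u)) xbar" "gradl (a n) \<in> subdiff UNIV (\<lambda>u. ereal (ell u)) (a n)" for n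
      using ell_ge by (auto simp: subdiff_def inner_commute add.commute)
  qed simp
  moreover have "(\<lambda>n. v k n) \<longlonglongrightarrow> vbar k"
    if k: "k \<in> {1..r}" and uc: "unif_convex_at (G k) (conj (G k) (g k)) (vbar k)" for k
  proof -
    have "(\<lambda>n. c n k) \<longlonglongrightarrow> vbar k"
    \<comment> \<open>For the conjugate, point and subgradient change roles: \<open>c n k\<close> is
      the point and \<open>c' n k\<close> a subgradient there.\<close>
    proof (rule unif_convex_at_tendsto[OF subspace_G[OF k] uc _ _ _ lims(3)[OF k]])
      show "L k (xbar - ybar k) \<in> subdiff (G k) (conj (G k) (g k)) (vbar k)"
        by (rule subdiff_conj[OF g_G0[OF k] sub_xv(2)[OF k]])
      show "c' n k \<in> subdiff (G k) (conj (G k) (g k)) (c n k)" for n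
        by (rule subdiff_conj[OF g_G0[OF k] sub(2)[OF k]])
      show "conj (G k) (g k) (vbar k) \<noteq> -\<infinity>"
        by (simp add: conj_at_subgradient[OF g_G0[OF k] sub_xv(2)[OF k]])
    qed
    from tendsto_diff[OF this cv[OF k]] show ?thesis by simp
  qed
  moreover have "vbar k \<in> G k" if "k \<in> {1..r}" for k
    using subdiff_real(2)[OF g_G0[OF that] sub_xv(2)[OF that]] .
  ultimately show ?thesis
    using primal_optimal[OF zero' ell_ge] dual_optimal[OF zero' ell_ge] weak_components
    by (intro exI[of _ xbar] exI[of _ vbar]) blast
qed

end
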